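(* Let $N\ge2$. The ad-invariant generating functionals on $\mathrm{Pol}(O_N^+)$ are precisely the functionals of the form $$\hat L=L\circ\widetilde{\mathrm{ad}}_h,$$ with $L$ defined on $\mathrm{Pol}_0(O_N^+)\cong\mathrm{Pol}([-N,N])$ by $$Lf=-bf'(N)+\int_{-N}^N\frac{f(x)-f(N)}{N-x}\,\mathrm{d}\nu(x),$$ where $b\ge0$ is a real number and $\nu$ is a finite (positive) measure on $[-N,N]$ with $\nu(\{N\})=0$.
   Context: The free orthogonal quantum group $O_N^+$: $C_u(O_N^+)$ is the universal unital $C^*$-algebra generated by $N^2$ self-adjoint elements $v_{jk}$ with $\sum_\ell v_{\ell j}v_{\ell k}=\delta_{jk}=\sum_\ell v_{j\ell}v_{k\ell}$, and $\Delta(v_{jk})=\sum_\ell v_{j\ell}\otimes v_{\ell k}$. $\mathrm{Pol}(O_N^+)$ is the Hopf $*$-algebra generated by the $v_{jk}$, with counit $\varepsilon(v_{jk})=\delta_{jk}$, antipode $S(v_{jk})=v_{kj}$, and Haar state $h$ (a trace; Kac type). A generating functional on $\mathrm{Pol}(O_N^+)$ is a hermitian linear functional $\phi$ with $\phi(1)=0$ and $\phi(a^*a)\ge0$ for $a\in\ker\varepsilon$. A functional $\phi$ is ad-invariant if $(\mathrm{id}\otimes\phi)\circ\mathrm{ad}=\phi(\cdot)\mathbf{1}$, where $\mathrm{ad}(a)=a_{(1)}S(a_{(3)})\otimes a_{(2)}$ (Sweedler notation). The irreducible unitary corepresentations $u^{(s)}$ are indexed by $s\in\mathbb{N}=\{0,1,2,\dots\}$,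 with $u^{(0)}=\mathbf 1$, $u^{(1)}=(v_{jk})$, and fusion rules $u^{(s)}\otimes u^{(t)}\cong u^{(|s-t|)}\oplus u^{(|s-t|+2)}\oplus\cdots\oplus u^{(s+t)}$. Let $U_s$ be the Chebyshev polynomials of the second kind, normalized by $U_0(x)=1$, $U_1(x)=x$, $U_{s+1}(x)=xU_s(x)-U_{s-1}(x)$; then $\dim u^{(s)}=U_s(N)$. Let $\chi_s=\sum_ju^{(s)}_{jj}$. The algebra of central polynomial functions is $\mathrm{Pol}_0(O_N^+)=\mathrm{span}\{\chi_s:s\in\mathbb{N}\}$; it is identified with the algebra $\mathrm{Pol}([-N,N])$ of polynomials on $[-N,N]$ by the isomorphism $\chi_s\mapsto U_s$. The map $\widetilde{\mathrm{ad}}_h:\mathrm{Pol}(O_N^+)\to\mathrm{Pol}_0(O_N^+)$ is $\widetilde{\mathrm{ad}}_h=(h\otimes\mathrm{id})\circ\mathrm{ad}$, i.e. $\widetilde{\mathrm{ad}}_h(u^{(s)}_{jk})=\frac{\delta_{jk}}{U_s(N)}\chi_s$. *)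

theory Defs
  imports
    "HOL-Analysis.Analysis"
    "HOL-Library.Poly_Mapping"
    "HOL-Computational_Algebra.Polynomial"
begin

section \<open>Complex vector spaces and complex unital algebras\<close>

class complex_vector = ab_group_add +
  fixes scaleC :: "complex \<Rightarrow> 'a \<Rightarrow> 'a"  (infixr "*\<^sub>C" 75)
  assumes scaleC_add_right: "c *\<^sub>C (x + y) = c *\<^sub>C x + c *\<^sub>C y"
    and scaleC_add_left: "(c + d) *\<^sub>C x = c *\<^sub>C x + d *\<^sub>C x"
    and scaleC_scaleC: "c *\<^sub>C d *\<^sub>C x = (c * d) *\<^sub>C x"
    and scaleC_one [simp]: "1 *\<^sub>C x = x"

interpretation complex_vector: vector_space "scaleC :: complex \<Rightarrow> 'a \<Rightarrow> 'a::complex_vector"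
  by unfold_locales (simp_all add: scaleC_add_right scaleC_add_left scaleC_scaleC)

class complex_unital_algebra = complex_vector + ring + monoid_mult +
  assumes mult_scaleC_left: "(c *\<^sub>C x) * y = c *\<^sub>C (x * y)"
    and mult_scaleC_right: "x * (c *\<^sub>C y) = c *\<^sub>C (x * y)"

instantiation complex :: complex_unital_algebra
begin
definition scaleC_complex :: "complex \<Rightarrow> complex \<Rightarrow> complex" where "scaleC_complex c x = c * x"
instance by standard (simp_all add: scaleC_complex_def algebra_simps)
end

abbreviation clinear :: "('a::complex_vector \<Rightarrow> 'b::complex_vector) \<Rightarrow> bool" where
  "clinear \<equiv> Vector_Spaces.linear scaleC scaleC"

lemma clinear_iff:
  "clinear f \<longleftrightarrow> (\<forall>x y. f (x + y) = f x + f y) \<and> (\<forall>c x. f (c *\<^sub>C x) = c *\<^sub>C f x)"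
  by (auto simp: Vector_Spaces.linear_def module_hom_def module_hom_axioms_def
      complex_vector.vector_space_axioms complex_vector.module_axioms)


section \<open>Finite formal combinations\<close>

text \<open>The (semi)linear extension of \<open>G\<close> to finite formal complex combinations; the map
  \<open>\<sigma>\<close> is the identity or complex conjugation.\<close>

definition lin_ext :: "(complex \<Rightarrow> complex) \<Rightarrow> ('k \<Rightarrow> 'a::complex_vector) \<Rightarrow> ('k \<Rightarrow>\<^sub>0 complex) \<Rightarrow> 'a" where
  "lin_ext \<sigma> G p = (\<Sum>k\<in>Poly_Mapping.keys p. \<sigma> (Poly_Mapping.lookup p k) *\<^sub>C G k)"

definition field_hom :: "(complex \<Rightarrow> complex) \<Rightarrow> bool" where
  "field_hom \<sigma> \<longleftrightarrow> \<sigma> 1 = 1 \<and> (\<forall>x y. \<sigma> (x + y) = \<sigma> x + \<sigma> y) \<and> (\<forall>x y. \<sigma> (x * y) = \<sigma> x * \<sigma> y)"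

lemma field_hom_id: "field_hom (\<lambda>x. x)" and field_hom_cnj: "field_hom cnj"
  by (auto simp: field_hom_def)

lemma field_hom_0: "field_hom \<sigma> \<Longrightarrow> \<sigma> 0 = 0"
  unfolding field_hom_def by (metis add_cancel_right_right)

lemma lin_ext_superset:
  assumes "field_hom \<sigma>" "finite A" "Poly_Mapping.keys p \<subseteq> A"
  shows "lin_ext \<sigma> G p = (\<Sum>k\<in>A. \<sigma> (Poly_Mapping.lookup p k) *\<^sub>C G k)"
  unfolding lin_ext_def using assms
  by (intro sum.mono_neutral_left) (auto simp: in_keys_iff field_hom_0)

lemma lin_ext_0 [simp]: "lin_ext \<sigma> G 0 = 0"
  by (simp add: lin_ext_def)

lemma lin_ext_single: "field_hom \<sigma> \<Longrightarrow> lin_ext \<sigma> G (Poly_Mapping.single k c) = \<sigma> c *\<^sub>C G k"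
  by (simp add: lin_ext_def field_hom_0)

lemma lin_ext_add:
  assumes "field_hom \<sigma>"
  shows "lin_ext \<sigma> G (p + q) = lin_ext \<sigma> G p + lin_ext \<sigma> G q"
proof -
  let ?A = "Poly_Mapping.keys p \<union> Poly_Mapping.keys q"
  have s: "\<sigma> (x + y) = \<sigma> x + \<sigma> y" for x y using assms by (simp add: field_hom_def)
  have 1: "lin_ext \<sigma> G r = (\<Sum>k\<in>?A. \<sigma> (Poly_Mapping.lookup r k) *\<^sub>C G k)"
    if "Poly_Mapping.keys r \<subseteq> ?A" for r
    by (rule lin_ext_superset[OF assms]) (use that in auto)
  have "Poly_Mapping.keys (p + q) \<subseteq> ?A" by (rule Poly_Mapping.keys_add)
  from 1[OF this] 1[of p] 1[of q] show ?thesis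
    by (simp add: lookup_add s scaleC_add_left sum.distrib)
qed

lemma lin_ext_minus: "field_hom \<sigma> \<Longrightarrow> lin_ext \<sigma> G (- p) = - lin_ext \<sigma> G p"
  using lin_ext_add[of \<sigma> G p "- p"] by (simp add: eq_neg_iff_add_eq_0 add.commute)

lemma lin_ext_diff: "field_hom \<sigma> \<Longrightarrow> lin_ext \<sigma> G (p - q) = lin_ext \<sigma> G p - lin_ext \<sigma> G q"
  using lin_ext_add[of \<sigma> G p "- q"] by (simp add: lin_ext_minus)

lemma lin_ext_sum:
  "field_hom \<sigma> \<Longrightarrow> lin_ext \<sigma> G (sum f A) = (\<Sum>x\<in>A. lin_ext \<sigma> G (f x))"
  by (induction A rule: infinite_finite_induct) (simp_all add: lin_ext_add)

lemma formal_induct [case_names zero single add]: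
  assumes "P 0" "\<And>k c. P (Poly_Mapping.single k c)" "\<And>p q. P p \<Longrightarrow> P q \<Longrightarrow> P (p + q)"
  shows "P (p :: 'k \<Rightarrow>\<^sub>0 complex)"
proof -
  have eq: "p = (\<Sum>k\<in>Poly_Mapping.keys p. Poly_Mapping.single k (Poly_Mapping.lookup p k))"
    by (intro poly_mapping_eqI)
      (auto simp: lookup_sum lookup_single when_def in_keys_iff sum.delta[OF finite_keys])
  have "P (sum f A)" if "\<And>x. P (f x)" for f and A :: "'k set"
    by (induction A rule: infinite_finite_induct) (auto simp: assms that)
  from this[of "\<lambda>k. Poly_Mapping.single k (Poly_Mapping.lookup p k)"] assms(2)
  show ?thesis by (subst eq) blast
qed

lemma lin_ext_scale:
  assumes "field_hom \<sigma>"
  shows "lin_ext \<sigma> G (Poly_Mapping.map ((*) c) p) = \<sigma> c *\<^sub>C lin_ext \<sigma> G p"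
proof -
  have s: "\<sigma> (x * y) = \<sigma> x * \<sigma> y" for x y using assms by (simp add: field_hom_def)
  have "Poly_Mapping.keys (Poly_Mapping.map ((*) c) p) \<subseteq> Poly_Mapping.keys p"
    by (auto simp: in_keys_iff map.rep_eq when_def)
  from lin_ext_superset[OF assms finite_keys this, of G]
  have "lin_ext \<sigma> G (Poly_Mapping.map ((*) c) p)
      = (\<Sum>k\<in>Poly_Mapping.keys p. \<sigma> (Poly_Mapping.lookup (Poly_Mapping.map ((*) c) p) k) *\<^sub>C G k)" .
  also have "\<dots> = (\<Sum>k\<in>Poly_Mapping.keys p. \<sigma> c *\<^sub>C \<sigma> (Poly_Mapping.lookup p k) *\<^sub>C G k)"
    by (rule sum.cong) (auto simp: map.rep_eq when_def s in_keys_iff scaleC_scaleC)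
  also have "\<dots> = \<sigma> c *\<^sub>C lin_ext \<sigma> G p"
    by (simp add: lin_ext_def complex_vector.scale_sum_right)
  finally show ?thesis .
qed


section \<open>The algebraic tensor product\<close>

inductive_set tensor_null :: "(('a::complex_vector \<times> 'b::complex_vector) \<Rightarrow>\<^sub>0 complex) set" where
  zero: "0 \<in> tensor_null"
| add: "p \<in> tensor_null \<Longrightarrow> q \<in> tensor_null \<Longrightarrow> p + q \<in> tensor_null"
| scale: "p \<in> tensor_null \<Longrightarrow> Poly_Mapping.map ((*) c) p \<in> tensor_null"
| add_left: "Poly_Mapping.single (a + a', b) 1 - Poly_Mapping.single (a, b) 1
    - Poly_Mapping.single (a', b) 1 \<in> tensor_null"
| add_right: "Poly_Mapping.single (a, b + b') 1 - Poly_Mapping.single (a, b) 1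
    - Poly_Mapping.single (a, b') 1 \<in> tensor_null"
| scale_left: "Poly_Mapping.single (c *\<^sub>C a, b) 1 - Poly_Mapping.single (a, b) c \<in> tensor_null"
| scale_right: "Poly_Mapping.single (a, c *\<^sub>C b) 1 - Poly_Mapping.single (a, b) c \<in> tensor_null"

lemma map_neg1: "Poly_Mapping.map ((*) (- 1)) p = - (p :: 'k \<Rightarrow>\<^sub>0 complex)"
  by (intro poly_mapping_eqI) (simp add: map.rep_eq when_def)

lemma map_scale_diff:
  "Poly_Mapping.map ((*) c) (p - q) = Poly_Mapping.map ((*) c) p - Poly_Mapping.map ((*) c) (q :: 'k \<Rightarrow>\<^sub>0 complex)"
  by (intro poly_mapping_eqI) (auto simp: map.rep_eq lookup_minus when_def algebra_simps)

lemma tensor_null_minus: "p \<in> tensor_null \<Longrightarrow> - p \<in> tensor_null"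
  using tensor_null.scale[of p "- 1"] by (simp add: map_neg1)

definition tensor_rel :: "(('a::complex_vector \<times> 'b::complex_vector) \<Rightarrow>\<^sub>0 complex)
    \<Rightarrow> (('a \<times> 'b) \<Rightarrow>\<^sub>0 complex) \<Rightarrow> bool" where
  "tensor_rel p q \<longleftrightarrow> p - q \<in> tensor_null"

lemma equivp_tensor_rel: "equivp tensor_rel"
proof (rule equivpI)
  show "reflp tensor_rel" by (auto simp: reflp_def tensor_rel_def tensor_null.zero)
  show "symp tensor_rel"
    unfolding symp_def tensor_rel_def by (metis minus_diff_eq tensor_null_minus)
  show "transp tensor_rel"
    unfolding transp_def tensor_rel_def
    by (metis (no_types, opaque_lifting) diff_add_cancel add_diff_eq tensor_null.add)
qed

quotient_type (overloaded) ('a, 'b) tensor =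
  "('a::complex_vector \<times> 'b::complex_vector) \<Rightarrow>\<^sub>0 complex" / tensor_rel
  by (rule equivp_tensor_rel)

instantiation tensor :: (complex_vector, complex_vector) complex_vector
begin

lift_definition zero_tensor :: "('a, 'b) tensor" is 0 .
lift_definition plus_tensor :: "('a, 'b) tensor \<Rightarrow> ('a, 'b) tensor \<Rightarrow> ('a, 'b) tensor" is "(+)"
  unfolding tensor_rel_def by (metis add_diff_add tensor_null.add)
lift_definition uminus_tensor :: "('a, 'b) tensor \<Rightarrow> ('a, 'b) tensor" is uminus
  unfolding tensor_rel_def by (metis minus_diff_minus tensor_null_minus)
lift_definition minus_tensor :: "('a, 'b) tensor \<Rightarrow> ('a, 'b) tensor \<Rightarrow> ('a, 'b) tensor" is "(-)"
proof -
  fix p q r s :: "('a \<times> 'b) \<Rightarrow>\<^sub>0 complex"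
  assume "tensor_rel p q" "tensor_rel r s"
  then have "(p - q) + - (r - s) \<in> tensor_null"
    unfolding tensor_rel_def by (intro tensor_null.add tensor_null_minus)
  then show "tensor_rel (p - r) (q - s)" by (simp add: tensor_rel_def algebra_simps)
qed
lift_definition scaleC_tensor :: "complex \<Rightarrow> ('a, 'b) tensor \<Rightarrow> ('a, 'b) tensor"
  is "\<lambda>c. Poly_Mapping.map ((*) c)"
  unfolding tensor_rel_def by (metis map_scale_diff tensor_null.scale)

instance
proof
  fix a b c :: "('a, 'b) tensor" and x y :: complex
  have r: "tensor_rel p q" if "p = q" for p q :: "('a \<times> 'b) \<Rightarrow>\<^sub>0 complex"
    by (simp add: that tensor_rel_def tensor_null.zero)
  show "a + b + c = a + (b + c)" by transfer (simp add: r add.assoc)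
  show "a + b = b + a" by transfer (simp add: r add.commute)
  show "0 + a = a" by transfer (simp add: r)
  show "- a + a = 0" by transfer (simp add: r)
  show "a - b = a + - b" by transfer (simp add: r)
  show "x *\<^sub>C (a + b) = x *\<^sub>C a + x *\<^sub>C b"
    by transfer (intro r poly_mapping_eqI, auto simp: map.rep_eq lookup_add when_def simp flip: distrib_left)
  show "(x + y) *\<^sub>C a = x *\<^sub>C a + y *\<^sub>C a"
    by transfer (intro r poly_mapping_eqI, auto simp: map.rep_eq lookup_add when_def algebra_simps)
  show "x *\<^sub>C y *\<^sub>C a = (x * y) *\<^sub>C a"
    by transfer (intro r poly_mapping_eqI, auto simp: map.rep_eq when_def algebra_simps)
  show "1 *\<^sub>C a = a"
    by transfer (intro r poly_mapping_eqI, auto simp: map.rep_eq when_def)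
qed

end

lift_definition tens :: "'a::complex_vector \<Rightarrow> 'b::complex_vector \<Rightarrow> ('a, 'b) tensor" (infixr "\<otimes>\<^sub>t" 76)
  is "\<lambda>a b. Poly_Mapping.single (a, b) 1" .

lemma tens_add_left: "(a + a') \<otimes>\<^sub>t b = a \<otimes>\<^sub>t b + a' \<otimes>\<^sub>t b"
  by transfer (use tensor_null.add_left in \<open>simp add: tensor_rel_def diff_diff_eq\<close>)

lemma tens_add_right: "a \<otimes>\<^sub>t (b + b') = a \<otimes>\<^sub>t b + a \<otimes>\<^sub>t b'"
  by transfer (use tensor_null.add_right in \<open>simp add: tensor_rel_def diff_diff_eq\<close>)

lemma tens_scaleC_left: "(c *\<^sub>C a) \<otimes>\<^sub>t b = c *\<^sub>C (a \<otimes>\<^sub>t b)"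
  by transfer (use tensor_null.scale_left in \<open>simp add: tensor_rel_def\<close>)

lemma tens_scaleC_right: "a \<otimes>\<^sub>t (c *\<^sub>C b) = c *\<^sub>C (a \<otimes>\<^sub>t b)"
  by transfer (use tensor_null.scale_right in \<open>simp add: tensor_rel_def\<close>)

lemma tensor_induct [case_names zero tens add, induct type: tensor]:
  assumes "P 0" "\<And>a b. P (a \<otimes>\<^sub>t b)" "\<And>s t. P s \<Longrightarrow> P t \<Longrightarrow> P (s + t)"
  shows "P t"
proof -
  have "P (abs_tensor p)" for p
  proof (induction p rule: formal_induct)
    case zero then show ?case using assms(1) by (simp add: zero_tensor.abs_eq)
  next
    case (single k c)
    obtain a b where k: "k = (a, b)" by (cases k)
    have "abs_tensor (Poly_Mapping.single k c) = (c *\<^sub>C a) \<otimes>\<^sub>t b"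
      by (simp only: k tens_scaleC_left) (simp add: tens.abs_eq scaleC_tensor.abs_eq)
    then show ?case using assms(2) by simp
  next
    case (add p q) then show ?case using assms(3) by (metis plus_tensor.abs_eq)
  qed
  then show ?thesis by (metis Quotient3_tensor Quotient3_abs_rep)
qed

text \<open>The linear map on the tensor product induced by a bilinear map \<open>f\<close>. The chosen
  representative is irrelevant when \<open>f\<close> is bilinear, see \<open>tensor_lift_tens\<close> and
  \<open>clinear_tensor_lift\<close>.\<close>

definition tensor_lift :: "('a::complex_vector \<Rightarrow> 'b::complex_vector \<Rightarrow> 'c::complex_vector)
    \<Rightarrow> ('a, 'b) tensor \<Rightarrow> 'c" where
  "tensor_lift f t = lin_ext (\<lambda>c. c) (\<lambda>(a, b). f a b) (rep_tensor t)"

definition cbilinear :: "('a::complex_vector \<Rightarrow> 'b::complex_vector \<Rightarrow> 'c::complex_vector) \<Rightarrow> bool" where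
  "cbilinear f \<longleftrightarrow> (\<forall>a. clinear (f a)) \<and> (\<forall>b. clinear (\<lambda>a. f a b))"

lemma lin_ext_tensor_null:
  assumes "cbilinear f" "p \<in> tensor_null"
  shows "lin_ext (\<lambda>c. c) (\<lambda>(a, b). f a b) p = 0"
  using assms(2) assms(1)
  by induction (simp_all add: lin_ext_add lin_ext_diff lin_ext_scale lin_ext_single field_hom_id
      cbilinear_def clinear_iff)

lemma tensor_lift_abs:
  assumes "cbilinear f"
  shows "tensor_lift f (abs_tensor p) = lin_ext (\<lambda>c. c) (\<lambda>(a, b). f a b) p"
proof -
  have "tensor_rel (rep_tensor (abs_tensor p)) p"
    using Quotient3_rep_abs[OF Quotient3_tensor] equivp_tensor_rel by (metis equivp_reflp)
  then have "rep_tensor (abs_tensor p) - p \<in> tensor_null" by (simp add: tensor_rel_def)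
  from lin_ext_tensor_null[OF assms this] show ?thesis
    by (simp add: tensor_lift_def lin_ext_diff field_hom_id)
qed

lemma tensor_lift_tens: "cbilinear f \<Longrightarrow> tensor_lift f (a \<otimes>\<^sub>t b) = f a b"
  by (simp add: tens.abs_eq tensor_lift_abs lin_ext_single field_hom_id)

lemma tensor_lift_add: "cbilinear f \<Longrightarrow> tensor_lift f (s + t) = tensor_lift f s + tensor_lift f t"
  by (metis Quotient3_abs_rep[OF Quotient3_tensor] plus_tensor.abs_eq tensor_lift_abs
      lin_ext_add[OF field_hom_id])

lemma tensor_lift_scaleC: "cbilinear f \<Longrightarrow> tensor_lift f (c *\<^sub>C t) = c *\<^sub>C tensor_lift f t"
  by (metis Quotient3_abs_rep[OF Quotient3_tensor] scaleC_tensor.abs_eq tensor_lift_abs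
      lin_ext_scale[OF field_hom_id])

lemma clinear_tensor_lift: "cbilinear f \<Longrightarrow> clinear (tensor_lift f)"
  by (simp add: clinear_iff tensor_lift_add tensor_lift_scaleC)

lemma tensor_lift_0: "cbilinear f \<Longrightarrow> tensor_lift f 0 = 0"
  using tensor_lift_add[of f 0 0] by simp

lemma tensor_lift_cong_add:
  assumes "cbilinear f" "cbilinear g" "cbilinear h" "\<And>a b. f a b = g a b + h a b"
  shows "tensor_lift f t = tensor_lift g t + tensor_lift h t"
proof (induction t)
  case (tens a b)
  show ?case by (simp only: tensor_lift_tens assms(1-3)) (rule assms(4))
qed (simp_all add: tensor_lift_0 tensor_lift_add assms(1-3))

lemma tensor_lift_cong_scaleC:
  assumes "cbilinear f" "cbilinear g" "\<And>a b. f a b = c *\<^sub>C g a b"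
  shows "tensor_lift f t = c *\<^sub>C tensor_lift g t"
proof (induction t)
  case (tens a b)
  show ?case by (simp only: tensor_lift_tens assms(1,2)) (rule assms(3))
qed (simp_all add: tensor_lift_0 tensor_lift_add assms(1,2) scaleC_add_right)

instantiation tensor :: (complex_unital_algebra, complex_unital_algebra) complex_unital_algebra
begin

definition one_tensor :: "('a, 'b) tensor" where "one_tensor = 1 \<otimes>\<^sub>t 1"

definition times_tensor :: "('a, 'b) tensor \<Rightarrow> ('a, 'b) tensor \<Rightarrow> ('a, 'b) tensor" where
  "times_tensor s t = tensor_lift (\<lambda>a b. tensor_lift (\<lambda>c d. (a * c) \<otimes>\<^sub>t (b * d)) t) s"

lemmas tensor_bilinear_simps = cbilinear_def clinear_iff tens_add_left tens_add_right
  tens_scaleC_left tens_scaleC_right distrib_left distrib_right mult_scaleC_left mult_scaleC_right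

lemma times_tensor_bilinear1: "cbilinear (\<lambda>c d. (a * c) \<otimes>\<^sub>t (b * d) :: ('a, 'b) tensor)"
  by (simp add: tensor_bilinear_simps)

lemma times_tensor_bilinear2:
  "cbilinear (\<lambda>a b. tensor_lift (\<lambda>c d. (a * c) \<otimes>\<^sub>t (b * d) :: ('a, 'b) tensor) t)"
  unfolding cbilinear_def clinear_iff
  by (intro conjI allI tensor_lift_cong_add tensor_lift_cong_scaleC times_tensor_bilinear1)
    (simp_all add: tensor_bilinear_simps)

lemma tens_mult_aux: "(a \<otimes>\<^sub>t b) * (c \<otimes>\<^sub>t d) = ((a * c) \<otimes>\<^sub>t (b * d) :: ('a, 'b) tensor)"
  unfolding times_tensor_def tensor_lift_tens[OF times_tensor_bilinear2]
  by (rule tensor_lift_tens[OF times_tensor_bilinear1])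

lemma times_tensor_add_left_aux: "(s + t) * r = s * r + t * (r :: ('a, 'b) tensor)"
  by (simp add: times_tensor_def tensor_lift_add times_tensor_bilinear2)

lemma times_tensor_scaleC_left_aux: "(c *\<^sub>C t) * r = c *\<^sub>C (t * (r :: ('a, 'b) tensor))"
  by (simp add: times_tensor_def tensor_lift_scaleC times_tensor_bilinear2)

lemma times_tensor_0_left_aux: "0 * r = (0 :: ('a, 'b) tensor)"
  by (simp add: times_tensor_def tensor_lift_0 times_tensor_bilinear2)

lemma times_tensor_add_right_aux: "r * (s + t) = r * s + r * (t :: ('a, 'b) tensor)"
  unfolding times_tensor_def
  by (intro tensor_lift_cong_add times_tensor_bilinear2)
    (simp add: tensor_lift_add times_tensor_bilinear1)

lemma times_tensor_scaleC_right_aux: "r * (c *\<^sub>C t) = c *\<^sub>C (r * (t :: ('a, 'b) tensor))"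
  unfolding times_tensor_def
  by (intro tensor_lift_cong_scaleC times_tensor_bilinear2)
    (simp add: tensor_lift_scaleC times_tensor_bilinear1)

lemma times_tensor_0_right_aux: "r * 0 = (0 :: ('a, 'b) tensor)"
  using times_tensor_add_right_aux[of r 0 0] by simp

lemmas times_tensor_aux = tens_mult_aux times_tensor_add_left_aux times_tensor_scaleC_left_aux
  times_tensor_0_left_aux times_tensor_add_right_aux times_tensor_scaleC_right_aux
  times_tensor_0_right_aux

lemma times_tensor_assoc_aux: "(r * s) * t = r * (s * (t :: ('a, 'b) tensor))"
proof (induction r)
  case (tens a b)
  show ?case
  proof (induction s)
    case (tens a' b')
    show ?case by (induction t) (simp_all add: times_tensor_aux mult.assoc)
  qed (simp_all add: times_tensor_aux)
qed (simp_all add: times_tensor_aux)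

lemma times_tensor_one_aux:
  "1 * t = (t :: ('a, 'b) tensor)" "t * 1 = (t :: ('a, 'b) tensor)"
  by (induction t) (simp_all add: one_tensor_def times_tensor_aux)

instance
  by standard (simp_all add: times_tensor_aux times_tensor_assoc_aux times_tensor_one_aux)

end


section \<open>The Hopf *-algebra of the free orthogonal quantum group\<close>

text \<open>Words over the alphabet \<open>v\<^bsub>jk\<^esub>\<close> form a free monoid, written additively so that
  \<open>\<Rightarrow>\<^sub>0\<close> becomes the free unital algebra.\<close>

datatype 'a word = Word (letters: "'a list")

instantiation word :: (type) monoid_add
begin
definition zero_word :: "'a word" where "0 = Word []"
definition plus_word :: "'a word \<Rightarrow> 'a word \<Rightarrow> 'a word" where "w + w' = Word (letters w @ letters w')"
instance by standard (simp_all add: zero_word_def plus_word_def)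
end

lemma letters_simps [simp]: "letters 0 = []" "letters (w + w') = letters w @ letters w'"
  by (simp_all add: zero_word_def plus_word_def)

type_synonym 'n free_alg = "('n \<times> 'n) word \<Rightarrow>\<^sub>0 complex"

definition gen :: "'n \<Rightarrow> 'n \<Rightarrow> 'n free_alg" where
  "gen j k = Poly_Mapping.single (Word [(j, k)]) 1"

definition orth_relators :: "('n::finite) free_alg set" where
  "orth_relators =
     (\<Union>j. \<Union>k. {(\<Sum>l\<in>UNIV. gen l j * gen l k) - of_bool (j = k),
             (\<Sum>l\<in>UNIV. gen j l * gen k l) - of_bool (j = k)})"

text \<open>The two-sided ideal generated by the relators (closure under scalars is subsumed by
  multiplication with constants). It is stable under the involution of the free algebra for
  which the generators are self-adjoint.\<close>

inductive_set orth_ideal :: "('n::finite) free_alg set" where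
  zero: "0 \<in> orth_ideal"
| relator: "r \<in> orth_relators \<Longrightarrow> r \<in> orth_ideal"
| add: "p \<in> orth_ideal \<Longrightarrow> q \<in> orth_ideal \<Longrightarrow> p + q \<in> orth_ideal"
| mult_left: "p \<in> orth_ideal \<Longrightarrow> q * p \<in> orth_ideal"
| mult_right: "p \<in> orth_ideal \<Longrightarrow> p * q \<in> orth_ideal"

lemma orth_ideal_minus: "p \<in> orth_ideal \<Longrightarrow> - p \<in> orth_ideal"
  using orth_ideal.mult_left[of p "- 1"] by simp

definition orth_rel :: "('n::finite) free_alg \<Rightarrow> 'n free_alg \<Rightarrow> bool" where
  "orth_rel p q \<longleftrightarrow> p - q \<in> orth_ideal"

lemma orth_rel_refl: "p = q \<Longrightarrow> orth_rel p q"
  by (simp add: orth_rel_def orth_ideal.zero)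

lemma equivp_orth_rel: "equivp orth_rel"
proof (rule equivpI)
  show "reflp orth_rel" by (auto simp: reflp_def orth_rel_refl)
  show "symp orth_rel"
    unfolding symp_def orth_rel_def by (metis minus_diff_eq orth_ideal_minus)
  show "transp orth_rel"
    unfolding transp_def orth_rel_def
    by (metis (no_types, opaque_lifting) diff_add_cancel add_diff_eq orth_ideal.add)
qed

text \<open>\<open>'n pol_orth\<close> is \<open>Pol(O\<^sub>N\<^sup>+)\<close> with \<open>N = CARD('n)\<close>, presented as the universal unital
  *-algebra on the self-adjoint generators \<open>vgen j k\<close> satisfying the orthogonality relations;
  \<open>C\<^sub>u(O\<^sub>N\<^sup>+)\<close> is its universal C*-completion.\<close>

quotient_type (overloaded) 'n pol_orth = "('n::finite) free_alg" / orth_rel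
  by (rule equivp_orth_rel)

lemma scale_free_alg_central:
  "p * Poly_Mapping.single 0 c = Poly_Mapping.single 0 c * (p :: 'n free_alg)"
  by (induction p rule: formal_induct) (simp_all add: mult_single mult.commute algebra_simps)

instantiation pol_orth :: (finite) complex_unital_algebra
begin

lift_definition zero_pol_orth :: "'a pol_orth" is 0 .
lift_definition one_pol_orth :: "'a pol_orth" is 1 .
lift_definition plus_pol_orth :: "'a pol_orth \<Rightarrow> 'a pol_orth \<Rightarrow> 'a pol_orth" is "(+)"
  unfolding orth_rel_def by (metis add_diff_add orth_ideal.add)
lift_definition uminus_pol_orth :: "'a pol_orth \<Rightarrow> 'a pol_orth" is uminus
  unfolding orth_rel_def by (metis minus_diff_minus orth_ideal_minus)
lift_definition minus_pol_orth :: "'a pol_orth \<Rightarrow> 'a pol_orth \<Rightarrow> 'a pol_orth" is "(-)"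
proof -
  fix p q r s :: "'a free_alg"
  assume "orth_rel p q" "orth_rel r s"
  then have "(p - q) + - (r - s) \<in> orth_ideal"
    unfolding orth_rel_def by (intro orth_ideal.add orth_ideal_minus)
  then show "orth_rel (p - r) (q - s)" by (simp add: orth_rel_def algebra_simps)
qed
lift_definition times_pol_orth :: "'a pol_orth \<Rightarrow> 'a pol_orth \<Rightarrow> 'a pol_orth" is "(*)"
proof -
  fix p q r s :: "'a free_alg"
  assume "orth_rel p q" "orth_rel r s"
  then have "(p - q) * r + q * (r - s) \<in> orth_ideal"
    unfolding orth_rel_def by (intro orth_ideal.add orth_ideal.mult_left orth_ideal.mult_right)
  then show "orth_rel (p * r) (q * s)" by (simp add: orth_rel_def algebra_simps)
qed
lift_definition scaleC_pol_orth :: "complex \<Rightarrow> 'a pol_orth \<Rightarrow> 'a pol_orth"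
  is "\<lambda>c p. Poly_Mapping.single 0 c * p"
  unfolding orth_rel_def by (metis right_diff_distrib orth_ideal.mult_left)

instance
proof
  fix a b c :: "'a pol_orth" and x y :: complex
  show "a + b + c = a + (b + c)" by transfer (simp add: orth_rel_refl add.assoc)
  show "a + b = b + a" by transfer (simp add: orth_rel_refl add.commute)
  show "0 + a = a" by transfer (simp add: orth_rel_refl)
  show "- a + a = 0" by transfer (simp add: orth_rel_refl)
  show "a - b = a + - b" by transfer (simp add: orth_rel_refl)
  show "a * b * c = a * (b * c)" by transfer (simp add: orth_rel_refl mult.assoc)
  show "(a + b) * c = a * c + b * c" by transfer (simp add: orth_rel_refl distrib_right)
  show "a * (b + c) = a * b + a * c" by transfer (simp add: orth_rel_refl distrib_left)
  show "1 * a = a" by transfer (simp add: orth_rel_refl)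
  show "a * 1 = a" by transfer (simp add: orth_rel_refl)
  show "x *\<^sub>C (a + b) = x *\<^sub>C a + x *\<^sub>C b" by transfer (simp add: orth_rel_refl distrib_left)
  show "(x + y) *\<^sub>C a = x *\<^sub>C a + y *\<^sub>C a"
    by transfer (simp add: orth_rel_refl single_add distrib_right)
  show "x *\<^sub>C y *\<^sub>C a = (x * y) *\<^sub>C a"
    by transfer (simp add: orth_rel_refl mult_single flip: mult.assoc)
  show "1 *\<^sub>C a = a" by transfer (simp add: orth_rel_refl)
  show "(x *\<^sub>C a) * b = x *\<^sub>C (a * b)" by transfer (simp add: orth_rel_refl mult.assoc)
  show "a * (x *\<^sub>C b) = x *\<^sub>C (a * b)"
    by transfer (metis orth_rel_refl mult.assoc scale_free_alg_central)
qed

end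

lift_definition vgen :: "'n::finite \<Rightarrow> 'n \<Rightarrow> 'n pol_orth" is gen .

text \<open>A (semi)linear map out of \<open>'n pol_orth\<close> given by its values on words. It is independent of
  the chosen representative as soon as the extension to the free algebra kills the ideal,
  which \<open>lin_ext_orth_ideal_mult\<close> and \<open>lin_ext_orth_ideal_antimult\<close> reduce to the
  defining relations.\<close>

definition pol_ext :: "(complex \<Rightarrow> complex) \<Rightarrow> (('n::finite \<times> 'n) word \<Rightarrow> 'a::complex_vector)
    \<Rightarrow> 'n pol_orth \<Rightarrow> 'a" where
  "pol_ext \<sigma> G x = lin_ext \<sigma> G (rep_pol_orth x)"

lemma pol_ext_abs:
  assumes "field_hom \<sigma>" "\<And>p. p \<in> orth_ideal \<Longrightarrow> lin_ext \<sigma> G p = 0"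
  shows "pol_ext \<sigma> G (abs_pol_orth p) = lin_ext \<sigma> G p"
proof -
  have "orth_rel (rep_pol_orth (abs_pol_orth p)) p"
    using Quotient3_rep_abs[OF Quotient3_pol_orth] equivp_orth_rel by (metis equivp_reflp)
  then have "rep_pol_orth (abs_pol_orth p) - p \<in> orth_ideal" by (simp add: orth_rel_def)
  from assms(2)[OF this] show ?thesis
    by (simp add: pol_ext_def lin_ext_diff assms(1))
qed

lemma lin_ext_mult:
  fixes G :: "('n \<times> 'n) word \<Rightarrow> 'a::complex_unital_algebra"
  assumes "field_hom \<sigma>" "\<And>w w'. G (w + w') = G w * G w'"
  shows "lin_ext \<sigma> G (p * q) = lin_ext \<sigma> G p * lin_ext \<sigma> G q"
proof (induction p rule: formal_induct)
  case (single k c)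
  have s: "\<sigma> (x * y) = \<sigma> x * \<sigma> y" for x y using assms by (simp add: field_hom_def)
  show ?case
    by (induction q rule: formal_induct)
      (simp_all add: mult_single lin_ext_single lin_ext_add assms s distrib_left
        mult_scaleC_left mult_scaleC_right scaleC_scaleC)
qed (simp_all add: lin_ext_add assms distrib_right)

lemma lin_ext_antimult:
  fixes G :: "('n \<times> 'n) word \<Rightarrow> 'a::complex_unital_algebra"
  assumes "field_hom \<sigma>" "\<And>w w'. G (w + w') = G w' * G w"
  shows "lin_ext \<sigma> G (p * q) = lin_ext \<sigma> G q * lin_ext \<sigma> G p"
proof (induction p rule: formal_induct)
  case (single k c)
  have s: "\<sigma> (x * y) = \<sigma> x * \<sigma> y" for x y using assms by (simp add: field_hom_def)
  show ?case
    by (induction q rule: formal_induct)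
      (simp_all add: mult_single lin_ext_single lin_ext_add assms s distrib_right distrib_left
        mult_scaleC_left mult_scaleC_right scaleC_scaleC scaleC_add_right mult.commute[of "\<sigma> c"])
qed (simp_all add: lin_ext_add assms distrib_left distrib_right)

lemma lin_ext_gen: "field_hom \<sigma> \<Longrightarrow> lin_ext \<sigma> G (gen j k) = G (Word [(j, k)])"
  by (simp add: gen_def lin_ext_single) (simp add: field_hom_def)

lemma lin_ext_one: "field_hom \<sigma> \<Longrightarrow> lin_ext \<sigma> G 1 = G 0"
  by (subst single_one[symmetric], subst lin_ext_single) (simp_all add: field_hom_def)

lemma lin_ext_of_bool: "field_hom \<sigma> \<Longrightarrow> lin_ext \<sigma> G (of_bool b) = (if b then G 0 else 0)"
  by (simp add: lin_ext_one)

definition orth_family :: "('n::finite \<Rightarrow> 'n \<Rightarrow> 'a::complex_unital_algebra) \<Rightarrow> bool" where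
  "orth_family g \<longleftrightarrow> (\<forall>j k. (\<Sum>l\<in>UNIV. g l j * g l k) = (if j = k then 1 else 0)
                        \<and> (\<Sum>l\<in>UNIV. g j l * g k l) = (if j = k then 1 else 0))"

lemma lin_ext_orth_ideal_mult:
  fixes G :: "('n::finite \<times> 'n) word \<Rightarrow> 'a::complex_unital_algebra"
  assumes "field_hom \<sigma>" "\<And>w w'. G (w + w') = G w * G w'" "G 0 = 1"
    "orth_family (\<lambda>j k. G (Word [(j, k)]))" "p \<in> orth_ideal"
  shows "lin_ext \<sigma> G p = 0"
  using assms(5)
proof induction
  case (relator r)
  then show ?case
    using assms(1,3,4)
    by (auto simp: orth_relators_def lin_ext_diff lin_ext_sum lin_ext_mult[OF assms(1,2)]
        lin_ext_gen lin_ext_of_bool orth_family_def simp del: of_bool_eq_0_iff)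
qed (simp_all add: lin_ext_add lin_ext_mult[OF assms(1,2)] assms(1))

lemma lin_ext_orth_ideal_antimult:
  fixes G :: "('n::finite \<times> 'n) word \<Rightarrow> 'a::complex_unital_algebra"
  assumes "field_hom \<sigma>" "\<And>w w'. G (w + w') = G w' * G w" "G 0 = 1"
    "orth_family (\<lambda>j k. G (Word [(j, k)]))" "p \<in> orth_ideal"
  shows "lin_ext \<sigma> G p = 0"
  using assms(5)
proof induction
  case (relator r)
  then show ?case
    using assms(1,3,4)
    by (auto simp: orth_relators_def lin_ext_diff lin_ext_sum lin_ext_antimult[OF assms(1,2)]
        lin_ext_gen lin_ext_of_bool orth_family_def simp del: of_bool_eq_0_iff)
qed (simp_all add: lin_ext_add lin_ext_antimult[OF assms(1,2)] assms(1))

lemma pol_ext_facts: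
  fixes G :: "('n::finite \<times> 'n) word \<Rightarrow> 'a::complex_unital_algebra"
  assumes \<sigma>: "field_hom \<sigma>" and kill: "\<forall>p\<in>orth_ideal. lin_ext \<sigma> G p = 0"
  shows "pol_ext \<sigma> G (vgen j k) = G (Word [(j, k)])"
    and "pol_ext \<sigma> G 1 = G 0"
    and "pol_ext \<sigma> G (x + y) = pol_ext \<sigma> G x + pol_ext \<sigma> G y"
    and "pol_ext \<sigma> G (c *\<^sub>C x) = \<sigma> c *\<^sub>C pol_ext \<sigma> G x"
    and "(\<And>w w'. G (w + w') = G w * G w') \<Longrightarrow> pol_ext \<sigma> G (x * y) = pol_ext \<sigma> G x * pol_ext \<sigma> G y"
    and "(\<And>w w'. G (w + w') = G w' * G w) \<Longrightarrow> pol_ext \<sigma> G (x * y) = pol_ext \<sigma> G y * pol_ext \<sigma> G x"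
proof -
  note ext = pol_ext_abs[OF \<sigma> kill[rule_format]]
  obtain p q where xy: "x = abs_pol_orth p" "y = abs_pol_orth q"
    by (metis Quotient3_abs_rep[OF Quotient3_pol_orth])
  show "pol_ext \<sigma> G (vgen j k) = G (Word [(j, k)])"
    by (simp add: vgen.abs_eq ext lin_ext_gen \<sigma>)
  show "pol_ext \<sigma> G 1 = G 0"
    by (simp add: one_pol_orth.abs_eq ext lin_ext_one \<sigma>)
  show "pol_ext \<sigma> G (x + y) = pol_ext \<sigma> G x + pol_ext \<sigma> G y"
    by (simp add: xy plus_pol_orth.abs_eq ext lin_ext_add \<sigma>)
  show "pol_ext \<sigma> G (c *\<^sub>C x) = \<sigma> c *\<^sub>C pol_ext \<sigma> G x"
    by (simp add: xy scaleC_pol_orth.abs_eq ext flip: mult_map_scale_conv_mult)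
      (simp add: lin_ext_scale \<sigma>)
  show "pol_ext \<sigma> G (x * y) = pol_ext \<sigma> G x * pol_ext \<sigma> G y"
    if "\<And>w w'. G (w + w') = G w * G w'"
    by (simp add: xy times_pol_orth.abs_eq ext lin_ext_mult[OF \<sigma> that])
  show "pol_ext \<sigma> G (x * y) = pol_ext \<sigma> G y * pol_ext \<sigma> G x"
    if "\<And>w w'. G (w + w') = G w' * G w"
    by (simp add: xy times_pol_orth.abs_eq ext lin_ext_antimult[OF \<sigma> that])
qed

lemma pol_orth_induct [case_names one vgen mult add scaleC]:
  fixes x :: "'n::finite pol_orth"
  assumes "P 1" "\<And>j k. P (vgen j k)" "\<And>x y. P x \<Longrightarrow> P y \<Longrightarrow> P (x * y)"
    "\<And>x y. P x \<Longrightarrow> P y \<Longrightarrow> P (x + y)" "\<And>c x. P x \<Longrightarrow> P (c *\<^sub>C x)"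
  shows "P x"
proof -
  have w: "P (abs_pol_orth (Poly_Mapping.single (Word ws) 1))" for ws :: "('n \<times> 'n) list"
  proof (induction ws)
    case Nil
    have "abs_pol_orth (Poly_Mapping.single (Word []) 1) = (1 :: 'n pol_orth)"
      by (simp add: one_pol_orth.abs_eq flip: zero_word_def)
    then show ?case using assms(1) by simp
  next
    case (Cons a ws)
    obtain j k where a: "a = (j, k)" by (cases a)
    have "abs_pol_orth (Poly_Mapping.single (Word (a # ws)) 1)
        = vgen j k * abs_pol_orth (Poly_Mapping.single (Word ws) 1)"
      by (simp add: vgen.abs_eq times_pol_orth.abs_eq gen_def mult_single a plus_word_def)
    then show ?case using assms(2,3) Cons by simp
  qed
  have "P (abs_pol_orth p)" for p
  proof (induction p rule: formal_induct)
    case zero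
    have "(0 :: 'n pol_orth) = 0 *\<^sub>C 1" by simp
    then show ?case using assms(1,5) by (metis zero_pol_orth.abs_eq)
  next
    case (single k c)
    have "abs_pol_orth (Poly_Mapping.single k c)
        = c *\<^sub>C abs_pol_orth (Poly_Mapping.single (Word (letters k)) 1)"
      by (simp add: scaleC_pol_orth.abs_eq mult_single)
    then show ?case using w[of "letters k"] assms(5) by simp
  next
    case (add p q)
    then show ?case using assms(4) by (metis plus_pol_orth.abs_eq)
  qed
  then show ?thesis by (metis Quotient3_abs_rep[OF Quotient3_pol_orth])
qed

lemma orth_family_v: "orth_family vgen"
proof -
  have r: "abs_pol_orth r = 0" if "r \<in> orth_relators" for r :: "'a free_alg"
    using orth_ideal.relator[OF that]
    by (simp add: zero_pol_orth.abs_eq pol_orth.abs_eq_iff orth_rel_def)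
  have gv: "abs_pol_orth (gen j k) = vgen j k" for j k :: 'a by (simp add: vgen.abs_eq)
  have abs_sum: "abs_pol_orth (sum f A) = (\<Sum>x\<in>A. abs_pol_orth (f x))"
    for f :: "'a \<Rightarrow> 'a free_alg" and A
    by (induction A rule: infinite_finite_induct)
      (simp_all add: zero_pol_orth.abs_eq plus_pol_orth.abs_eq[symmetric])
  have b: "abs_pol_orth (of_bool P) = (if P then 1 else 0 :: 'a pol_orth)" for P
    by (simp add: zero_pol_orth.abs_eq one_pol_orth.abs_eq)
  have "(\<Sum>l\<in>UNIV. vgen l j * vgen l k) - (if j = k then 1 else 0) = (0 :: 'a pol_orth)" for j k
  proof -
    have "(\<Sum>l\<in>UNIV. gen l j * gen l k) - of_bool (j = k) \<in> orth_relators"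
      unfolding orth_relators_def by blast
    from r[OF this] show ?thesis
      by (simp add: minus_pol_orth.abs_eq[symmetric] abs_sum b
        times_pol_orth.abs_eq[symmetric] gv del: of_bool_eq_0_iff of_bool_eq)
  qed
  moreover have "(\<Sum>l\<in>UNIV. vgen j l * vgen k l) - (if j = k then 1 else 0) = (0 :: 'a pol_orth)" for j k
  proof -
    have "(\<Sum>l\<in>UNIV. gen j l * gen k l) - of_bool (j = k) \<in> orth_relators"
      unfolding orth_relators_def by blast
    from r[OF this] show ?thesis
      by (simp add: minus_pol_orth.abs_eq[symmetric] abs_sum b
        times_pol_orth.abs_eq[symmetric] gv del: of_bool_eq_0_iff of_bool_eq)
  qed
  ultimately show ?thesis by (simp add: orth_family_def)
qed

text \<open>The unital algebra homomorphism sending \<open>vgen j k\<close> to \<open>g j k\<close>; it exists when \<open>g\<close> satisfies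
  the orthogonality relations.\<close>

definition pol_hom :: "('n::finite \<Rightarrow> 'n \<Rightarrow> 'a::complex_unital_algebra) \<Rightarrow> 'n pol_orth \<Rightarrow> 'a" where
  "pol_hom g = pol_ext (\<lambda>c. c) (\<lambda>w. prod_list (map (\<lambda>(j, k). g j k) (letters w)))"

definition comult :: "'n::finite pol_orth \<Rightarrow> ('n pol_orth, 'n pol_orth) tensor" where
  "comult = pol_hom (\<lambda>j k. \<Sum>l\<in>UNIV. vgen j l \<otimes>\<^sub>t vgen l k)"

definition counit :: "'n::finite pol_orth \<Rightarrow> complex" where
  "counit = pol_hom (\<lambda>j k. if j = k then 1 else 0)"

text \<open>The linear antimultiplicative map with \<open>vgen j k \<mapsto> vgen k j\<close> and the antilinear
  antimultiplicative map with \<open>vgen j k \<mapsto> vgen j k\<close>.\<close>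

definition antipode :: "'n::finite pol_orth \<Rightarrow> 'n pol_orth" where
  "antipode = pol_ext (\<lambda>c. c) (\<lambda>w. prod_list (map (\<lambda>(j, k). vgen k j) (rev (letters w))))"

definition star :: "'n::finite pol_orth \<Rightarrow> 'n pol_orth" where
  "star = pol_ext cnj (\<lambda>w. prod_list (map (\<lambda>(j, k). vgen j k) (rev (letters w))))"


lemma pol_hom_facts:
  assumes "orth_family g"
  shows "pol_hom g (vgen j k) = g j k" and "pol_hom g 1 = 1"
    and "pol_hom g (x + y) = pol_hom g x + pol_hom g y"
    and "pol_hom g (c *\<^sub>C x) = c *\<^sub>C pol_hom g x"
    and "pol_hom g (x * y) = pol_hom g x * pol_hom g y"
proof -
  let ?G = "\<lambda>w. prod_list (map (\<lambda>(j, k). g j k) (letters w))"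
  have m: "?G (w + w') = ?G w * ?G w'" for w w' by simp
  have k: "\<forall>p\<in>orth_ideal. lin_ext (\<lambda>c. c) ?G p = 0"
    by (intro ballI lin_ext_orth_ideal_mult[OF field_hom_id m]) (simp_all add: assms)
  note f = pol_ext_facts[OF field_hom_id k]
  show "pol_hom g (vgen j k) = g j k" "pol_hom g 1 = 1"
    "pol_hom g (x + y) = pol_hom g x + pol_hom g y"
    "pol_hom g (c *\<^sub>C x) = c *\<^sub>C pol_hom g x"
    "pol_hom g (x * y) = pol_hom g x * pol_hom g y"
    by (simp_all add: pol_hom_def f(1-4) f(5)[OF m])
qed

lemma tens_mult: "(a \<otimes>\<^sub>t b) * (c \<otimes>\<^sub>t d) = (a * c) \<otimes>\<^sub>t (b * d)"
  for a c :: "'a::complex_unital_algebra" and b d :: "'b::complex_unital_algebra"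
  by (rule tens_mult_aux)

lemma tens_zero [simp]: "0 \<otimes>\<^sub>t b = 0" "a \<otimes>\<^sub>t 0 = 0"
  using tens_add_left[of 0 0 b] tens_add_right[of a 0 0] by simp_all

lemma tens_sum_left: "(\<Sum>i\<in>A. f i) \<otimes>\<^sub>t b = (\<Sum>i\<in>A. f i \<otimes>\<^sub>t b)"
  by (induction A rule: infinite_finite_induct) (simp_all add: tens_add_left)

lemma tens_sum_right: "a \<otimes>\<^sub>t (\<Sum>i\<in>A. f i) = (\<Sum>i\<in>A. a \<otimes>\<^sub>t f i)"
  by (induction A rule: infinite_finite_induct) (simp_all add: tens_add_right)

lemma orth_family_comult: "orth_family (\<lambda>j k. \<Sum>l\<in>UNIV. vgen j l \<otimes>\<^sub>t vgen l k)"
proof -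
  note o = orth_family_v[unfolded orth_family_def, rule_format]
  have d: "(\<Sum>i\<in>UNIV. \<Sum>m\<in>UNIV. (if i = m then 1 else 0) \<otimes>\<^sub>t (f i m)) = (\<Sum>i\<in>UNIV. 1 \<otimes>\<^sub>t f i i)"
    "(\<Sum>i\<in>UNIV. \<Sum>m\<in>UNIV. f i m \<otimes>\<^sub>t (if i = m then 1 else 0)) = (\<Sum>i\<in>UNIV. f i i \<otimes>\<^sub>t 1)"
    for f :: "'a \<Rightarrow> 'a \<Rightarrow> 'a pol_orth"
    by (simp_all add: if_distrib[of "\<lambda>x. x \<otimes>\<^sub>t _"] if_distrib[of "\<lambda>x. _ \<otimes>\<^sub>t x"] cong: if_cong)
  have "(\<Sum>l\<in>UNIV. (\<Sum>i\<in>UNIV. vgen l i \<otimes>\<^sub>t vgen i j) * (\<Sum>m\<in>UNIV. vgen l m \<otimes>\<^sub>t vgen m k))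
      = (if j = k then 1 else 0)" for j k :: 'a
  proof -
    have "(\<Sum>l\<in>UNIV. (\<Sum>i\<in>UNIV. vgen l i \<otimes>\<^sub>t vgen i j) * (\<Sum>m\<in>UNIV. vgen l m \<otimes>\<^sub>t vgen m k))
        = (\<Sum>l\<in>UNIV. \<Sum>i\<in>UNIV. \<Sum>m\<in>UNIV. (vgen l i * vgen l m) \<otimes>\<^sub>t (vgen i j * vgen m k))"
      by (simp add: sum_product tens_mult)
    also have "\<dots> = (\<Sum>i\<in>UNIV. \<Sum>l\<in>UNIV. \<Sum>m\<in>UNIV. (vgen l i * vgen l m) \<otimes>\<^sub>t (vgen i j * vgen m k))"
      by (rule sum.swap)
    also have "\<dots> = (\<Sum>i\<in>UNIV. \<Sum>m\<in>UNIV. \<Sum>l\<in>UNIV. (vgen l i * vgen l m) \<otimes>\<^sub>t (vgen i j * vgen m k))"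
      by (rule sum.cong[OF refl], rule sum.swap)
    also have "\<dots> = (\<Sum>i\<in>UNIV. \<Sum>m\<in>UNIV. (\<Sum>l\<in>UNIV. vgen l i * vgen l m) \<otimes>\<^sub>t (vgen i j * vgen m k))"
      by (simp add: tens_sum_left)
    also have "\<dots> = 1 \<otimes>\<^sub>t (\<Sum>i\<in>UNIV. vgen i j * vgen i k)"
      by (simp only: o d tens_sum_right[symmetric])
    finally show ?thesis by (simp add: o one_tensor_def)
  qed
  moreover have "(\<Sum>l\<in>UNIV. (\<Sum>i\<in>UNIV. vgen j i \<otimes>\<^sub>t vgen i l) * (\<Sum>m\<in>UNIV. vgen k m \<otimes>\<^sub>t vgen m l))
      = (if j = k then 1 else 0)" for j k :: 'a
  proof -
    have "(\<Sum>l\<in>UNIV. (\<Sum>i\<in>UNIV. vgen j i \<otimes>\<^sub>t vgen i l) * (\<Sum>m\<in>UNIV. vgen k m \<otimes>\<^sub>t vgen m l))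
        = (\<Sum>l\<in>UNIV. \<Sum>i\<in>UNIV. \<Sum>m\<in>UNIV. (vgen j i * vgen k m) \<otimes>\<^sub>t (vgen i l * vgen m l))"
      by (simp add: sum_product tens_mult)
    also have "\<dots> = (\<Sum>i\<in>UNIV. \<Sum>l\<in>UNIV. \<Sum>m\<in>UNIV. (vgen j i * vgen k m) \<otimes>\<^sub>t (vgen i l * vgen m l))"
      by (rule sum.swap)
    also have "\<dots> = (\<Sum>i\<in>UNIV. \<Sum>m\<in>UNIV. \<Sum>l\<in>UNIV. (vgen j i * vgen k m) \<otimes>\<^sub>t (vgen i l * vgen m l))"
      by (rule sum.cong[OF refl], rule sum.swap)
    also have "\<dots> = (\<Sum>i\<in>UNIV. \<Sum>m\<in>UNIV. (vgen j i * vgen k m) \<otimes>\<^sub>t (\<Sum>l\<in>UNIV. vgen i l * vgen m l))"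
      by (simp add: tens_sum_right)
    also have "\<dots> = (\<Sum>i\<in>UNIV. vgen j i * vgen k i) \<otimes>\<^sub>t 1"
      by (simp only: o d tens_sum_left[symmetric])
    finally show ?thesis by (simp add: o one_tensor_def)
  qed
  ultimately show ?thesis by (simp add: orth_family_def)
qed

lemma orth_family_counit: "orth_family (\<lambda>j k :: 'n::finite. if j = k then 1 else 0 :: complex)"
  by (auto simp: orth_family_def if_distrib[of "\<lambda>x. x * _"] cong: if_cong)

lemmas comult_facts = pol_hom_facts[OF orth_family_comult, folded comult_def]
lemmas counit_facts = pol_hom_facts[OF orth_family_counit, folded counit_def]

lemma antipode_facts:
  fixes x y :: "'n::finite pol_orth" and j k :: 'n
  shows "antipode (vgen j k) = vgen k j" "antipode 1 = (1 :: 'n pol_orth)"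
  "antipode (x + y) = antipode x + antipode y"
  "antipode (c *\<^sub>C x) = c *\<^sub>C antipode x"
  "antipode (x * y) = antipode y * antipode x"
proof -
  let ?G = "\<lambda>w. prod_list (map (\<lambda>(j, k). vgen k j) (rev (letters w))) :: 'n pol_orth"
  have m: "?G (w + w') = ?G w' * ?G w" for w w' by simp
  have o: "orth_family (\<lambda>j k. vgen k j :: 'n pol_orth)" using orth_family_v unfolding orth_family_def by blast
  have k: "\<forall>p\<in>orth_ideal. lin_ext (\<lambda>c. c) ?G p = 0"
    by (intro ballI lin_ext_orth_ideal_antimult[OF field_hom_id m]) (simp_all add: o)
  note f = pol_ext_facts[OF field_hom_id k]
  show "antipode (vgen j k) = vgen k j" "antipode 1 = (1 :: 'n pol_orth)"
    "antipode (x + y) = antipode x + antipode y"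
    "antipode (c *\<^sub>C x) = c *\<^sub>C antipode x"
    "antipode (x * y) = antipode y * antipode x"
    by (simp_all add: antipode_def f(1-4) f(6)[OF m])
qed

lemma star_facts:
  fixes x y :: "'n::finite pol_orth" and j k :: 'n
  shows "star (vgen j k) = vgen j k" "star 1 = (1 :: 'n pol_orth)"
  "star (x + y) = star x + star y"
  "star (c *\<^sub>C x) = cnj c *\<^sub>C star x"
  "star (x * y) = star y * star x"
proof -
  let ?G = "\<lambda>w. prod_list (map (\<lambda>(j, k). vgen j k) (rev (letters w))) :: 'n pol_orth"
  have m: "?G (w + w') = ?G w' * ?G w" for w w' by simp
  have k: "\<forall>p\<in>orth_ideal. lin_ext cnj ?G p = 0"
    by (intro ballI lin_ext_orth_ideal_antimult[OF field_hom_cnj m]) (simp_all add: orth_family_v)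
  note f = pol_ext_facts[OF field_hom_cnj k]
  show "star (vgen j k) = vgen j k" "star 1 = (1 :: 'n pol_orth)"
    "star (x + y) = star x + star y"
    "star (c *\<^sub>C x) = cnj c *\<^sub>C star x"
    "star (x * y) = star y * star x"
    by (simp_all add: star_def f(1-4) f(6)[OF m])
qed

lemma star_star: "star (star x) = x"
  by (induction x rule: pol_orth_induct) (simp_all add: star_facts)

instance pol_orth :: (finite) ring_1
proof
  have "counit (0 :: 'a pol_orth) = 0" using counit_facts(3)[of 0 0] by simp
  then show "(0 :: 'a pol_orth) \<noteq> 1" by (metis counit_facts(2) zero_neq_one)
qed

section \<open>Functionals and the adjoint coaction\<close>

text \<open>The slice maps \<open>id \<otimes> \<phi>\<close> and \<open>\<phi> \<otimes> id\<close> for a linear functional \<open>\<phi>\<close>, with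
  \<open>A \<otimes> \<complex>\<close> and \<open>\<complex> \<otimes> B\<close> identified with \<open>A\<close> and \<open>B\<close>.\<close>

definition slice_right :: "('b::complex_vector \<Rightarrow> complex) \<Rightarrow> ('a::complex_vector, 'b) tensor \<Rightarrow> 'a" where
  "slice_right \<phi> = tensor_lift (\<lambda>a b. \<phi> b *\<^sub>C a)"

definition slice_left :: "('a::complex_vector \<Rightarrow> complex) \<Rightarrow> ('a, 'b::complex_vector) tensor \<Rightarrow> 'b" where
  "slice_left \<phi> = tensor_lift (\<lambda>a b. \<phi> a *\<^sub>C b)"

text \<open>\<open>ad(a) = a\<^sub>(\<^sub>1\<^sub>) S(a\<^sub>(\<^sub>3\<^sub>)) \<otimes> a\<^sub>(\<^sub>2\<^sub>)\<close>, where \<open>(id \<otimes> \<Delta>)\<Delta>(a) = a\<^sub>(\<^sub>1\<^sub>) \<otimes> (a\<^sub>(\<^sub>2\<^sub>) \<otimes> a\<^sub>(\<^sub>3\<^sub>))\<close>.\<close>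

definition comult2 :: "'n::finite pol_orth \<Rightarrow> ('n pol_orth, ('n pol_orth, 'n pol_orth) tensor) tensor" where
  "comult2 a = tensor_lift (\<lambda>x y. x \<otimes>\<^sub>t comult y) (comult a)"

definition ad :: "'n::finite pol_orth \<Rightarrow> ('n pol_orth, 'n pol_orth) tensor" where
  "ad a = tensor_lift (\<lambda>x. tensor_lift (\<lambda>y z. (x * antipode z) \<otimes>\<^sub>t y)) (comult2 a)"

lemma cbilinear_slice:
  "clinear \<phi> \<Longrightarrow> cbilinear (\<lambda>a b. \<phi> b *\<^sub>C a)" "clinear \<phi> \<Longrightarrow> cbilinear (\<lambda>a b. \<phi> a *\<^sub>C b)"
  by (simp_all add: cbilinear_def clinear_iff scaleC_add_right scaleC_add_left scaleC_scaleC
      scaleC_complex_def mult.commute)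

lemma slice_right_tens: "clinear \<phi> \<Longrightarrow> slice_right \<phi> (a \<otimes>\<^sub>t b) = \<phi> b *\<^sub>C a"
  by (simp add: slice_right_def tensor_lift_tens cbilinear_slice)

lemma slice_left_tens: "clinear \<phi> \<Longrightarrow> slice_left \<phi> (a \<otimes>\<^sub>t b) = \<phi> a *\<^sub>C b"
  by (simp add: slice_left_def tensor_lift_tens cbilinear_slice)

lemma cbilinear_comult2: "cbilinear (\<lambda>x y. x \<otimes>\<^sub>t comult y)"
  by (simp add: cbilinear_def clinear_iff tens_add_left tens_add_right tens_scaleC_left
      tens_scaleC_right comult_facts)

lemma cbilinear_ad_inner: "cbilinear (\<lambda>y z. (x * antipode z) \<otimes>\<^sub>t y)"
  by (simp add: cbilinear_def clinear_iff tens_add_left tens_add_right tens_scaleC_left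
      tens_scaleC_right antipode_facts distrib_left mult_scaleC_right)

lemma cbilinear_ad: "cbilinear (\<lambda>x. tensor_lift (\<lambda>y z. (x * antipode z) \<otimes>\<^sub>t y))"
  unfolding cbilinear_def clinear_iff
  by (intro conjI allI tensor_lift_add tensor_lift_scaleC tensor_lift_cong_add
      tensor_lift_cong_scaleC cbilinear_ad_inner)
    (simp_all add: tens_add_left tens_scaleC_left distrib_right mult_scaleC_left)

lemma clinear_ad: "clinear ad"
  by (simp add: clinear_iff ad_def comult2_def comult_facts tensor_lift_add tensor_lift_scaleC
      cbilinear_comult2 cbilinear_ad)

lemma tensor_lift_sum:
  "cbilinear f \<Longrightarrow> tensor_lift f (\<Sum>i\<in>A. g i) = (\<Sum>i\<in>A. tensor_lift f (g i))"
  by (induction A rule: infinite_finite_induct) (simp_all add: tensor_lift_0 tensor_lift_add)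

lemma ad_v: "ad (vgen j k) = (\<Sum>p\<in>UNIV. \<Sum>q\<in>UNIV. (vgen j p * vgen k q) \<otimes>\<^sub>t vgen p q)"
  by (simp add: ad_def comult2_def comult_facts tensor_lift_sum tensor_lift_tens
      cbilinear_comult2 cbilinear_ad cbilinear_ad_inner tens_sum_right antipode_facts)

definition ad_invariant :: "('n::finite pol_orth \<Rightarrow> complex) \<Rightarrow> bool" where
  "ad_invariant \<phi> \<longleftrightarrow> (\<forall>a. slice_right \<phi> (ad a) = \<phi> a *\<^sub>C 1)"

definition generating_functional :: "('n::finite pol_orth \<Rightarrow> complex) \<Rightarrow> bool" where
  "generating_functional \<phi> \<longleftrightarrow> clinear \<phi> \<and> (\<forall>a. \<phi> (star a) = cnj (\<phi> a)) \<and> \<phi> 1 = 0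
     \<and> (\<forall>a. counit a = 0 \<longrightarrow> \<phi> (star a * a) \<in> \<real>\<^sub>\<ge>\<^sub>0)"

definition haar_state :: "('n::finite pol_orth \<Rightarrow> complex) \<Rightarrow> bool" where
  "haar_state h \<longleftrightarrow> clinear h \<and> h 1 = 1 \<and> (\<forall>a. h (star a * a) \<in> \<real>\<^sub>\<ge>\<^sub>0)
     \<and> (\<forall>a. slice_right h (comult a) = h a *\<^sub>C 1) \<and> (\<forall>a. slice_left h (comult a) = h a *\<^sub>C 1)"

definition ad_h :: "('n::finite pol_orth \<Rightarrow> complex) \<Rightarrow> 'n pol_orth \<Rightarrow> 'n pol_orth" where
  "ad_h h a = slice_left h (ad a)"


section \<open>Corepresentations\<close>

text \<open>A finite-dimensional corepresentation is a matrix \<open>u\<close> over \<open>'n pol_orth\<close> whose rows and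
  columns are indexed by a finite set \<open>I\<close>.\<close>

definition unitary_corep :: "'i set \<Rightarrow> ('i \<Rightarrow> 'i \<Rightarrow> 'n::finite pol_orth) \<Rightarrow> bool" where
  "unitary_corep I u \<longleftrightarrow> finite I
     \<and> (\<forall>i\<in>I. \<forall>j\<in>I. comult (u i j) = (\<Sum>l\<in>I. u i l \<otimes>\<^sub>t u l j))
     \<and> (\<forall>i\<in>I. \<forall>j\<in>I. (\<Sum>l\<in>I. star (u l i) * u l j) = (if i = j then 1 else 0))
     \<and> (\<forall>i\<in>I. \<forall>j\<in>I. (\<Sum>l\<in>I. u i l * star (u j l)) = (if i = j then 1 else 0))"

text \<open>\<open>T u = w T\<close> for a scalar \<open>J \<times> I\<close> matrix \<open>T\<close>.\<close>

definition intertwiner :: "'i set \<Rightarrow> ('i \<Rightarrow> 'i \<Rightarrow> 'n::finite pol_orth)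
    \<Rightarrow> 'j set \<Rightarrow> ('j \<Rightarrow> 'j \<Rightarrow> 'n pol_orth) \<Rightarrow> ('j \<Rightarrow> 'i \<Rightarrow> complex) \<Rightarrow> bool" where
  "intertwiner I u J w T \<longleftrightarrow>
     (\<forall>j\<in>J. \<forall>i\<in>I. (\<Sum>l\<in>I. T j l *\<^sub>C u l i) = (\<Sum>l\<in>J. T l i *\<^sub>C w j l))"

definition corep_equiv :: "'i set \<Rightarrow> ('i \<Rightarrow> 'i \<Rightarrow> 'n::finite pol_orth)
    \<Rightarrow> 'j set \<Rightarrow> ('j \<Rightarrow> 'j \<Rightarrow> 'n pol_orth) \<Rightarrow> bool" where
  "corep_equiv I u J w \<longleftrightarrow> (\<exists>T T'. intertwiner I u J w T
     \<and> (\<forall>i\<in>I. \<forall>i'\<in>I. (\<Sum>j\<in>J. T' i j * T j i') = (if i = i' then 1 else 0))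
     \<and> (\<forall>j\<in>J. \<forall>j'\<in>J. (\<Sum>i\<in>I. T j i * T' i j') = (if j = j' then 1 else 0)))"

definition irreducible_corep :: "'i set \<Rightarrow> ('i \<Rightarrow> 'i \<Rightarrow> 'n::finite pol_orth) \<Rightarrow> bool" where
  "irreducible_corep I u \<longleftrightarrow> unitary_corep I u \<and> I \<noteq> {}
     \<and> (\<forall>T. intertwiner I u I u T \<longrightarrow> (\<exists>c. \<forall>i\<in>I. \<forall>j\<in>I. T i j = (if i = j then c else 0)))"

definition corep_tensor :: "('i \<Rightarrow> 'i \<Rightarrow> 'n::finite pol_orth) \<Rightarrow> ('j \<Rightarrow> 'j \<Rightarrow> 'n pol_orth)
    \<Rightarrow> 'i \<times> 'j \<Rightarrow> 'i \<times> 'j \<Rightarrow> 'n pol_orth" where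
  "corep_tensor u w = (\<lambda>(i, j) (i', j'). u i i' * w j j')"

definition corep_sum :: "('r \<Rightarrow> 'i \<Rightarrow> 'i \<Rightarrow> 'n::finite pol_orth)
    \<Rightarrow> 'r \<times> 'i \<Rightarrow> 'r \<times> 'i \<Rightarrow> 'n pol_orth" where
  "corep_sum u = (\<lambda>(r, i) (r', i'). if r = r' then u r i i' else 0)"

text \<open>\<open>u s\<close>, of dimension \<open>d s\<close>, is a complete list of representatives of the irreducible unitary
  corepresentations, labelled as usual: \<open>u 0\<close> is trivial, \<open>u 1\<close> is the matrix \<open>vgen\<close> up to an
  enumeration of the index type, and the fusion rules hold.\<close>

definition irreps :: "(nat \<Rightarrow> nat) \<Rightarrow> (nat \<Rightarrow> nat \<Rightarrow> nat \<Rightarrow> 'n::finite pol_orth) \<Rightarrow> bool" where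
  "irreps d u \<longleftrightarrow>
     (\<forall>s. irreducible_corep {..<d s} (u s))
     \<and> (\<forall>s t. corep_equiv {..<d s} (u s) {..<d t} (u t) \<longrightarrow> s = t)
     \<and> (\<forall>m w. irreducible_corep {..<m} (w :: nat \<Rightarrow> nat \<Rightarrow> 'n pol_orth)
          \<longrightarrow> (\<exists>s. corep_equiv {..<m} w {..<d s} (u s)))
     \<and> d 0 = 1 \<and> u 0 0 0 = 1
     \<and> (\<exists>e. bij_betw e {..<d 1} (UNIV :: 'n set) \<and> (\<forall>i<d 1. \<forall>j<d 1. u 1 i j = vgen (e i) (e j)))
     \<and> (\<forall>s t. corep_equiv ({..<d s} \<times> {..<d t}) (corep_tensor (u s) (u t))
          (SIGMA r:(\<lambda>i. nat \<bar>int s - int t\<bar> + 2 * i) ` {..min s t}. {..<d r}) (corep_sum u))"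

definition character :: "(nat \<Rightarrow> nat) \<Rightarrow> (nat \<Rightarrow> nat \<Rightarrow> nat \<Rightarrow> 'n::finite pol_orth) \<Rightarrow> nat \<Rightarrow> 'n pol_orth" where
  "character d u s = (\<Sum>j<d s. u s j j)"


section \<open>Central polynomial functions\<close>

fun cheb :: "nat \<Rightarrow> complex poly" where
  "cheb 0 = 1"
| "cheb (Suc 0) = [:0, 1:]"
| "cheb (Suc (Suc s)) = [:0, 1:] * cheb (Suc s) - cheb s"

text \<open>The isomorphism from the span of the characters to polynomials with
  \<open>\<chi>\<^sub>s \<mapsto> U\<^sub>s\<close>; only its values on that span matter. Polynomial functions on \<open>[-N, N]\<close> are
  represented by the polynomials themselves.\<close>

definition central_to_poly :: "(nat \<Rightarrow> nat) \<Rightarrow> (nat \<Rightarrow> nat \<Rightarrow> nat \<Rightarrow> 'n::finite pol_orth)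
    \<Rightarrow> 'n pol_orth \<Rightarrow> complex poly" where
  "central_to_poly d u a = (THE f. \<exists>m c. a = (\<Sum>s<m. c s *\<^sub>C character d u s)
     \<and> f = (\<Sum>s<m. smult (c s) (cheb s)))"

definition levy_functional :: "real \<Rightarrow> real \<Rightarrow> real measure \<Rightarrow> complex poly \<Rightarrow> complex" where
  "levy_functional N b \<nu> f = - of_real b * poly (pderiv f) (of_real N)
     + (\<integral>x. (poly f (of_real x) - poly f (of_real N)) / of_real (N - x) \<partial>\<nu>)"

end

theory Submission
  imports Defs "HOL-Probability.Probability"
begin

text \<open>An ad-invariant functional factors through the average \<open>ad\<^sub>h\<close>, whose range consists of the
  polynomials in the self-adjoint element \<open>\<chi> = \<Sum>\<^sub>j v\<^sub>j\<^sub>j\<close>.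

  If \<open>\<phi>\<close> is moreover generating, then \<open>g \<mapsto> \<phi> ((N - \<chi>) g(\<chi>))\<close> is a positive functional on polynomials
  over \<open>[-N, N]\<close>, because \<open>2 (N \<mp> \<chi>)\<close> is the sum of the squares of the self-adjoint elements
  \<open>\<delta>\<^sub>k\<^sub>j \<mp> v\<^sub>k\<^sub>j\<close>, which for the upper sign lie in the kernel of the counit. The Hausdorff moment problem
  provides a measure; its atom at \<open>N\<close> is \<open>b\<close> and the rest is \<open>\<nu>\<close>.

  Conversely it suffices that the polynomial of \<open>ad\<^sub>h (a\<^sup>*a)\<close> is nonnegative on \<open>[-N, N]\<close>. Its value at \<open>x\<close> is
  \<open>\<psi> (ad\<^sub>h (a\<^sup>*a))\<close> for the evaluation \<open>\<psi>\<close> at an orthogonal matrix of trace \<open>x\<close>, and since \<open>h\<close> is a trace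
  this equals \<open>h (Z\<^sup>*Z)\<close> with \<open>Z = (id \<otimes> \<psi>) (ad a)\<close>.\<close>

text \<open>The obstacle is that \<phi> is nonnegative only on squares from ker \<epsilon>, so no
  measure represents it directly. For a polynomial f write f - f(N) = (N - x) g. Since \<phi> 1 = 0,
  the value of \<phi> at f(\<chi>) depends on g alone, and in g it is positive without any side
  condition. Because g(N) = - f'(N), an atom of mass b at N contributes - b f'(N): drift term and
  integral come from one measure. Positivity is obtained on products of powers of N - \<chi> and N +
  \<chi>. Up to rescaling these are the Bernstein polynomials, exactly the test functions of the
  Hausdorff moment problem. N \<ge> 2 leaves room for a plane rotation: orthogonal matrices then
  realise every trace in [-N, N], so evaluation at each such x comes from a character, \<epsilon>
  being the one at x = N. For N = 1 only the traces 1 and -1 would occur.\<close>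

section \<open>Linear maps and slices\<close>

lemma clinear_add: "clinear f \<Longrightarrow> f (x + y) = f x + f y"
  and clinear_scaleC: "clinear f \<Longrightarrow> f (c *\<^sub>C x) = c *\<^sub>C f x"
  by (simp_all add: clinear_iff)

lemma clinear_0: "clinear f \<Longrightarrow> f 0 = 0"
  using clinear_scaleC[of f 0 0] by simp

lemma clinear_diff: "clinear f \<Longrightarrow> f (x - y) = f x - f y"
  using clinear_add[of f x "(-1) *\<^sub>C y"] clinear_scaleC[of f "-1" y] by simp

lemma clinear_sum: "clinear f \<Longrightarrow> f (\<Sum>i\<in>A. g i) = (\<Sum>i\<in>A. f (g i))"
  by (induction A rule: infinite_finite_induct) (simp_all add: clinear_0 clinear_add)

lemma clinear_slice_right: "clinear \<phi> \<Longrightarrow> clinear (slice_right \<phi>)"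
  and clinear_slice_left: "clinear \<phi> \<Longrightarrow> clinear (slice_left \<phi>)"
  by (simp_all add: slice_right_def slice_left_def clinear_tensor_lift cbilinear_slice)

text \<open>Both sides are \<phi> \<otimes> \<psi> applied to \<open>t\<close>. With h for \<phi> it
  turns the value of a functional on \<open>ad_h\<close> into h of a slice, where ad-invariance or
  positivity of h can be used.\<close>

lemma slice_swap:
  assumes "clinear \<phi>" "clinear \<psi>"
  shows "\<psi> (slice_left \<phi> t) = \<phi> (slice_right \<psi> t)"
proof (induction t)
  case zero
  then show ?case
    by (simp add: clinear_0 assms clinear_slice_left clinear_slice_right)
next
  case (tens a b)
  then show ?case
    by (simp add: slice_left_tens slice_right_tens assms clinear_scaleC scaleC_complex_def)
next
  case (add s t)
  then show ?case
    by (simp add: clinear_add assms clinear_slice_left clinear_slice_right)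
qed

lemma of_nat_mult_scaleC: "of_nat n * x = of_nat n *\<^sub>C (x :: 'a::{complex_unital_algebra, ring_1})"
  by (induction n) (simp_all add: distrib_right scaleC_add_left)

lemma sum_delta_mult:
  fixes f :: "'i \<Rightarrow> 'a::{ring,monoid_mult}"
  assumes "finite I" "j \<in> I"
  shows "(\<Sum>l\<in>I. (if l = j then 1 else 0) * f l) = f j"
    and "(\<Sum>l\<in>I. (if j = l then 1 else 0) * f l) = f j"
    and "(\<Sum>l\<in>I. f l * (if l = j then 1 else 0)) = f j"
    and "(\<Sum>l\<in>I. f l * (if j = l then 1 else 0)) = f j"
  using assms by (simp_all add: if_distrib[of "\<lambda>x. x * _"] if_distrib[of "\<lambda>x. _ * x"] cong: if_cong)

lemma sum_delta_scaleC:
  assumes "finite I" "j \<in> I"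
  shows "(\<Sum>l\<in>I. (if l = j then c else 0) *\<^sub>C f l) = c *\<^sub>C f j"
    and "(\<Sum>l\<in>I. (if j = l then c else 0) *\<^sub>C f l) = c *\<^sub>C f j"
  using assms by (simp_all add: if_distrib[of "\<lambda>x. x *\<^sub>C _"] cong: if_cong)

section \<open>Counit, antipode and involution\<close>

lemma clinear_counit: "clinear counit"
  and clinear_antipode: "clinear antipode"
  and clinear_comult: "clinear comult"
  by (simp_all add: clinear_iff counit_facts antipode_facts comult_facts)

lemma star_0: "star (0 :: 'n::finite pol_orth) = 0"
  using star_facts(3)[of 0 "0 :: 'n pol_orth"] by simp

lemma star_sum: "star (\<Sum>i\<in>A. f i) = (\<Sum>i\<in>A. star (f i))"
  by (induction A rule: infinite_finite_induct) (simp_all add: star_facts star_0)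

lemma star_minus: "star (- x) = - star x"
  using star_facts(4)[of "-1" x] by simp

lemma star_diff: "star (x - y) = star x - star y"
  using star_facts(3)[of x "- y"] by (simp add: star_minus)

lemma star_delta: "star (if P then 1 else 0) = (if P then 1 else 0)"
  by (simp add: star_facts star_0)

lemma slice_left_counit_mult:
  "slice_left counit (s * t) = slice_left counit s * (slice_left counit t :: 'n::finite pol_orth)"
  (is "?F (s * t) = _")
proof (induction s)
  case (tens a b)
  show ?case
  proof (induction t)
    case (tens c d)
    then show ?case
      by (simp add: tens_mult slice_left_tens clinear_counit counit_facts mult_scaleC_left
          mult_scaleC_right scaleC_scaleC scaleC_complex_def mult.commute)
  qed (simp_all add: clinear_0 clinear_add clinear_slice_left clinear_counit distrib_left)
qed (simp_all add: clinear_0 clinear_add clinear_slice_left clinear_counit distrib_right)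

text \<open>Counit axiom for the concrete presentation: both sides are multiplicative, so the
  generators suffice.\<close>

lemma slice_left_counit_comult: "slice_left counit (comult a) = a"
proof (induction a rule: pol_orth_induct)
  case one
  show ?case by (simp add: comult_facts one_tensor_def slice_left_tens clinear_counit counit_facts)
next
  case (vgen j k)
  show ?case
    by (simp add: comult_facts clinear_sum clinear_slice_left clinear_counit slice_left_tens
        counit_facts sum_delta_scaleC)
qed (simp_all add: comult_facts slice_left_counit_mult clinear_add clinear_scaleC
    clinear_slice_left clinear_counit)

section \<open>Antipode axioms\<close>

lemma cbilinear_antipode_mult: "cbilinear (\<lambda>x y. antipode x * y)"
  by (simp add: cbilinear_def clinear_iff antipode_facts distrib_left distrib_right
      mult_scaleC_left mult_scaleC_right)

text \<open>The left side is not multiplicative in \<open>a\<close>. In a product, however, the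
  contribution of the second factor encloses that of the first, and as soon as the inner part is a
  scalar it can be pulled out. This carries the induction over products.\<close>

lemma antipode_left:
  "tensor_lift (\<lambda>x y. antipode x * y) (comult a) = counit a *\<^sub>C (1 :: 'n::finite pol_orth)"
proof -
  let ?F = "tensor_lift (\<lambda>x y :: 'n pol_orth. antipode x * y)"
  note bil = cbilinear_antipode_mult
  note lin = clinear_0[OF clinear_tensor_lift[OF bil]] clinear_add[OF clinear_tensor_lift[OF bil]]
    clinear_scaleC[OF clinear_tensor_lift[OF bil]] clinear_sum[OF clinear_tensor_lift[OF bil]]
  have *: "?F (s * c \<otimes>\<^sub>t d) = antipode c * ?F s * d" for s c d
    by (induction s) (simp_all add: lin tens_mult tensor_lift_tens bil antipode_facts
        distrib_left distrib_right mult.assoc)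
  have **: "?F (s * t) = e *\<^sub>C ?F t" if "?F s = e *\<^sub>C 1" for s t e
    by (induction t) (simp_all add: lin * that tensor_lift_tens bil mult_scaleC_left
        mult_scaleC_right distrib_left scaleC_add_right)
  show ?thesis
  proof (induction a rule: pol_orth_induct)
    case one
    show ?case by (simp add: comult_facts one_tensor_def tensor_lift_tens bil antipode_facts counit_facts)
  next
    case (vgen j k)
    show ?case
      using orth_family_v[where ?'a = 'n]
      by (simp add: comult_facts lin tensor_lift_tens bil antipode_facts counit_facts orth_family_def)
  next
    case (mult x y)
    show ?case
      by (simp add: comult_facts **[OF mult(1)] mult(2) counit_facts scaleC_scaleC)
  qed (simp_all add: comult_facts lin counit_facts scaleC_add_left scaleC_scaleC scaleC_complex_def)
qed

lemma antipode_star: "antipode (star x) = star (antipode x)"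
  by (induction x rule: pol_orth_induct) (simp_all add: antipode_facts star_facts)

lemma cbilinear_antipode_flip: "cbilinear (\<lambda>x y. antipode y \<otimes>\<^sub>t antipode x)"
  by (simp add: cbilinear_def clinear_iff antipode_facts tens_add_left tens_add_right
      tens_scaleC_left tens_scaleC_right)

text \<open>Both sides are antimultiplicative, so the generators suffice. It gives the
  comultiplication of adjoint entries, which are antipodes of entries.\<close>

lemma comult_antipode:
  "comult (antipode a) = tensor_lift (\<lambda>x y. antipode y \<otimes>\<^sub>t antipode x) (comult (a :: 'n::finite pol_orth))"
proof -
  let ?F = "tensor_lift (\<lambda>x y :: 'n pol_orth. antipode y \<otimes>\<^sub>t antipode x)"
  note bil = cbilinear_antipode_flip
  note lin = clinear_0[OF clinear_tensor_lift[OF bil]] clinear_add[OF clinear_tensor_lift[OF bil]]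
    clinear_scaleC[OF clinear_tensor_lift[OF bil]] clinear_sum[OF clinear_tensor_lift[OF bil]]
  have *: "?F (s * t) = ?F t * ?F s" for s t
  proof (induction s)
    case (tens a b)
    show ?case
      by (induction t) (simp_all add: lin tens_mult tensor_lift_tens bil antipode_facts
          distrib_left distrib_right)
  qed (simp_all add: lin distrib_left distrib_right)
  show ?thesis
  proof (induction a rule: pol_orth_induct)
    case one
    show ?case by (simp add: comult_facts one_tensor_def tensor_lift_tens bil antipode_facts)
  next
    case (vgen j k)
    show ?case by (simp add: comult_facts lin tensor_lift_tens bil antipode_facts)
  qed (simp_all add: comult_facts antipode_facts lin *)
qed

section \<open>Corepresentations\<close>

text \<open>Unitarity is left out so that \<open>ad_corep\<close> applies to a tensor product once
  its comultiplication is known.\<close>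

definition corep :: "'i set \<Rightarrow> ('i \<Rightarrow> 'i \<Rightarrow> 'n::finite pol_orth) \<Rightarrow> bool" where
  "corep I u \<longleftrightarrow> finite I \<and> (\<forall>i\<in>I. \<forall>j\<in>I. comult (u i j) = (\<Sum>l\<in>I. u i l \<otimes>\<^sub>t u l j))"

definition conj_corep :: "('i \<Rightarrow> 'i \<Rightarrow> 'n::finite pol_orth) \<Rightarrow> 'i \<Rightarrow> 'i \<Rightarrow> 'n pol_orth" where
  "conj_corep u = (\<lambda>i j. star (u i j))"

lemma conj_conj_corep: "conj_corep (conj_corep u) = u"
  by (simp add: conj_corep_def star_star)

lemma unitary_corep_corep: "unitary_corep I u \<Longrightarrow> corep I u"
  by (simp add: unitary_corep_def corep_def)

text \<open>The counit axiom reads \<epsilon>(u) u = u for the scalar matrix \<epsilon>(u), and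
  unitarity cancels u on the right.\<close>

lemma counit_corep:
  assumes u: "unitary_corep I u" and ij: "i \<in> I" "j \<in> I"
  shows "counit (u i j) = (if i = j then 1 else 0)"
proof -
  have fin: "finite I" using u by (simp add: unitary_corep_def)
  have *: "(\<Sum>l\<in>I. counit (u i l) *\<^sub>C u l k) = u i k" if "k \<in> I" for k
    using u ij that slice_left_counit_comult[of "u i k"]
    by (simp add: unitary_corep_def clinear_sum clinear_slice_left clinear_counit slice_left_tens)
  have "counit (u i j) *\<^sub>C 1 = (\<Sum>l\<in>I. counit (u i l) *\<^sub>C (if l = j then 1 else 0))"
    using fin ij by (simp add: if_distrib[of "\<lambda>x. _ *\<^sub>C x"] cong: if_cong)
  also have "\<dots> = (\<Sum>l\<in>I. counit (u i l) *\<^sub>C (\<Sum>k\<in>I. u l k * star (u j k)))"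
    using u ij by (intro sum.cong) (auto simp: unitary_corep_def)
  also have "\<dots> = (\<Sum>k\<in>I. (\<Sum>l\<in>I. counit (u i l) *\<^sub>C u l k) * star (u j k))"
    by (simp add: complex_vector.scale_sum_right sum_distrib_right mult_scaleC_left) (rule sum.swap)
  also have "\<dots> = (\<Sum>k\<in>I. u i k * star (u j k))"
    by (simp add: *)
  also have "\<dots> = (if i = j then 1 else 0)"
    using u ij by (simp add: unitary_corep_def)
  \<comment> \<open>Both sides are scalar multiples of 1; a second application of the counit
    extracts the scalars.\<close>
  finally have "counit (counit (u i j) *\<^sub>C (1 :: 'b pol_orth)) = counit (if i = j then 1 else 0 :: 'b pol_orth)"
    by simp
  then show ?thesis
    by (simp add: counit_facts scaleC_complex_def clinear_0 clinear_counit split: if_splits)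
qed

text \<open>By the antipode axiom S(u) is a left inverse of u, by unitarity the adjoint matrix is a
  right inverse; hence they agree.\<close>

lemma antipode_corep:
  assumes u: "unitary_corep I u" and ij: "i \<in> I" "j \<in> I"
  shows "antipode (u i j) = star (u j i)"
proof -
  have fin: "finite I" using u by (simp add: unitary_corep_def)
  have *: "(\<Sum>l\<in>I. antipode (u i l) * u l k) = (if i = k then 1 else 0)" if "k \<in> I" for k
    using u ij that antipode_left[of "u i k"]
    by (simp add: unitary_corep_def clinear_sum clinear_tensor_lift cbilinear_antipode_mult
        tensor_lift_tens counit_corep[OF u])
  have "antipode (u i j) = (\<Sum>l\<in>I. antipode (u i l) * (if l = j then 1 else 0))"
    by (simp only: sum_delta_mult fin ij)
  also have "\<dots> = (\<Sum>l\<in>I. antipode (u i l) * (\<Sum>k\<in>I. u l k * star (u j k)))"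
    using u ij by (intro sum.cong) (auto simp: unitary_corep_def)
  also have "\<dots> = (\<Sum>k\<in>I. (\<Sum>l\<in>I. antipode (u i l) * u l k) * star (u j k))"
    by (simp add: sum_distrib_left sum_distrib_right mult.assoc) (rule sum.swap)
  also have "\<dots> = (\<Sum>k\<in>I. (if i = k then 1 else 0) * star (u j k))"
    by (simp add: *)
  also have "\<dots> = star (u j i)"
    by (simp only: sum_delta_mult fin ij)
  finally show ?thesis .
qed

text \<open>The entrywise adjoint of a unitary corepresentation is again unitary because the antipode is
  involutive (Kac type).\<close>

lemma unitary_conj_corep:
  assumes u: "unitary_corep I u"
  shows "unitary_corep I (conj_corep u)"
proof -
  have fin: "finite I" using u by (simp add: unitary_corep_def)
  \<comment> \<open>Adjoint entries are antipodes of transposed entries, and the flip in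
    \<open>comult_antipode\<close> undoes the transposition.\<close>
  have 1: "comult (star (u i j)) = (\<Sum>l\<in>I. star (u i l) \<otimes>\<^sub>t star (u l j))" if "i \<in> I" "j \<in> I" for i j
  proof -
    have "comult (star (u i j)) = comult (antipode (u j i))"
      by (simp add: antipode_corep[OF u] that)
    also have "\<dots> = (\<Sum>l\<in>I. antipode (u l i) \<otimes>\<^sub>t antipode (u j l))"
      using u that
      by (simp add: comult_antipode unitary_corep_def clinear_sum clinear_tensor_lift
          cbilinear_antipode_flip tensor_lift_tens)
    finally show ?thesis using that by (simp add: antipode_corep[OF u])
  qed
  \<comment> \<open>The antipode reverses products and transposes, so it sends a unitarity relation
    of u to the one with rows and columns exchanged.\<close>
  have 2: "(\<Sum>l\<in>I. u l i * star (u l j)) = (if i = j then 1 else 0)" if "i \<in> I" "j \<in> I" for i j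
  proof -
    have "(\<Sum>l\<in>I. u l i * star (u l j)) = antipode (\<Sum>l\<in>I. u j l * star (u i l))"
      using that by (simp add: clinear_sum clinear_antipode antipode_facts antipode_star
          antipode_corep[OF u] star_star)
    also have "\<dots> = (if i = j then 1 else 0)"
      using u that by (auto simp: unitary_corep_def antipode_facts clinear_0 clinear_antipode)
    finally show ?thesis .
  qed
  have 3: "(\<Sum>l\<in>I. star (u i l) * u j l) = (if i = j then 1 else 0)" if "i \<in> I" "j \<in> I" for i j
  proof -
    have "(\<Sum>l\<in>I. star (u i l) * u j l) = antipode (\<Sum>l\<in>I. star (u l j) * u l i)"
      using that by (simp add: clinear_sum clinear_antipode antipode_facts antipode_star
          antipode_corep[OF u] star_star)
    also have "\<dots> = (if i = j then 1 else 0)"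
      using u that by (auto simp: unitary_corep_def antipode_facts clinear_0 clinear_antipode)
    finally show ?thesis .
  qed
  show ?thesis
    unfolding unitary_corep_def conj_corep_def using fin 1 2 3 by (simp add: star_star)
qed

lemma intertwiner_conj:
  assumes "intertwiner I u J w T"
  shows "intertwiner I (conj_corep u) J (conj_corep w) (\<lambda>j i. cnj (T j i))"
  unfolding intertwiner_def
proof (intro ballI)
  fix j i assume ij: "j \<in> J" "i \<in> I"
  have "star (\<Sum>l\<in>I. T j l *\<^sub>C u l i) = star (\<Sum>l\<in>J. T l i *\<^sub>C w j l)"
    using assms ij by (simp add: intertwiner_def)
  then show "(\<Sum>l\<in>I. cnj (T j l) *\<^sub>C conj_corep u l i) = (\<Sum>l\<in>J. cnj (T l i) *\<^sub>C conj_corep w j l)"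
    by (simp add: star_sum star_facts conj_corep_def)
qed

lemma intertwiner_comp:
  assumes T: "intertwiner I u J w T" and R: "intertwiner J w K z R"
  shows "intertwiner I u K z (\<lambda>k i. \<Sum>j\<in>J. R k j * T j i)"
  unfolding intertwiner_def
proof (intro ballI)
  fix k i assume ki: "k \<in> K" "i \<in> I"
  have "(\<Sum>l\<in>I. (\<Sum>j\<in>J. R k j * T j l) *\<^sub>C u l i) = (\<Sum>l\<in>I. \<Sum>j\<in>J. R k j *\<^sub>C T j l *\<^sub>C u l i)"
    by (simp add: complex_vector.scale_sum_left scaleC_scaleC)
  also have "\<dots> = (\<Sum>j\<in>J. R k j *\<^sub>C (\<Sum>l\<in>I. T j l *\<^sub>C u l i))"
    by (subst sum.swap) (simp add: complex_vector.scale_sum_right)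
  also have "\<dots> = (\<Sum>j\<in>J. R k j *\<^sub>C (\<Sum>l\<in>J. T l i *\<^sub>C w j l))"
    using T ki by (intro sum.cong) (auto simp: intertwiner_def)
  also have "\<dots> = (\<Sum>j\<in>J. \<Sum>l\<in>J. T l i *\<^sub>C R k j *\<^sub>C w j l)"
    by (simp add: complex_vector.scale_sum_right scaleC_scaleC mult.commute)
  also have "\<dots> = (\<Sum>l\<in>J. T l i *\<^sub>C (\<Sum>j\<in>J. R k j *\<^sub>C w j l))"
    by (subst sum.swap) (simp add: complex_vector.scale_sum_right)
  also have "\<dots> = (\<Sum>l\<in>J. T l i *\<^sub>C (\<Sum>j\<in>K. R j l *\<^sub>C z k j))"
    using R ki by (intro sum.cong) (auto simp: intertwiner_def)
  also have "\<dots> = (\<Sum>l\<in>J. \<Sum>j\<in>K. (R j l * T l i) *\<^sub>C z k j)"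
    by (simp add: complex_vector.scale_sum_right scaleC_scaleC mult.commute)
  also have "\<dots> = (\<Sum>j\<in>K. (\<Sum>l\<in>J. R j l * T l i) *\<^sub>C z k j)"
    by (subst sum.swap) (simp add: complex_vector.scale_sum_left)
  finally show "(\<Sum>l\<in>I. (\<Sum>j\<in>J. R k j * T j l) *\<^sub>C u l i) = (\<Sum>j\<in>K. (\<Sum>l\<in>J. R j l * T l i) *\<^sub>C z k j)" .
qed

lemma irreducible_conj_corep:
  assumes u: "irreducible_corep I u"
  shows "irreducible_corep I (conj_corep u)"
  unfolding irreducible_corep_def
proof (intro conjI allI impI)
  show "unitary_corep I (conj_corep u)" "I \<noteq> {}"
    using u by (simp_all add: irreducible_corep_def unitary_conj_corep)
  fix T assume "intertwiner I (conj_corep u) I (conj_corep u) T"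
  from intertwiner_conj[OF this] obtain c where c: "\<forall>i\<in>I. \<forall>j\<in>I. cnj (T i j) = (if i = j then c else 0)"
    using u unfolding conj_conj_corep irreducible_corep_def by metis
  then have "\<forall>i\<in>I. \<forall>j\<in>I. T i j = (if i = j then cnj c else 0)"
    by (metis complex_cnj_cnj complex_cnj_zero)
  then show "\<exists>c. \<forall>i\<in>I. \<forall>j\<in>I. T i j = (if i = j then c else 0)" by blast
qed

lemma corep_equiv_conj:
  assumes "corep_equiv I (conj_corep u) J (conj_corep w)"
  shows "corep_equiv I u J w"
proof -
  obtain T T' where T: "intertwiner I (conj_corep u) J (conj_corep w) T"
    and 1: "\<forall>i\<in>I. \<forall>i'\<in>I. (\<Sum>j\<in>J. T' i j * T j i') = (if i = i' then 1 else 0)"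
    and 2: "\<forall>j\<in>J. \<forall>j'\<in>J. (\<Sum>i\<in>I. T j i * T' i j') = (if j = j' then 1 else 0)"
    using assms unfolding corep_equiv_def by blast
  have "(\<Sum>j\<in>J. cnj (T' i j) * cnj (T j i')) = (if i = i' then 1 else 0)" if "i \<in> I" "i' \<in> I" for i i'
    using arg_cong[OF 1[rule_format, OF that], of cnj] by (simp split: if_splits)
  moreover have "(\<Sum>i\<in>I. cnj (T j i) * cnj (T' i j')) = (if j = j' then 1 else 0)" if "j \<in> J" "j' \<in> J" for j j'
    using arg_cong[OF 2[rule_format, OF that], of cnj] by (simp split: if_splits)
  ultimately show ?thesis
    unfolding corep_equiv_def using intertwiner_conj[OF T] unfolding conj_conj_corep
    by (intro exI[of _ "\<lambda>j i. cnj (T j i)"] exI[of _ "\<lambda>i j. cnj (T' i j)"]) auto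
qed

text \<open>Insert T'T = 1, intertwine, and use cyclicity of the trace; cyclicity is legitimate
  because T and T' have scalar entries.\<close>

lemma corep_equiv_trace:
  assumes "corep_equiv I u J w" "finite I" "finite J"
  shows "(\<Sum>i\<in>I. u i i) = (\<Sum>j\<in>J. w j j)"
proof -
  obtain T T' where T: "intertwiner I u J w T"
    and 1: "\<forall>i\<in>I. \<forall>i'\<in>I. (\<Sum>j\<in>J. T' i j * T j i') = (if i = i' then 1 else 0)"
    and 2: "\<forall>j\<in>J. \<forall>j'\<in>J. (\<Sum>i\<in>I. T j i * T' i j') = (if j = j' then 1 else 0)"
    using assms unfolding corep_equiv_def by blast
  have "(\<Sum>i\<in>I. u i i) = (\<Sum>i\<in>I. \<Sum>l\<in>I. (if i = l then 1 else 0) *\<^sub>C u l i)"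
    by (intro sum.cong refl) (simp add: sum_delta_scaleC assms)
  also have "\<dots> = (\<Sum>i\<in>I. \<Sum>l\<in>I. (\<Sum>j\<in>J. T' i j * T j l) *\<^sub>C u l i)"
    using 1 by (intro sum.cong refl) simp
  also have "\<dots> = (\<Sum>i\<in>I. \<Sum>j\<in>J. T' i j *\<^sub>C (\<Sum>l\<in>I. T j l *\<^sub>C u l i))"
    by (intro sum.cong refl, simp add: complex_vector.scale_sum_left complex_vector.scale_sum_right scaleC_scaleC)
      (rule sum.swap)
  also have "\<dots> = (\<Sum>i\<in>I. \<Sum>j\<in>J. T' i j *\<^sub>C (\<Sum>l\<in>J. T l i *\<^sub>C w j l))"
    using T by (intro sum.cong refl) (auto simp: intertwiner_def)
  also have "\<dots> = (\<Sum>j\<in>J. \<Sum>i\<in>I. \<Sum>l\<in>J. (T l i * T' i j) *\<^sub>C w j l)"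
    by (subst sum.swap) (simp add: complex_vector.scale_sum_right scaleC_scaleC mult.commute)
  also have "\<dots> = (\<Sum>j\<in>J. \<Sum>l\<in>J. (\<Sum>i\<in>I. T l i * T' i j) *\<^sub>C w j l)"
    by (intro sum.cong refl) (subst sum.swap, simp add: complex_vector.scale_sum_left)
  also have "\<dots> = (\<Sum>j\<in>J. \<Sum>l\<in>J. (if l = j then 1 else 0) *\<^sub>C w j l)"
    using 2 by (intro sum.cong refl) simp
  also have "\<dots> = (\<Sum>j\<in>J. w j j)"
    by (intro sum.cong refl) (simp add: sum_delta_scaleC assms)
  finally show ?thesis .
qed

section \<open>Orthogonality relations\<close>

lemma haar_state_clinear: "haar_state h \<Longrightarrow> clinear h"
  by (simp add: haar_state_def)

text \<open>Polarisation: h is real on \<open>star x * x\<close> for x = 1 + c a, and c = 1 and c =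
  \<i> give the imaginary and the real part of the claim.\<close>

lemma haar_state_star:
  assumes "haar_state h"
  shows "h (star a) = cnj (h a)"
proof -
  have lin: "clinear h" and one: "h 1 = 1" and pos: "\<And>a. Im (h (star a * a)) = 0"
    using assms by (auto simp: haar_state_def complex_nonneg_Reals_iff)
  have *: "h (star (1 + c *\<^sub>C a) * (1 + c *\<^sub>C a)) = 1 + c * h a + cnj c * h (star a) + cnj c * c * h (star a * a)" for c
    by (simp add: star_facts distrib_left distrib_right mult_scaleC_left mult_scaleC_right scaleC_scaleC
        clinear_add[OF lin] clinear_scaleC[OF lin] one scaleC_complex_def algebra_simps)
  have "Im (h a + h (star a)) = 0"
    using pos[of "1 + 1 *\<^sub>C a"] pos[of a] unfolding * by simp
  moreover have "Re (h a) - Re (h (star a)) = 0"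
    using pos[of "1 + \<i> *\<^sub>C a"] pos[of a] unfolding * by simp
  ultimately show ?thesis by (simp add: complex_eq_iff)
qed

text \<open>Invariance of h in matrix form: E = u E w', where E is the scalar matrix with entries
  \<open>h (u i p * star (w j q))\<close> and w' is the adjoint of w.\<close>

lemma haar_corep_pair:
  assumes h: "haar_state h" and u: "unitary_corep I u" and w: "unitary_corep J w"
    and idx: "p \<in> I" "q \<in> J" "i \<in> I" "j \<in> J"
  shows "(\<Sum>a\<in>I. \<Sum>b\<in>J. h (u a p * star (w b q)) *\<^sub>C (u i a * star (w j b)))
    = h (u i p * star (w j q)) *\<^sub>C 1"
proof -
  have lin: "clinear h" using h by (rule haar_state_clinear)
  have "comult (star (w j q)) = (\<Sum>b\<in>J. star (w j b) \<otimes>\<^sub>t star (w b q))"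
    using unitary_conj_corep[OF w] idx by (simp add: unitary_corep_def conj_corep_def)
  moreover have "comult (u i p) = (\<Sum>a\<in>I. u i a \<otimes>\<^sub>t u a p)"
    using u idx by (simp add: unitary_corep_def)
  ultimately have "comult (u i p * star (w j q))
      = (\<Sum>a\<in>I. \<Sum>b\<in>J. (u i a * star (w j b)) \<otimes>\<^sub>t (u a p * star (w b q)))"
    by (simp add: comult_facts sum_product tens_mult)
  moreover have "slice_right h (comult (u i p * star (w j q))) = h (u i p * star (w j q)) *\<^sub>C 1"
    using h by (simp add: haar_state_def)
  ultimately show ?thesis
    by (simp add: clinear_sum[OF clinear_slice_right[OF lin]] lin slice_right_tens)
qed

text \<open>Multiply E = u E w' on the right by w and use w' w = 1 to get E w = u E.\<close>

lemma haar_intertwiner: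
  assumes h: "haar_state h" and u: "unitary_corep I u" and w: "unitary_corep J w"
    and idx: "p \<in> I" "q \<in> J"
  shows "intertwiner J w I u (\<lambda>i j. h (u i p * star (w j q)))"
  unfolding intertwiner_def
proof (intro ballI)
  fix i k assume ik: "i \<in> I" "k \<in> J"
  have fin: "finite J" using w by (simp add: unitary_corep_def)
  let ?E = "\<lambda>i j. h (u i p * star (w j q))"
  have "(\<Sum>l\<in>J. ?E i l *\<^sub>C w l k) = (\<Sum>l\<in>J. (?E i l *\<^sub>C 1) * w l k)"
    by (simp add: mult_scaleC_left)
  also have "\<dots> = (\<Sum>l\<in>J. (\<Sum>a\<in>I. \<Sum>b\<in>J. ?E a b *\<^sub>C (u i a * star (w l b))) * w l k)"
    using haar_corep_pair[OF h u w idx ik(1)] by (intro sum.cong) auto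
  also have "\<dots> = (\<Sum>l\<in>J. \<Sum>a\<in>I. \<Sum>b\<in>J. ?E a b *\<^sub>C (u i a * (star (w l b) * w l k)))"
    by (simp add: sum_distrib_right mult_scaleC_left mult.assoc)
  also have "\<dots> = (\<Sum>a\<in>I. \<Sum>l\<in>J. \<Sum>b\<in>J. ?E a b *\<^sub>C (u i a * (star (w l b) * w l k)))"
    by (rule sum.swap)
  also have "\<dots> = (\<Sum>a\<in>I. \<Sum>b\<in>J. \<Sum>l\<in>J. ?E a b *\<^sub>C (u i a * (star (w l b) * w l k)))"
    by (rule sum.cong[OF refl], rule sum.swap)
  also have "\<dots> = (\<Sum>a\<in>I. \<Sum>b\<in>J. ?E a b *\<^sub>C (u i a * (\<Sum>l\<in>J. star (w l b) * w l k)))"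
    by (simp add: complex_vector.scale_sum_right sum_distrib_left)
  also have "\<dots> = (\<Sum>a\<in>I. \<Sum>b\<in>J. ?E a b *\<^sub>C (u i a * (if b = k then 1 else 0)))"
    using w ik by (intro sum.cong refl arg_cong[where f = "\<lambda>x. _ *\<^sub>C (_ * x)"]) (auto simp: unitary_corep_def)
  also have "\<dots> = (\<Sum>a\<in>I. ?E a k *\<^sub>C u i a)"
    using fin ik by (intro sum.cong refl)
      (simp add: if_distrib[of "\<lambda>x. _ *\<^sub>C (_ * x)"] cong: if_cong)
  finally show "(\<Sum>l\<in>J. ?E i l *\<^sub>C w l k) = (\<Sum>a\<in>I. ?E a k *\<^sub>C u i a)" .
qed

lemma irreducible_corepD:
  assumes "irreducible_corep I u" "intertwiner I u I u T"
  shows "\<exists>c. \<forall>i\<in>I. \<forall>j\<in>I. T i j = (if i = j then c else 0)"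
  using assms unfolding irreducible_corep_def by blast

text \<open>Irreducibility makes E a scalar c. Its trace is computed with the relation for columns
  without a twist, that is, with unitarity of the conjugate; therefore the constant is the ordinary
  dimension.\<close>

lemma haar_orthogonality:
  assumes h: "haar_state h" and u: "irreducible_corep I u"
    and idx: "p \<in> I" "q \<in> I" "i \<in> I" "j \<in> I"
  shows "h (u i p * star (u j q)) = (if i = j \<and> p = q then 1 / of_nat (card I) else 0)"
proof -
  have uu: "unitary_corep I u" using u by (simp add: irreducible_corep_def)
  have fin: "finite I" using uu by (simp add: unitary_corep_def)
  have card: "card I \<noteq> 0" using fin idx by auto
  have lin: "clinear h" using h by (rule haar_state_clinear)
  obtain c where c: "\<forall>i\<in>I. \<forall>j\<in>I. h (u i p * star (u j q)) = (if i = j then c else 0)"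
    using irreducible_corepD[OF u haar_intertwiner[OF h uu uu idx(1,2)]] by blast
  have "of_nat (card I) * c = (\<Sum>i\<in>I. h (u i p * star (u i q)))"
    by (simp add: c)
  also have "\<dots> = h (\<Sum>i\<in>I. u i p * star (u i q))"
    by (simp add: clinear_sum[OF lin])
  also have "(\<Sum>i\<in>I. u i p * star (u i q)) = (if p = q then 1 else 0)"
    using unitary_conj_corep[OF uu] idx by (simp add: unitary_corep_def conj_corep_def star_star)
  also have "h \<dots> = (if p = q then 1 else 0)"
    using h by (simp add: haar_state_def clinear_0)
  finally have "c = (if p = q then 1 / of_nat (card I) else 0)"
    using card by (auto simp: field_simps split: if_splits)
  then show ?thesis by (simp add: c idx)
qed

text \<open>Schur's lemma from scalar commutants alone: E and its adjoint both intertwine, so both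
  of their products are scalars. If E has a nonzero entry, E is invertible up to a factor and the
  corepresentations are equivalent.\<close>

lemma haar_orthogonality_inequivalent:
  assumes h: "haar_state h" and u: "irreducible_corep I u" and w: "irreducible_corep J w"
    and ne: "\<not> corep_equiv J w I u"
    and idx: "p \<in> I" "q \<in> J" "i \<in> I" "j \<in> J"
  shows "h (u i p * star (w j q)) = 0"
proof (rule ccontr)
  assume nz: "h (u i p * star (w j q)) \<noteq> 0"
  have uu: "unitary_corep I u" and ww: "unitary_corep J w"
    using u w by (simp_all add: irreducible_corep_def)
  have fin: "finite I" "finite J" using uu ww by (simp_all add: unitary_corep_def)
  define E where "E i j = h (u i p * star (w j q))" for i j
  have E: "intertwiner J w I u E"
    using haar_intertwiner[OF h uu ww idx(1,2)] by (simp add: E_def[abs_def])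
  have "h (w j q * star (u i p)) = cnj (E i j)" for i j
    using haar_state_star[OF h, of "u i p * star (w j q)"] by (simp add: star_facts star_star E_def)
  then have E': "intertwiner I u J w (\<lambda>j i. cnj (E i j))"
    using haar_intertwiner[OF h ww uu idx(2,1)] by simp
  obtain c where c: "\<forall>i\<in>I. \<forall>i'\<in>I. (\<Sum>j\<in>J. E i j * cnj (E i' j)) = (if i = i' then c else 0)"
    using irreducible_corepD[OF u intertwiner_comp[OF E' E]] by blast
  obtain c' where c': "\<forall>j\<in>J. \<forall>j'\<in>J. (\<Sum>i\<in>I. cnj (E i j) * E i j') = (if j = j' then c' else 0)"
    using irreducible_corepD[OF w intertwiner_comp[OF E E']] by blast
  have "c = of_real (\<Sum>j\<in>J. (cmod (E i j))\<^sup>2)"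
    using c[rule_format, OF idx(3) idx(3)] by (simp flip: complex_norm_square)
  moreover have "(\<Sum>j\<in>J. (cmod (E i j))\<^sup>2) > 0"
    using fin idx nz by (intro sum_pos2[of _ j]) (auto simp: E_def)
  ultimately have c0: "c \<noteq> 0" by (metis less_irrefl of_real_eq_0_iff)
  \<comment> \<open>Associativity of E E' E, with E' the adjoint of E, compared at a nonzero entry
    identifies the two scalars \<open>c\<close> and \<open>c'\<close>.\<close>
  have "c * E i j = (\<Sum>i'\<in>I. (if i = i' then c else 0) * E i' j)"
    using fin idx by (simp add: if_distrib[of "\<lambda>x. x * _"] cong: if_cong)
  also have "\<dots> = (\<Sum>i'\<in>I. (\<Sum>j'\<in>J. E i j' * cnj (E i' j')) * E i' j)"
    using idx by (intro sum.cong refl) (simp add: c)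
  also have "\<dots> = (\<Sum>j'\<in>J. E i j' * (\<Sum>i'\<in>I. cnj (E i' j') * E i' j))"
    by (simp add: sum_distrib_left sum_distrib_right mult.assoc) (rule sum.swap)
  also have "\<dots> = (\<Sum>j'\<in>J. E i j' * (if j' = j then c' else 0))"
    using idx by (intro sum.cong refl) (simp add: c')
  also have "\<dots> = c' * E i j"
    using fin idx by (simp add: if_distrib[of "\<lambda>x. _ * x"] mult.commute cong: if_cong)
  finally have cc: "c' = c" using nz by (simp add: E_def)
  have "corep_equiv J w I u"
    unfolding corep_equiv_def
  proof (intro exI conjI ballI)
    show "intertwiner J w I u E" by (rule E)
    fix j j' assume "j \<in> J" "j' \<in> J"
    then show "(\<Sum>i\<in>I. (cnj (E i j) / c) * E i j') = (if j = j' then 1 else 0)"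
      using c'[rule_format, of j j'] c0 cc by (simp add: sum_divide_distrib[symmetric])
  next
    fix i i' assume "i \<in> I" "i' \<in> I"
    then show "(\<Sum>j\<in>J. E i j * (cnj (E i' j) / c)) = (if i = i' then 1 else 0)"
      using c[rule_format, of i i'] c0 by (simp add: sum_divide_distrib[symmetric])
  qed
  with ne show False by simp
qed

section \<open>The adjoint coaction on coefficients\<close>

lemma ad_corep:
  assumes u: "corep I u" and ij: "i \<in> I" "j \<in> I"
  shows "ad (u i j) = (\<Sum>p\<in>I. \<Sum>q\<in>I. (u i p * antipode (u q j)) \<otimes>\<^sub>t u p q)"
  using assms
  by (simp add: corep_def ad_def comult2_def tensor_lift_sum tensor_lift_tens
      cbilinear_comult2 cbilinear_ad cbilinear_ad_inner tens_sum_right)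

lemma clinear_ad_h:
  fixes h :: "'n::finite pol_orth \<Rightarrow> complex"
  assumes "clinear h"
  shows "clinear (ad_h h)"
  unfolding clinear_iff ad_h_def
  by (simp add: clinear_add[OF clinear_ad] clinear_scaleC[OF clinear_ad]
      clinear_add[OF clinear_slice_left[OF assms]] clinear_scaleC[OF clinear_slice_left[OF assms]])

lemma ad_h_corep:
  assumes h: "haar_state h" and u: "irreducible_corep I u" and ij: "i \<in> I" "j \<in> I"
  shows "ad_h h (u i j) = (if i = j then 1 / of_nat (card I) else 0) *\<^sub>C (\<Sum>k\<in>I. u k k)"
proof -
  have uu: "unitary_corep I u" using u by (simp add: irreducible_corep_def)
  have fin: "finite I" using uu by (simp add: unitary_corep_def)
  have lin: "clinear h" using h by (rule haar_state_clinear)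
  have "ad_h h (u i j) = (\<Sum>p\<in>I. \<Sum>q\<in>I. h (u i p * star (u j q)) *\<^sub>C u p q)"
    using ij by (simp add: ad_h_def ad_corep[OF unitary_corep_corep[OF uu]] clinear_sum[OF clinear_slice_left[OF lin]] lin
        slice_left_tens antipode_corep[OF uu])
  also have "\<dots> = (\<Sum>p\<in>I. \<Sum>q\<in>I. (if q = p then (if i = j then 1 / of_nat (card I) else 0) else 0) *\<^sub>C u p q)"
    using ij by (intro sum.cong refl) (simp add: haar_orthogonality[OF h u])
  also have "\<dots> = (\<Sum>p\<in>I. (if i = j then 1 / of_nat (card I) else 0) *\<^sub>C u p p)"
    by (intro sum.cong refl) (simp only: sum_delta_scaleC fin)
  finally show ?thesis by (simp add: complex_vector.scale_sum_right)
qed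

section \<open>Consequences of the fusion rules\<close>

lemma irrepsD:
  assumes "irreps d u"
  shows "irreducible_corep {..<d s} (u s)"
    and "corep_equiv {..<d s} (u s) {..<d t} (u t) \<Longrightarrow> s = t"
    and "unitary_corep {..<d s} (u s)"
  using assms by (simp_all add: irreps_def irreducible_corep_def)

lemma irreps_fundamental:
  fixes u :: "nat \<Rightarrow> nat \<Rightarrow> nat \<Rightarrow> 'n::finite pol_orth"
  assumes "irreps d u"
  shows "\<exists>e. bij_betw e {..<d 1} (UNIV :: 'n set) \<and> (\<forall>i<d 1. \<forall>j<d 1. u 1 i j = vgen (e i) (e j))"
  using assms unfolding irreps_def by (elim conjE)

definition fusion_set :: "nat \<Rightarrow> nat \<Rightarrow> nat set" where
  "fusion_set s t = (\<lambda>i. nat \<bar>int s - int t\<bar> + 2 * i) ` {..min s t}"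

lemma irreps_fusion:
  "irreps d u \<Longrightarrow> corep_equiv ({..<d s} \<times> {..<d t}) (corep_tensor (u s) (u t))
          (SIGMA r:fusion_set s t. {..<d r}) (corep_sum u)"
  by (simp add: irreps_def fusion_set_def)

lemma character_mult:
  assumes "irreps d u"
  shows "character d u s * character d u t = (\<Sum>r\<in>fusion_set s t. character d u r)"
proof -
  have "character d u s * character d u t
      = (\<Sum>i\<in>{..<d s} \<times> {..<d t}. corep_tensor (u s) (u t) i i)"
    by (simp add: character_def sum_product sum.cartesian_product corep_tensor_def case_prod_unfold)
  also have "\<dots> = (\<Sum>j\<in>(SIGMA r:fusion_set s t. {..<d r}). corep_sum u j j)"
    by (rule corep_equiv_trace[OF irreps_fusion[OF assms]]) (auto simp: fusion_set_def)
  also have "\<dots> = (\<Sum>r\<in>fusion_set s t. character d u r)"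
    by (simp add: character_def corep_sum_def case_prod_unfold)
      (subst sum.Sigma, auto simp: fusion_set_def case_prod_unfold)
  finally show ?thesis .
qed

text \<open>The product is an entry of the tensor product of u^(1) and u^(s). Undoing the fusion
  equivalence by \<open>T'\<close> expresses it through entries of a direct sum of
  irreducibles.\<close>

lemma vgen_mult_coefficient:
  assumes ir: "irreps d u" and kl: "k < d s" "l < d s"
  shows "vgen i j * u s k l \<in> complex_vector.span {u r a b | r a b. a < d r \<and> b < d r}"
    (is "_ \<in> complex_vector.span ?B")
proof -
  obtain e where e: "bij_betw e {..<d 1} (UNIV :: 'a set)"
    and ue: "\<And>i j. i < d 1 \<Longrightarrow> j < d 1 \<Longrightarrow> u 1 i j = vgen (e i) (e j)"
    using irreps_fundamental[OF ir] by blast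
  have "i \<in> e ` {..<d 1}" "j \<in> e ` {..<d 1}" using e by (simp_all add: bij_betw_def)
  then obtain i' j' where ij: "i' < d 1" "j' < d 1" "i = e i'" "j = e j'" by blast
  let ?I = "{..<d 1} \<times> {..<d s}" and ?J = "SIGMA r:fusion_set 1 s. {..<d r}"
  let ?U = "corep_tensor (u 1) (u s)" and ?W = "corep_sum u"
  obtain T T' where T: "intertwiner ?I ?U ?J ?W T"
    and TT: "\<forall>i\<in>?I. \<forall>i'\<in>?I. (\<Sum>j\<in>?J. T' i j * T j i') = (if i = i' then 1 else 0)"
    using irreps_fusion[OF ir, of 1 s] unfolding corep_equiv_def by blast
  have mem: "(i', k) \<in> ?I" "(j', l) \<in> ?I" using ij kl by auto
  have "vgen i j * u s k l = ?U (i', k) (j', l)"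
    using ue[OF ij(1,2)] ij by (simp add: corep_tensor_def)
  also have "\<dots> = (\<Sum>x\<in>?I. (if (i', k) = x then 1 else 0) *\<^sub>C ?U x (j', l))"
    using mem by (simp only: sum_delta_scaleC finite_cartesian_product finite_lessThan complex_vector.scale_one)
  also have "\<dots> = (\<Sum>x\<in>?I. (\<Sum>y\<in>?J. T' (i', k) y * T y x) *\<^sub>C ?U x (j', l))"
    by (intro sum.cong refl arg_cong[where f = "\<lambda>c. c *\<^sub>C _"] TT[rule_format, OF mem(1), symmetric])
  also have "\<dots> = (\<Sum>y\<in>?J. T' (i', k) y *\<^sub>C (\<Sum>x\<in>?I. T y x *\<^sub>C ?U x (j', l)))"
    by (simp only: complex_vector.scale_sum_left complex_vector.scale_sum_right scaleC_scaleC)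
      (rule sum.swap)
  also have "\<dots> = (\<Sum>y\<in>?J. T' (i', k) y *\<^sub>C (\<Sum>x\<in>?J. T x (j', l) *\<^sub>C ?W y x))"
    by (intro sum.cong refl arg_cong[where f = "\<lambda>c. _ *\<^sub>C c"]
        T[unfolded intertwiner_def, rule_format] mem(2))
  also have "\<dots> \<in> complex_vector.span ?B"
  proof (intro complex_vector.span_sum complex_vector.span_scale)
    fix y x assume yx: "y \<in> ?J" "x \<in> ?J"
    obtain r a r' b where "y = (r, a)" "x = (r', b)" by (cases y, cases x)
    with yx have "?W y x = 0 \<or> ?W y x \<in> ?B" by (auto simp: corep_sum_def)
    then show "?W y x \<in> complex_vector.span ?B"
      by (auto intro: complex_vector.span_zero complex_vector.span_base)
  qed
  finally show ?thesis .
qed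

text \<open>The span is stable under left multiplication by the generators, hence by the whole
  algebra, and it contains 1.\<close>

lemma span_coefficients:
  assumes ir: "irreps d u"
  shows "x \<in> complex_vector.span {u r a b | r a b. a < d r \<and> b < d r}"
    (is "_ \<in> complex_vector.span ?B")
proof -
  have "\<forall>z\<in>complex_vector.span ?B. x * z \<in> complex_vector.span ?B"
  proof (induction x rule: pol_orth_induct)
    case (vgen j k)
    show ?case
    proof
      fix z assume "z \<in> complex_vector.span ?B"
      then show "vgen j k * z \<in> complex_vector.span ?B"
      proof (induction rule: complex_vector.span_induct_alt)
        case base
        then show ?case by (simp add: complex_vector.span_zero)
      next
        case (step c x y)
        then obtain r a b where "x = u r a b" "a < d r" "b < d r" by auto
        then show ?case
          using step vgen_mult_coefficient[OF ir]
          by (simp add: distrib_left mult_scaleC_right complex_vector.span_add complex_vector.span_scale)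
      qed
    qed
  qed (auto simp: distrib_right mult_scaleC_left mult.assoc complex_vector.span_add complex_vector.span_scale)
  moreover have "u 0 0 0 = 1" "d 0 = 1" using ir by (simp_all add: irreps_def)
  then have "1 \<in> complex_vector.span ?B"
    by (intro complex_vector.span_base) (metis (mono_tags, lifting) CollectI zero_less_one)
  ultimately show ?thesis by force
qed

lemma irreps_induct [consumes 1, case_names coeff add scaleC]:
  assumes ir: "irreps d u"
    and "\<And>s i j. i < d s \<Longrightarrow> j < d s \<Longrightarrow> P (u s i j)"
    and "\<And>x y. P x \<Longrightarrow> P y \<Longrightarrow> P (x + y)" and "\<And>c x. P x \<Longrightarrow> P (c *\<^sub>C x)"
  shows "P x"
  using span_coefficients[OF ir, of x]
proof (induction rule: complex_vector.span_induct_alt)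
  case base
  have "0 = 0 *\<^sub>C u 0 0 0" by simp
  moreover have "P (u 0 0 0)" using ir by (intro assms(2)) (simp_all add: irreps_def)
  ultimately show ?case using assms(4) by metis
qed (use assms in auto)

text \<open>Orthogonality for \<open>u\<close> and for its conjugate give the same value to \<open>h (ab\<^sup>*)\<close> and
  \<open>h (b\<^sup>*a)\<close>.\<close>

lemma haar_state_trace:
  fixes u :: "nat \<Rightarrow> nat \<Rightarrow> nat \<Rightarrow> 'n::finite pol_orth" and h :: "'n pol_orth \<Rightarrow> complex"
  assumes ir: "irreps d u" and h: "haar_state h"
  shows "h (a * b) = h (b * a)"
proof -
  have lin: "clinear h" using h by (rule haar_state_clinear)
  have *: "h (u s i p * star (u t j q)) = h (star (u t j q) * u s i p)"
    if "i < d s" "p < d s" "j < d t" "q < d t" for s t i p j q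
  proof (cases "s = t")
    case True
    then show ?thesis
      using that haar_orthogonality[OF h irrepsD(1)[OF ir, of s], of p q i j]
        haar_orthogonality[OF h irreducible_conj_corep[OF irrepsD(1)[OF ir, of s]], of q p j i]
      by (auto simp: conj_corep_def star_star)
  next
    case False
    then have "\<not> corep_equiv {..<d t} (u t) {..<d s} (u s)"
      "\<not> corep_equiv {..<d s} (conj_corep (u s)) {..<d t} (conj_corep (u t))"
      using irrepsD(2)[OF ir] corep_equiv_conj by metis+
    then show ?thesis
      using that haar_orthogonality_inequivalent[OF h irrepsD(1)[OF ir, of s] irrepsD(1)[OF ir, of t], of p q i j]
        haar_orthogonality_inequivalent[OF h irreducible_conj_corep[OF irrepsD(1)[OF ir, of t]]
          irreducible_conj_corep[OF irrepsD(1)[OF ir, of s]], of q p j i]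
      by (auto simp: conj_corep_def star_star)
  qed
  \<comment> \<open>Orthogonality concerns a coefficient times an adjoint coefficient, so the
    extension by linearity is made in \<open>a\<close> and \<open>star b\<close>.\<close>
  have "h (a * star b) = h (star b * a)" for b
    using ir
  proof (induction b rule: irreps_induct)
    case (coeff s i j)
    from ir show ?case
    proof (induction a rule: irreps_induct)
      case (coeff t k l)
      then show ?case using * \<open>i < d s\<close> \<open>j < d s\<close> by simp
    qed (simp_all add: distrib_left distrib_right mult_scaleC_left mult_scaleC_right
        clinear_add[OF lin] clinear_scaleC[OF lin])
  qed (simp_all add: star_facts distrib_left distrib_right mult_scaleC_left mult_scaleC_right
      clinear_add[OF lin] clinear_scaleC[OF lin])
  from this[of "star b"] show ?thesis by (simp add: star_star)
qed

section \<open>Polynomials in an algebra element\<close>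

text \<open>Horner's scheme with scalar coefficients and values in a noncommutative algebra.\<close>

definition alg_poly :: "'a::complex_unital_algebra \<Rightarrow> complex poly \<Rightarrow> 'a" where
  "alg_poly x p = fold_coeffs (\<lambda>c y. c *\<^sub>C 1 + x * y) p 0"

lemma alg_poly_0 [simp]: "alg_poly x 0 = 0"
  by (simp add: alg_poly_def)

lemma alg_poly_pCons [simp]: "alg_poly x (pCons c p) = c *\<^sub>C 1 + x * alg_poly x p"
  by (cases "p = 0 \<and> c = 0") (auto simp: alg_poly_def)

lemma alg_poly_1 [simp]: "alg_poly x 1 = 1"
  by (simp add: one_pCons)

lemma alg_poly_add: "alg_poly x (p + q) = alg_poly x p + alg_poly x q"
  by (induction p q rule: poly_induct2) (simp_all add: scaleC_add_left distrib_left)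

lemma alg_poly_smult: "alg_poly x (smult c p) = c *\<^sub>C alg_poly x p"
  by (induction p) (simp_all add: scaleC_add_right scaleC_scaleC mult_scaleC_right)

lemma alg_poly_mult: "alg_poly x (p * q) = alg_poly x p * alg_poly x q"
  by (induction p) (simp_all add: alg_poly_add alg_poly_smult distrib_right mult_scaleC_left mult.assoc)

lemma alg_poly_minus: "alg_poly x (- p) = - alg_poly x p"
  using alg_poly_smult[of x "-1" p] by simp

lemma alg_poly_diff: "alg_poly x (p - q) = alg_poly x p - alg_poly x q"
  using alg_poly_add[of x p "- q"] by (simp add: alg_poly_minus)

lemma alg_poly_sum: "alg_poly x (\<Sum>i\<in>A. f i) = (\<Sum>i\<in>A. alg_poly x (f i))"
  by (induction A rule: infinite_finite_induct) (simp_all add: alg_poly_add)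

lemma alg_poly_commute: "x * alg_poly x p = alg_poly x p * x"
  using alg_poly_mult[of x "[:0, 1:]" p] alg_poly_mult[of x p "[:0, 1:]"] by (simp add: mult.commute)

lemma star_alg_poly:
  assumes "star x = x"
  shows "star (alg_poly x p) = alg_poly x (map_poly cnj p)"
  by (induction p) (simp_all add: star_0 star_facts map_poly_pCons assms alg_poly_commute)

lemma hom_alg_poly:
  assumes "clinear \<psi>" "\<psi> 1 = 1" "\<And>x y. \<psi> (x * y) = \<psi> x * (\<psi> y :: complex)"
  shows "\<psi> (alg_poly x p) = poly p (\<psi> x)"
  by (induction p) (simp_all add: clinear_0[OF assms(1)] clinear_add[OF assms(1)] clinear_scaleC[OF assms(1)]
      assms(2,3) scaleC_complex_def)

section \<open>The fundamental character\<close>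

definition fund_char :: "'n::finite pol_orth" where
  "fund_char = (\<Sum>j\<in>UNIV. vgen j j)"

lemma star_fund_char: "star fund_char = fund_char"
  by (simp add: fund_char_def star_sum star_facts)

lemma counit_fund_char: "counit (fund_char :: 'n::finite pol_orth) = of_nat CARD('n)"
  by (simp add: fund_char_def clinear_sum[OF clinear_counit] counit_facts)

lemma character_1:
  assumes "irreps d u"
  shows "character d u 1 = fund_char"
proof -
  obtain e where e: "bij_betw e {..<d 1} (UNIV :: 'a set)"
    and ue: "\<forall>i<d 1. \<forall>j<d 1. u 1 i j = vgen (e i) (e j)"
    using irreps_fundamental[OF assms] by blast
  have "character d u 1 = (\<Sum>j<d 1. vgen (e j) (e j))"
    unfolding character_def using ue by (intro sum.cong) auto
  also have "\<dots> = fund_char"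
    unfolding fund_char_def by (rule sum.reindex_bij_betw[OF e])
  finally show ?thesis .
qed

text \<open>Fusion of u^(1) with u^(s+1) yields u^(s) and u^(s+2); on characters this is the
  Chebyshev recurrence.\<close>

lemma character_cheb:
  assumes "irreps d u"
  shows "character d u s = alg_poly fund_char (cheb s)"
proof (induction s rule: cheb.induct)
  case 1
  then show ?case using assms by (simp add: irreps_def character_def)
next
  case 2
  then show ?case using character_1[OF assms] by simp
next
  case (3 s)
  have "fusion_set 1 (Suc s) = {s, Suc (Suc s)}"
    by (auto simp: fusion_set_def atMost_Suc)
  then have "character d u 1 * character d u (Suc s) = character d u s + character d u (Suc (Suc s))"
    using character_mult[OF assms, of 1 "Suc s"] by simp
  then have "character d u (Suc (Suc s)) = fund_char * character d u (Suc s) - character d u s"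
    using character_1[OF assms] by (simp add: algebra_simps)
  then show ?case by (simp add: 3 alg_poly_diff alg_poly_smult alg_poly_mult)
qed

lemma counit_character:
  assumes "irreps d u"
  shows "counit (character d u s) = of_nat (d s)"
  by (simp add: character_def clinear_sum[OF clinear_counit] counit_corep[OF irrepsD(3)[OF assms]])

lemma dim_pos:
  assumes "irreps d u"
  shows "d s > 0"
  using irrepsD(1)[OF assms, of s] by (auto simp: irreducible_corep_def)

section \<open>The Chebyshev basis of the polynomials\<close>

lemma degree_cheb: "degree (cheb s) = s \<and> coeff (cheb s) s = 1"
proof (induction s rule: cheb.induct)
  case (3 s)
  have "cheb (Suc s) \<noteq> 0" using 3 by auto
  then have "degree ([:0, 1:] * cheb (Suc s)) = Suc (Suc s)" "degree (- cheb s) < Suc (Suc s)"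
    using 3 by (auto simp: degree_mult_eq)
  then have "degree (cheb (Suc (Suc s))) = Suc (Suc s)"
    by (simp only: cheb.simps diff_conv_add_uminus degree_add_eq_left)
  moreover have "coeff (cheb (Suc (Suc s))) (Suc (Suc s)) = 1"
    using 3 by (simp add: coeff_eq_0)
  ultimately show ?case by blast
qed simp_all

lemma cheb_spans: "\<exists>m c. f = (\<Sum>s<m. smult (c s) (cheb s))"
proof -
  have "\<exists>c. f = (\<Sum>s<m. smult (c s) (cheb s))" if "\<forall>i\<ge>m. coeff f i = 0" for m
    using that
  proof (induction m arbitrary: f)
    case 0
    then show ?case by (simp add: poly_eq_iff)
  next
    case (Suc m)
    \<comment> \<open>\<open>cheb m\<close> is monic of degree m, so this multiple cancels the top
      coefficient and creates no higher one.\<close>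
    have "\<forall>i\<ge>m. coeff (f - smult (coeff f m) (cheb m)) i = 0"
    proof (intro allI impI)
      fix i assume "m \<le> i"
      then consider "i = m" | "i > m" by linarith
      then show "coeff (f - smult (coeff f m) (cheb m)) i = 0"
        using Suc.prems degree_cheb[of m] by cases (auto simp: coeff_eq_0)
    qed
    from Suc.IH[OF this] obtain c where "f - smult (coeff f m) (cheb m) = (\<Sum>s<m. smult (c s) (cheb s))" by blast
    then have "f = (\<Sum>s<m. smult (c s) (cheb s)) + smult (coeff f m) (cheb m)"
      by (simp add: algebra_simps)
    also have "\<dots> = (\<Sum>s<Suc m. smult ((c(m := coeff f m)) s) (cheb s))"
      by simp
    finally show ?case by blast
  qed
  from this[of "Suc (degree f)"] show ?thesis by (meson Suc_le_lessD coeff_eq_0)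
qed

section \<open>Evaluation at orthogonal matrices\<close>

text \<open>A rotation in the plane of two indices contributes any trace in [-2, 2], and signs on
  the remaining diagonal shift the total in steps of 2. The matrix is real, so evaluation at it
  respects the involution.\<close>

lemma exists_orthogonal_trace:
  assumes "CARD('n::finite) \<ge> 2" "- real CARD('n::finite) \<le> x" "x \<le> real CARD('n::finite)"
  obtains g :: "'n::finite \<Rightarrow> 'n \<Rightarrow> complex" where "orth_family g" "\<And>j k. cnj (g j k) = g j k"
    "(\<Sum>j\<in>UNIV. g j j) = of_real x"
proof -
  obtain a b :: 'n where ab: "a \<noteq> b"
    using assms(1) by (metis UNIV_eq_I card_2_iff' ex_card subset_UNIV)
  let ?R = "UNIV - {a, b}"
  have cardR: "card ?R = CARD('n) - 2" using ab by (simp add: card_Diff_subset)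
  \<comment> \<open>\<open>m\<close> counts the entries -1. The trace is 2c + (N - 2) - 2m, so c
    \<le> 1 means m \<le> (N - x) / 2; the largest such integer, capped at the N - 2 available
    places, also gives c \<ge> -1.\<close>
  define m where "m = min (CARD('n) - 2) (nat \<lfloor>(real CARD('n) - x) / 2\<rfloor>)"
  define c where "c = (x - (real CARD('n) - 2) + 2 * real m) / 2"
  have m: "m \<le> card ?R" by (simp add: cardR m_def)
  have "real m \<le> (real CARD('n) - x) / 2"
  proof -
    have "real m \<le> real (nat \<lfloor>(real CARD('n) - x) / 2\<rfloor>)" by (simp add: m_def)
    also have "\<dots> \<le> (real CARD('n) - x) / 2"
      using assms of_int_floor_le[of "(real CARD('n) - x) / 2"] by (subst of_nat_nat) auto
    finally show ?thesis .
  qed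
  then have c1: "c \<le> 1" by (simp add: c_def)
  have c2: "c \<ge> -1"
  proof (cases "CARD('n) - 2 \<le> nat \<lfloor>(real CARD('n) - x) / 2\<rfloor>")
    case True
    then have "real m = real CARD('n) - 2" using assms by (simp add: m_def of_nat_diff)
    then show ?thesis using assms by (simp add: c_def)
  next
    case False
    then have "real m = real (nat \<lfloor>(real CARD('n) - x) / 2\<rfloor>)" by (simp add: m_def)
    also have "\<dots> \<ge> (real CARD('n) - x) / 2 - 1" by linarith
    finally show ?thesis by (simp add: c_def field_simps)
  qed
  obtain D where D: "D \<subseteq> ?R" "card D = m"
    using obtain_subset_with_card_n[OF m] by blast
  define s where "s = sqrt (1 - c\<^sup>2)"
  have "c\<^sup>2 \<le> 1" using c1 c2 by (simp add: abs_square_le_1 abs_le_iff)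
  then have cs: "c * c + s * s = 1" by (simp add: s_def flip: power2_eq_square)
  define e where "e j = (if j \<in> D then -1 else 1 :: real)" for j
  define r where "r j k = (if j = a then (if k = a then c else if k = b then - s else 0)
    else if j = b then (if k = a then s else if k = b then c else 0)
    else if j = k then e j else 0)" for j k
  have UN: "UNIV = insert a (insert b ?R)" by blast
  have split: "(\<Sum>l\<in>UNIV. f l) = f a + f b + (\<Sum>l\<in>?R. f l)" for f :: "'n \<Rightarrow> real"
    using ab by (subst UN, subst sum.insert) (auto simp: add.assoc)
  have ee: "e j * e j = 1" for j by (simp add: e_def)
  have R1: "(\<Sum>l\<in>?R. r l j * r l k) = (if j = k \<and> j \<in> ?R then 1 else 0)" for j k
  proof -
    have "(\<Sum>l\<in>?R. r l j * r l k) = (\<Sum>l\<in>?R. if l = j then (if j = k then 1 else 0) else 0)"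
      by (intro sum.cong) (auto simp: r_def ee)
    also have "\<dots> = (if j = k \<and> j \<in> ?R then 1 else 0)" by (subst sum.delta) auto
    finally show ?thesis .
  qed
  have R2: "(\<Sum>l\<in>?R. r j l * r k l) = (if j = k \<and> j \<in> ?R then 1 else 0)" for j k
  proof -
    have "(\<Sum>l\<in>?R. r j l * r k l) = (\<Sum>l\<in>?R. if l = j then (if j = k then 1 else 0) else 0)"
      by (intro sum.cong) (auto simp: r_def ee)
    also have "\<dots> = (if j = k \<and> j \<in> ?R then 1 else 0)" by (subst sum.delta) auto
    finally show ?thesis .
  qed
  have o1: "(\<Sum>l\<in>UNIV. r l j * r l k) = (if j = k then 1 else 0)" for j k
    unfolding split R1 using ab cs by (auto simp: r_def algebra_simps)
  have o2: "(\<Sum>l\<in>UNIV. r j l * r k l) = (if j = k then 1 else 0)" for j k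
    unfolding split R2 using ab cs by (auto simp: r_def algebra_simps)
  have "(\<Sum>j\<in>UNIV. r j j) = 2 * c + (\<Sum>j\<in>?R. e j)"
    unfolding split using ab by (auto simp: r_def intro!: sum.cong)
  also have "(\<Sum>j\<in>?R. e j) = (\<Sum>j\<in>?R. 1 - 2 * (if j \<in> D then 1 else 0))"
    by (intro sum.cong) (auto simp: e_def)
  also have "\<dots> = real (card ?R) - 2 * real (card D)"
    using D(1) by (simp add: sum_subtractf flip: sum_distrib_left) (simp add: sum.If_cases Int_absorb1)
  also have "\<dots> = real CARD('n) - 2 - 2 * real m"
    using assms(1) by (simp add: cardR D of_nat_diff)
  finally have tr: "(\<Sum>j\<in>UNIV. r j j) = x" by (simp add: c_def field_simps)
  show ?thesis
  proof (rule that[of "\<lambda>j k. of_real (r j k)"])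
    show "orth_family (\<lambda>j k. complex_of_real (r j k))"
      unfolding orth_family_def
      by (simp add: o1 o2 flip: of_real_mult of_real_sum)
    show "(\<Sum>j\<in>UNIV. complex_of_real (r j j)) = of_real x"
      by (simp add: tr flip: of_real_sum)
  qed simp
qed

text \<open>These are the points of the classical group O(N).\<close>

definition star_character :: "('n::finite pol_orth \<Rightarrow> complex) \<Rightarrow> bool" where
  "star_character \<psi> \<longleftrightarrow> clinear \<psi> \<and> \<psi> 1 = 1 \<and> (\<forall>x y. \<psi> (x * y) = \<psi> x * \<psi> y)
    \<and> (\<forall>x. \<psi> (star x) = cnj (\<psi> x))"

lemma star_character_pol_hom:
  fixes g :: "'n::finite \<Rightarrow> 'n \<Rightarrow> complex"
  assumes o: "orth_family g" and c: "\<And>j k. cnj (g j k) = g j k"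
  shows "star_character (pol_hom g)"
proof -
  have "pol_hom g (star x) = cnj (pol_hom g x)" for x
    by (induction x rule: pol_orth_induct)
      (simp_all add: pol_hom_facts[OF o] star_facts c scaleC_complex_def mult.commute)
  then show ?thesis
    by (simp add: star_character_def clinear_iff pol_hom_facts[OF o])
qed

lemma star_character_counit: "star_character counit"
proof -
  have "orth_family (\<lambda>j k :: 'a. if j = k then 1 else 0 :: complex)" by (rule orth_family_counit)
  from star_character_pol_hom[OF this] show ?thesis unfolding counit_def by (simp split: if_splits)
qed

lemma exists_star_character:
  assumes "CARD('n::finite) \<ge> 2" "- real CARD('n::finite) \<le> x" "x \<le> real CARD('n::finite)"
  obtains \<psi> :: "'n::finite pol_orth \<Rightarrow> complex" where "star_character \<psi>"
    "\<And>p. \<psi> (alg_poly fund_char p) = poly p (of_real x)"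
proof -
  obtain g :: "'n \<Rightarrow> 'n \<Rightarrow> complex" where g: "orth_family g" "\<And>j k. cnj (g j k) = g j k"
    "(\<Sum>j\<in>UNIV. g j j) = of_real x"
    using exists_orthogonal_trace[OF assms] by blast
  have s: "star_character (pol_hom g)" by (rule star_character_pol_hom[OF g(1,2)])
  then have lin: "clinear (pol_hom g)" by (simp add: star_character_def)
  have "pol_hom g fund_char = of_real x"
    by (simp add: fund_char_def clinear_sum[OF lin] pol_hom_facts[OF g(1)] g(3))
  then show ?thesis
    using s hom_alg_poly[of "pol_hom g"] by (intro that[of "pol_hom g"]) (auto simp: star_character_def)
qed

text \<open>Characters evaluate both polynomials at every x in [0, 1], which is infinite.\<close>

lemma alg_poly_fund_char_inj:
  assumes "CARD('n::finite) \<ge> 2" "alg_poly (fund_char :: 'n::finite pol_orth) p = alg_poly fund_char q"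
  shows "p = q"
proof (rule ccontr)
  assume "p \<noteq> q"
  then have "finite {z. poly (p - q) z = 0}" by (intro poly_roots_finite) simp
  moreover have "complex_of_real ` {0..1} \<subseteq> {z. poly (p - q) z = 0}"
  proof safe
    fix x :: real assume x: "x \<in> {0..1}"
    obtain \<psi> :: "'n pol_orth \<Rightarrow> complex" where "\<And>p. \<psi> (alg_poly fund_char p) = poly p (of_real x)"
      using exists_star_character[OF assms(1), of x] x assms(1) by auto
    then show "poly (p - q) (of_real x) = 0" using assms(2) by (metis poly_diff right_minus_eq)
  qed
  ultimately have "finite (complex_of_real ` {0..1})" by (rule finite_subset[rotated])
  then have "finite {0..1::real}" by (rule finite_imageD) (auto simp: inj_on_def)
  then show False by (simp add: infinite_Icc)
qed

text \<open>Resolves the definite description: existence because the Chebyshev polynomials span,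
  uniqueness because a polynomial is determined by its value at \<chi>.\<close>

lemma central_to_poly_alg_poly:
  fixes u :: "nat \<Rightarrow> nat \<Rightarrow> nat \<Rightarrow> 'n::finite pol_orth"
  assumes card: "CARD('n) \<ge> 2" and ir: "irreps d u"
  shows "central_to_poly d u (alg_poly fund_char f) = f"
proof -
  have *: "(\<Sum>s<m. c s *\<^sub>C character d u s) = alg_poly fund_char (\<Sum>s<m. smult (c s) (cheb s))" for m c
    by (simp add: alg_poly_sum alg_poly_smult character_cheb[OF ir])
  obtain m c where f: "f = (\<Sum>s<m. smult (c s) (cheb s))" using cheb_spans by blast
  show ?thesis
    unfolding central_to_poly_def *
  proof (rule the_equality)
    show "\<exists>m c. alg_poly fund_char f = alg_poly (fund_char :: 'n pol_orth) (\<Sum>s<m. smult (c s) (cheb s))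
        \<and> f = (\<Sum>s<m. smult (c s) (cheb s))"
      using f by blast
  qed (use alg_poly_fund_char_inj[OF card] in metis)
qed

section \<open>Averaging over the adjoint coaction\<close>

lemma ad_h_character:
  fixes u :: "nat \<Rightarrow> nat \<Rightarrow> nat \<Rightarrow> 'n::finite pol_orth" and h :: "'n pol_orth \<Rightarrow> complex"
  assumes "irreps d u" "haar_state h" "i < d s" "j < d s"
  shows "ad_h h (u s i j) = (if i = j then 1 / of_nat (d s) else 0) *\<^sub>C character d u s"
  using ad_h_corep[OF assms(2) irrepsD(1)[OF assms(1), of s], of i j] assms(3,4)
  by (simp add: character_def)

lemma ad_h_central:
  fixes u :: "nat \<Rightarrow> nat \<Rightarrow> nat \<Rightarrow> 'n::finite pol_orth" and h :: "'n pol_orth \<Rightarrow> complex"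
  assumes ir: "irreps d u" and h: "haar_state h"
  shows "\<exists>f. ad_h h a = alg_poly fund_char f"
  using ir
proof (induction a rule: irreps_induct)
  case (coeff s i j)
  then show ?case
    by (metis ad_h_character[OF ir h] character_cheb[OF ir] alg_poly_smult)
next
  case (add x y)
  then show ?case
    by (metis clinear_add[OF clinear_ad_h[OF haar_state_clinear[OF h]]] alg_poly_add)
next
  case (scaleC c x)
  then show ?case
    by (metis clinear_scaleC[OF clinear_ad_h[OF haar_state_clinear[OF h]]] alg_poly_smult)
qed

lemma ad_h_star:
  fixes u :: "nat \<Rightarrow> nat \<Rightarrow> nat \<Rightarrow> 'n::finite pol_orth" and h :: "'n pol_orth \<Rightarrow> complex"
  assumes ir: "irreps d u" and h: "haar_state h"
  shows "ad_h h (star a) = star (ad_h h a)"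
  using ir
proof (induction a rule: irreps_induct)
  case (coeff s i j)
  \<comment> \<open>Real coefficients make the character self-adjoint, so a coefficient and its
    adjoint average to multiples of the same element.\<close>
  have "map_poly cnj (cheb s) = cheb s"
    by (induction s rule: cheb.induct)
      (simp_all add: map_poly_pCons poly_eq_iff coeff_map_poly coeff_pCons split: nat.splits)
  then have ch: "star (character d u s) = character d u s"
    by (simp add: character_cheb[OF ir] star_alg_poly[OF star_fund_char])
  have "ad_h h (star (u s i j)) = (if i = j then 1 / of_nat (d s) else 0) *\<^sub>C star (character d u s)"
    using ad_h_corep[OF h irreducible_conj_corep[OF irrepsD(1)[OF ir, of s]], of i j] coeff
    by (simp add: character_def conj_corep_def star_sum)
  moreover have "ad_h h (u s i j) = (if i = j then 1 / of_nat (d s) else 0) *\<^sub>C character d u s"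
    by (rule ad_h_character[OF ir h coeff])
  ultimately show ?case by (simp add: star_facts ch)
qed (simp_all add: star_facts clinear_add[OF clinear_ad_h[OF haar_state_clinear[OF h]]]
    clinear_scaleC[OF clinear_ad_h[OF haar_state_clinear[OF h]]])

lemma ad_h_1:
  fixes u :: "nat \<Rightarrow> nat \<Rightarrow> nat \<Rightarrow> 'n::finite pol_orth" and h :: "'n pol_orth \<Rightarrow> complex"
  assumes ir: "irreps d u" and h: "haar_state h"
  shows "ad_h h 1 = 1"
  using ad_h_character[OF ir h, of 0 0 0] character_cheb[OF ir, of 0] ir by (simp add: irreps_def)

text \<open>Since \<epsilon>(\<chi>) = N, this says that the polynomial of \<open>ad_h h a\<close>
  takes the value \<epsilon>(a) at N.\<close>

lemma counit_ad_h:
  fixes u :: "nat \<Rightarrow> nat \<Rightarrow> nat \<Rightarrow> 'n::finite pol_orth" and h :: "'n pol_orth \<Rightarrow> complex"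
  assumes ir: "irreps d u" and h: "haar_state h"
  shows "counit (ad_h h a) = counit a"
  using ir
proof (induction a rule: irreps_induct)
  case (coeff s i j)
  then show ?case
    using dim_pos[OF ir, of s]
    by (simp add: ad_h_character[OF ir h] counit_facts counit_character[OF ir]
        counit_corep[OF irrepsD(3)[OF ir]] scaleC_complex_def)
qed (simp_all add: counit_facts clinear_add[OF clinear_ad_h[OF haar_state_clinear[OF h]]]
    clinear_scaleC[OF clinear_ad_h[OF haar_state_clinear[OF h]]])

text \<open>The antipode reverses products, so in the coaction on a product the part of the second
  factor is enclosed by the first factor and its antipode; \<psi> splits because it is
  multiplicative.\<close>

lemma slice_right_ad_prod:
  assumes u: "unitary_corep I u" and w: "unitary_corep J w" and psi: "star_character \<psi>"
    and idx: "i \<in> I" "j \<in> I" "k \<in> J" "l \<in> J"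
  shows "slice_right \<psi> (ad (u i j * w k l))
    = (\<Sum>p\<in>I. \<Sum>q\<in>I. \<psi> (u p q) *\<^sub>C (u i p * slice_right \<psi> (ad (w k l)) * antipode (u q j)))"
proof -
  have lin: "clinear \<psi>" and mult: "\<And>x y. \<psi> (x * y) = \<psi> x * \<psi> y"
    using psi by (simp_all add: star_character_def)
  have fin: "finite I" "finite J" using u w by (simp_all add: unitary_corep_def)
  let ?U = "corep_tensor u w"
  have comult: "comult (?U x y) = (\<Sum>z\<in>I \<times> J. ?U x z \<otimes>\<^sub>t ?U z y)" if "x \<in> I \<times> J" "y \<in> I \<times> J" for x y
  proof -
    obtain a b a' b' where xy: "x = (a, b)" "y = (a', b')" by (cases x, cases y)
    then have "comult (?U x y) = (\<Sum>z\<in>I. u a z \<otimes>\<^sub>t u z a') * (\<Sum>z\<in>J. w b z \<otimes>\<^sub>t w z b')"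
      using that u w by (simp add: corep_tensor_def comult_facts unitary_corep_def)
    also have "\<dots> = (\<Sum>z\<in>I \<times> J. ?U x z \<otimes>\<^sub>t ?U z y)"
      by (simp add: xy sum_product tens_mult sum.cartesian_product corep_tensor_def case_prod_unfold)
    finally show ?thesis .
  qed
  then have U: "corep (I \<times> J) ?U" using fin by (simp add: corep_def)
  note rlin = clinear_sum[OF clinear_slice_right[OF lin]]
  have rw: "slice_right \<psi> (ad (w k l)) = (\<Sum>p\<in>J. \<Sum>q\<in>J. \<psi> (w p q) *\<^sub>C (w k p * antipode (w q l)))"
    by (simp add: ad_corep[OF unitary_corep_corep[OF w]] idx rlin slice_right_tens lin)
  have "slice_right \<psi> (ad (u i j * w k l)) = slice_right \<psi> (ad (?U (i, k) (j, l)))"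
    by (simp add: corep_tensor_def)
  also have "\<dots> = (\<Sum>x\<in>I \<times> J. \<Sum>y\<in>I \<times> J. \<psi> (?U x y) *\<^sub>C (?U (i, k) x * antipode (?U y (j, l))))"
    using idx by (simp only: ad_corep[OF U] SigmaI rlin slice_right_tens[OF lin])
  also have "\<dots> = (\<Sum>p\<in>I. \<Sum>p'\<in>J. \<Sum>q\<in>I. \<Sum>q'\<in>J. \<psi> (?U (p, p') (q, q')) *\<^sub>C (?U (i, k) (p, p') * antipode (?U (q, q') (j, l))))"
    by (simp only: sum.cartesian_product')
  also have "\<dots> = (\<Sum>p\<in>I. \<Sum>q\<in>I. \<Sum>p'\<in>J. \<Sum>q'\<in>J. \<psi> (?U (p, p') (q, q')) *\<^sub>C (?U (i, k) (p, p') * antipode (?U (q, q') (j, l))))"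
    by (rule sum.cong[OF refl], rule sum.swap)
  also have "\<dots> = (\<Sum>p\<in>I. \<Sum>q\<in>I. \<psi> (u p q) *\<^sub>C (u i p * slice_right \<psi> (ad (w k l)) * antipode (u q j)))"
    unfolding rw by (intro sum.cong refl)
      (simp add: corep_tensor_def mult antipode_facts sum_distrib_left sum_distrib_right
        complex_vector.scale_sum_right mult_scaleC_left mult_scaleC_right scaleC_scaleC mult.assoc)
  finally show ?thesis .
qed

text \<open>With \<open>Z a = (id \<otimes> \<psi>) (ad a)\<close>, traciality of \<open>h\<close> moves the antipode factor of \<open>ad (a\<^sup>*b)\<close> to the
  front, where it completes \<open>(Z a)\<^sup>*\<close>.\<close>

lemma haar_slice_ad:
  fixes u :: "nat \<Rightarrow> nat \<Rightarrow> nat \<Rightarrow> 'n::finite pol_orth" and h :: "'n pol_orth \<Rightarrow> complex"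
  assumes ir: "irreps d u" and h: "haar_state h" and psi: "star_character \<psi>"
  shows "h (slice_right \<psi> (ad (star a * b))) = h (star (slice_right \<psi> (ad a)) * slice_right \<psi> (ad b))"
proof -
  have lin: "clinear \<psi>" and cnj: "\<And>x. \<psi> (star x) = cnj (\<psi> x)"
    using psi by (simp_all add: star_character_def)
  have hlin: "clinear h" using h by (rule haar_state_clinear)
  note simps = clinear_add[OF clinear_slice_right[OF lin]] clinear_scaleC[OF clinear_slice_right[OF lin]]
    clinear_sum[OF clinear_slice_right[OF lin]] clinear_add[OF clinear_ad] clinear_scaleC[OF clinear_ad]
    clinear_add[OF hlin] clinear_scaleC[OF hlin] star_facts distrib_left distrib_right
    mult_scaleC_left mult_scaleC_right
  from ir show ?thesis
  proof (induction a rule: irreps_induct)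
    case (coeff s i j)
    note ij = coeff
    have uu: "unitary_corep {..<d s} (u s)" by (rule irrepsD(3)[OF ir])
    from ir show ?case
    proof (induction b rule: irreps_induct)
      case (coeff t k l)
      let ?Z = "slice_right \<psi> (ad (u t k l))"
      let ?u = "u s" and ?I = "{..<d s}"
      let ?S = "\<Sum>p\<in>?I. \<Sum>q\<in>?I. \<psi> (star (?u p q)) *\<^sub>C (star (?u i p) * ?Z * antipode (star (?u q j)))"
      let ?R = "\<Sum>p\<in>?I. \<Sum>q\<in>?I. cnj (\<psi> (?u p q)) *\<^sub>C (star (antipode (?u q j)) * star (?u i p))"
      have S: "slice_right \<psi> (ad (star (?u i j) * u t k l)) = ?S"
        using slice_right_ad_prod[OF unitary_conj_corep[OF uu] irrepsD(3)[OF ir, of t] psi, of i j k l] ij coeff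
        by (simp add: conj_corep_def)
      have R: "?R = star (slice_right \<psi> (ad (?u i j)))"
        using ij by (simp add: ad_corep[OF unitary_corep_corep[OF uu]] clinear_sum[OF clinear_slice_right[OF lin]]
            slice_right_tens[OF lin] star_sum star_facts)
      have "h ?S = (\<Sum>p\<in>?I. \<Sum>q\<in>?I. cnj (\<psi> (?u p q)) * h (star (?u i p) * ?Z * star (antipode (?u q j))))"
        by (simp add: clinear_sum[OF hlin] clinear_scaleC[OF hlin] scaleC_complex_def cnj antipode_star)
      also have "\<dots> = (\<Sum>p\<in>?I. \<Sum>q\<in>?I. cnj (\<psi> (?u p q)) * h (star (antipode (?u q j)) * (star (?u i p) * ?Z)))"
        by (simp only: haar_state_trace[OF ir h, of "star (u s i _) * ?Z"])
      also have "\<dots> = h (?R * ?Z)"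
        by (simp add: clinear_sum[OF hlin] clinear_scaleC[OF hlin] scaleC_complex_def sum_distrib_right
            mult_scaleC_left mult.assoc)
      finally show ?case unfolding S R .
    qed (simp_all add: simps)
  qed (simp_all add: simps)
qed

lemma ad_h_positive:
  fixes u :: "nat \<Rightarrow> nat \<Rightarrow> nat \<Rightarrow> 'n::finite pol_orth" and h :: "'n pol_orth \<Rightarrow> complex"
  assumes ir: "irreps d u" and h: "haar_state h" and psi: "star_character \<psi>"
  shows "\<psi> (ad_h h (star a * a)) \<in> \<real>\<^sub>\<ge>\<^sub>0"
proof -
  have lin: "clinear \<psi>" using psi by (simp add: star_character_def)
  have "\<psi> (ad_h h (star a * a)) = h (slice_right \<psi> (ad (star a * a)))"
    unfolding ad_h_def by (rule slice_swap[OF haar_state_clinear[OF h] lin])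
  then show ?thesis
    using haar_slice_ad[OF ir h psi] h by (simp add: haar_state_def)
qed

lemma ad_h_poly_nonneg:
  fixes u :: "nat \<Rightarrow> nat \<Rightarrow> nat \<Rightarrow> 'n::finite pol_orth" and h :: "'n pol_orth \<Rightarrow> complex"
  assumes "irreps d u" "haar_state h" "CARD('n) \<ge> 2" "- real CARD('n) \<le> x" "x \<le> real CARD('n)"
    and "ad_h h (star a * a) = alg_poly fund_char f"
  shows "poly f (of_real x) \<in> \<real>\<^sub>\<ge>\<^sub>0"
proof -
  obtain \<psi> :: "'n pol_orth \<Rightarrow> complex" where psi: "star_character \<psi>"
    "\<And>p. \<psi> (alg_poly fund_char p) = poly p (of_real x)"
    using exists_star_character[OF assms(3-5)] by blast
  then show ?thesis using ad_h_positive[OF assms(1,2) psi(1), of a] assms(6) by simp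
qed

section \<open>The Hausdorff moment problem\<close>

text \<open>Factorial moments of the binomial distribution, by C(n,k) C(k,m) = C(n,m) C(n-m,k-m) and
  the binomial theorem. The general ring permits x = X and y = 1 - X in a polynomial ring.\<close>

lemma binomial_moment:
  fixes x y :: "'a::comm_ring_1"
  assumes "x + y = 1" "m \<le> n"
  shows "(\<Sum>k\<le>n. of_nat ((n choose k) * (k choose m)) * (x ^ k * y ^ (n - k))) = of_nat (n choose m) * x ^ m"
proof -
  have "(\<Sum>k\<le>n. of_nat ((n choose k) * (k choose m)) * (x ^ k * y ^ (n - k)))
      = (\<Sum>k\<in>{m..n}. of_nat ((n choose k) * (k choose m)) * (x ^ k * y ^ (n - k)))"
    by (intro sum.mono_neutral_right) (auto simp: binomial_eq_0)
  also have "\<dots> = (\<Sum>k\<in>{m..n}. of_nat ((n choose m) * ((n - m) choose (k - m))) * (x ^ k * y ^ (n - k)))"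
    by (intro sum.cong refl) (simp add: choose_mult)
  also have "\<dots> = (\<Sum>j\<le>n - m. of_nat ((n choose m) * ((n - m) choose j)) * (x ^ (j + m) * y ^ (n - m - j)))"
    by (rule sum.reindex_bij_witness[of _ "\<lambda>j. j + m" "\<lambda>k. k - m"]) (use assms(2) in auto)
  also have "\<dots> = of_nat (n choose m) * x ^ m * (x + y) ^ (n - m)"
    unfolding binomial_ring by (simp add: sum_distrib_left power_add algebra_simps)
  finally show ?thesis by (simp add: assms(1))
qed

text \<open>The ratio is the product of (k - i) / (n - i) over i < m. It is compared factor by
  factor with k / n; each of the m factors is off by at most m / (n - m).\<close>

lemma choose_ratio_diff:
  fixes k m n :: nat
  assumes "k \<le> n" "2 * m \<le> n" "m < n"
  shows "\<bar>real (k choose m) / real (n choose m) - (real k / real n) ^ m\<bar> \<le> real m * real m / (real n - real m)"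
proof -
  have "real (k choose m) / real (n choose m) = (\<Prod>i<m. (real k - real i) / (real n - real i))"
    by (simp add: binomial_gbinomial gbinomial_prod_rev prod_dividef atLeast0LessThan)
  moreover have "(real k / real n) ^ m = (\<Prod>i<m. real k / real n)" by simp
  \<comment> \<open>\<open>norm_prod_diff\<close> wants factors of modulus at most 1. For k < i the
    factor is negative, and 2m \<le> n keeps it above -1.\<close>
  moreover have "norm ((\<Prod>i<m. (real k - real i) / (real n - real i)) - (\<Prod>i<m. real k / real n))
      \<le> (\<Sum>i<m. norm ((real k - real i) / (real n - real i) - real k / real n))"
    using assms by (intro norm_prod_diff) (auto simp: divide_simps abs_le_iff)
  moreover have "norm ((real k - real i) / (real n - real i) - real k / real n) \<le> real m / (real n - real m)"
    if "i < m" for i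
  proof -
    have pos: "real n - real i > 0" "real n > 0" "real n - real m > 0" using that assms by auto
    have "(real k - real i) / (real n - real i) - real k / real n
        = - (real i / (real n - real i) * ((real n - real k) / real n))"
      using pos by (simp add: field_simps)
    then have "norm ((real k - real i) / (real n - real i) - real k / real n)
        = real i / (real n - real i) * ((real n - real k) / real n)"
      using pos assms by (simp add: abs_mult)
    also have "\<dots> \<le> real i / (real n - real i) * 1"
      using pos assms by (intro mult_left_mono) auto
    also have "\<dots> \<le> real m / (real n - real m)"
      using pos that by (simp, intro frac_le) auto
    finally show ?thesis .
  qed
  then have "(\<Sum>i<m. norm ((real k - real i) / (real n - real i) - real k / real n)) \<le> (\<Sum>i<m. real m / (real n - real m))"
    by (intro sum_mono) auto
  ultimately show ?thesis by simp
qed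

text \<open>Place mass \<open>w n k\<close> at k/n and take a weak limit along a subsequence. The
  hypothesis controls factorial moments exactly; they differ from the power moments by
  O(1/n).\<close>

lemma hausdorff_weights:
  fixes w :: "nat \<Rightarrow> nat \<Rightarrow> real" and c :: "nat \<Rightarrow> real"
  assumes nonneg: "\<And>n k. k \<le> n \<Longrightarrow> w n k \<ge> 0" and total: "\<And>n. (\<Sum>k\<le>n. w n k) = 1"
    and moment: "\<And>n m. m \<le> n \<Longrightarrow> (\<Sum>k\<le>n. real (k choose m) / real (n choose m) * w n k) = c m"
  shows "\<exists>P. real_distribution P \<and> (AE x in P. x \<in> {0..1}) \<and> (\<forall>m. (\<integral>x. x ^ m \<partial>P) = c m)"
proof -
  define \<nu> where "\<nu> n = point_measure {..n} (\<lambda>k. ennreal (w n k))" for n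
  \<comment> \<open>For n = 0 the only atom sits at 0/0 = 0, so all atoms lie in [0, 1].\<close>
  define \<mu> where "\<mu> n = distr (\<nu> n) borel (\<lambda>k. real k / real n)" for n
  have sp: "space (\<nu> n) = {..n}" for n by (simp add: \<nu>_def space_point_measure)
  have meas: "f \<in> measurable (\<nu> n) N" if "\<And>k. f k \<in> space N" for f n and N :: "'b measure"
    using that by (auto simp: \<nu>_def)
  have prob: "prob_space (\<nu> n)" for n
  proof (rule prob_spaceI)
    have "(\<Sum>k\<le>n. ennreal (w n k)) = ennreal (\<Sum>k\<le>n. w n k)"
      by (intro sum_ennreal) (simp add: nonneg)
    then show "emeasure (\<nu> n) (space (\<nu> n)) = 1"
      by (simp add: sp) (simp add: \<nu>_def emeasure_point_measure_finite total)
  qed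
  interpret \<nu>: prob_space "\<nu> n" for n by (rule prob)
  have rd: "real_distribution (\<mu> n)" for n
    unfolding real_distribution_def real_distribution_axioms_def \<mu>_def
    by (auto intro!: \<nu>.prob_space_distr meas)
  have int: "(\<integral>x. f x \<partial>\<mu> n) = (\<Sum>k\<le>n. w n k * f (real k / real n))"
    if "f \<in> borel_measurable borel" for f :: "real \<Rightarrow> real" and n
  proof -
    have "(\<integral>x. f x \<partial>\<mu> n) = (\<integral>k. f (real k / real n) \<partial>\<nu> n)"
      unfolding \<mu>_def using that by (intro integral_distr meas) auto
    also have "\<dots> = (\<Sum>k\<le>n. w n k *\<^sub>R f (real k / real n))"
      unfolding \<nu>_def by (rule lebesgue_integral_point_measure_finite) (simp_all add: nonneg)
    finally show ?thesis by simp
  qed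
  \<comment> \<open>Tightness is phrased with intervals open on the left, so the left end must lie
    below 0.\<close>
  have "measure (\<mu> n) {-1<..1} = 1" for n
  proof -
    have "(\<lambda>k. real k / real n) -` {-1<..1} \<inter> space (\<nu> n) = space (\<nu> n)"
      by (auto simp: sp divide_simps)
    then show ?thesis unfolding \<mu>_def by (subst measure_distr) (auto intro!: meas simp: \<nu>.prob_space)
  qed
  then have "tight \<mu>" unfolding tight_def using rd
    by (intro conjI allI impI exI[of _ "-1"] exI[of _ 1]) auto
  then obtain r P where r: "strict_mono r" and P: "real_distribution P" and conv: "weak_conv_m (\<mu> \<circ> id \<circ> r) P"
    using tight_imp_convergent_subsubsequence[of \<mu> id] strict_mono_id by blast
  interpret P: real_distribution P by (rule P)
  have wc: "(\<lambda>n. \<integral>x. f x \<partial>\<mu> (r n)) \<longlonglongrightarrow> (\<integral>x. f x \<partial>P)"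
    if "continuous_on UNIV f" "\<And>x. \<bar>f x\<bar> \<le> 1" for f :: "real \<Rightarrow> real"
  proof -
    have "(\<lambda>n. integral\<^sup>L ((\<mu> \<circ> id \<circ> r) n) f) \<longlonglongrightarrow> integral\<^sup>L P f"
      using that rd P conv
      by (intro weak_conv_imp_integral_bdd_continuous_conv[where B = 1])
        (auto simp: continuous_on_eq_continuous_at comp_def)
    then show ?thesis by (simp add: comp_def)
  qed
  \<comment> \<open>Weak convergence tests bounded continuous functions only; clamping makes powers
    bounded and changes nothing on [0, 1].\<close>
  define cl where "cl x = max 0 (min 1 x)" for x :: real
  have cl: "0 \<le> cl x" "cl x \<le> 1" for x by (simp_all add: cl_def)
  have cl_cont: "continuous_on UNIV cl" unfolding cl_def by (intro continuous_intros)
  then have cl_meas [measurable]: "cl \<in> borel_measurable borel"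
    by (rule borel_measurable_continuous_onI)
  have cl_id: "cl (real k / real n) = real k / real n" if "k \<le> n" for k n
    using that by (auto simp: cl_def divide_simps max_def min_def)
  \<comment> \<open>A bounded continuous function vanishing exactly on [0, 1]: its integral is 0 for
    every \<open>\<mu> n\<close>, hence for the limit, which is therefore concentrated
    there.\<close>
  let ?g = "\<lambda>x. min 1 \<bar>x - cl x\<bar>"
  have gc: "continuous_on UNIV ?g" by (intro continuous_intros cl_cont)
  have "(\<integral>x. ?g x \<partial>\<mu> n) = 0" for n
    by (subst int) (auto intro!: borel_measurable_continuous_onI gc sum.neutral simp: cl_id)
  then have "(\<integral>x. ?g x \<partial>P) = 0"
    using wc[OF gc] LIMSEQ_unique[OF _ tendsto_const] by fastforce
  moreover have "integrable P ?g"
    by (rule P.integrable_const_bound[of _ 1]) auto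
  ultimately have "AE x in P. ?g x = 0"
    by (subst (asm) integral_nonneg_eq_0_iff_AE) auto
  then have AE: "AE x in P. x \<in> {0..1}"
  proof eventually_elim
    case (elim x)
    then have "x = cl x" by (auto simp: min_def split: if_splits)
    then show ?case by (metis atLeastAtMost_iff cl)
  qed
  have "(\<integral>x. x ^ m \<partial>P) = c m" for m
  proof -
    have fc: "continuous_on UNIV (\<lambda>x. cl x ^ m)" by (intro continuous_intros cl_cont)
    have "(\<lambda>n. \<integral>x. cl x ^ m \<partial>\<mu> n) \<longlonglongrightarrow> c m"
    proof (rule LIM_zero_cancel, rule Lim_null_comparison)
      show "eventually (\<lambda>n. norm ((\<integral>x. cl x ^ m \<partial>\<mu> n) - c m) \<le> real m * real m / (real n - real m)) sequentially"
        using eventually_ge_at_top[of "2 * m + 1"]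
      proof eventually_elim
        case (elim n)
        have "(\<integral>x. cl x ^ m \<partial>\<mu> n) = (\<Sum>k\<le>n. w n k * (real k / real n) ^ m)"
          by (subst int) (auto intro!: borel_measurable_continuous_onI fc sum.cong simp: cl_id)
        moreover have "c m = (\<Sum>k\<le>n. w n k * (real (k choose m) / real (n choose m)))"
          using moment[of m n] elim by (simp add: mult.commute)
        ultimately have "norm ((\<integral>x. cl x ^ m \<partial>\<mu> n) - c m)
            = \<bar>\<Sum>k\<le>n. w n k * ((real k / real n) ^ m - real (k choose m) / real (n choose m))\<bar>"
          by (simp add: sum_subtractf right_diff_distrib)
        also have "\<dots> \<le> (\<Sum>k\<le>n. w n k * (real m * real m / (real n - real m)))"
        proof (rule order_trans[OF sum_abs sum_mono])
          fix k assume "k \<in> {..n}"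
          then show "\<bar>w n k * ((real k / real n) ^ m - real (k choose m) / real (n choose m))\<bar>
              \<le> w n k * (real m * real m / (real n - real m))"
            using mult_left_mono[OF choose_ratio_diff[of k n m] nonneg[of k n]] elim nonneg[of k n]
            by (simp add: abs_mult abs_minus_commute)
        qed
        also have "\<dots> = real m * real m / (real n - real m)"
          by (simp only: sum_distrib_right[symmetric] total mult_1)
        finally show ?case .
      qed
      show "(\<lambda>n. real m * real m / (real n - real m)) \<longlonglongrightarrow> 0"
        by real_asymp
    qed
    then have "(\<lambda>n. \<integral>x. cl x ^ m \<partial>\<mu> (r n)) \<longlonglongrightarrow> c m"
      using LIMSEQ_subseq_LIMSEQ[OF _ r] by (force simp: comp_def)
    moreover have "\<bar>cl x ^ m\<bar> \<le> 1" for x using cl[of x] by (simp add: power_le_one)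
    ultimately have "(\<integral>x. cl x ^ m \<partial>P) = c m"
      using wc[OF fc] LIMSEQ_unique by blast
    moreover have "(\<integral>x. cl x ^ m \<partial>P) = (\<integral>x. x ^ m \<partial>P)"
    proof (rule integral_cong_AE)
      show "AE x in P. cl x ^ m = x ^ m" using AE by eventually_elim (auto simp: cl_def)
    qed (auto intro!: borel_measurable_continuous_onI fc)
    ultimately show ?thesis by simp
  qed
  with P AE show ?thesis by blast
qed

section \<open>Functionals on polynomials as integrals\<close>

lemma poly_of_real_measurable [measurable]: "(\<lambda>x. poly p (complex_of_real x)) \<in> borel_measurable borel"
  by (intro borel_measurable_continuous_onI continuous_intros)

lemma poly_bounded_on_interval:
  "\<exists>B. \<forall>x\<in>{a..b::real}. norm (poly p (complex_of_real x)) \<le> B"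
proof -
  have "compact ((\<lambda>x. poly p (complex_of_real x)) ` {a..b})"
    by (intro compact_continuous_image continuous_intros compact_Icc)
  then show ?thesis by (auto dest!: compact_imp_bounded simp: bounded_iff)
qed

lemma integrable_poly_interval:
  assumes "finite_measure \<mu>" "sets \<mu> = sets borel" "AE x in \<mu>. x \<in> {a..b}"
  shows "integrable \<mu> (\<lambda>x. poly p (complex_of_real x))"
proof -
  interpret finite_measure \<mu> by fact
  obtain B where B: "\<forall>x\<in>{a..b}. norm (poly p (complex_of_real x)) \<le> B"
    using poly_bounded_on_interval by blast
  show ?thesis
  proof (rule integrable_const_bound)
    show "AE x in \<mu>. norm (poly p (complex_of_real x)) \<le> B"
      using assms(3) by eventually_elim (use B in auto)
    show "(\<lambda>x. poly p (complex_of_real x)) \<in> borel_measurable \<mu>"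
      using assms(2) by (simp cong: measurable_cong_sets)
  qed
qed

lemma poly_functional_eqI:
  fixes L M :: "complex poly \<Rightarrow> complex"
  assumes "\<And>p q. L (p + q) = L p + L q" "\<And>c p. L (smult c p) = c * L p"
    and "\<And>p q. M (p + q) = M p + M q" "\<And>c p. M (smult c p) = c * M p"
    and "\<And>m. L ([:0, 1:] ^ m) = M ([:0, 1:] ^ m)"
  shows "L p = M p"
proof -
  have sumL: "L (sum f A) = (\<Sum>i\<in>A. L (f i))" for f and A :: "nat set"
    using assms(2)[of 0] by (induction A rule: infinite_finite_induct) (simp_all add: assms(1))
  have sumM: "M (sum f A) = (\<Sum>i\<in>A. M (f i))" for f and A :: "nat set"
    using assms(4)[of 0] by (induction A rule: infinite_finite_induct) (simp_all add: assms(3))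
  have "p = (\<Sum>i\<le>degree p. smult (coeff p i) ([:0, 1:] ^ i))"
    using poly_as_sum_of_monoms[of p] by (simp add: monom_altdef)
  then have "L p = L (\<Sum>i\<le>degree p. smult (coeff p i) ([:0, 1:] ^ i))"
    and "M p = M (\<Sum>i\<le>degree p. smult (coeff p i) ([:0, 1:] ^ i))" by simp_all
  then show ?thesis by (simp add: sumL sumM assms(2,4,5))
qed

text \<open>The weights are the values of M on the Bernstein polynomials C(n,k) X^k (1-X)^(n-k);
  \<open>binomial_moment\<close> turns their factorial moments into M(X^m).\<close>

lemma hausdorff_moment_unit_interval:
  fixes M :: "complex poly \<Rightarrow> complex"
  assumes add: "\<And>p q. M (p + q) = M p + M q" and smult: "\<And>c p. M (smult c p) = c * M p"
    and pos: "\<And>k l. M ([:0, 1:] ^ k * [:1, -1:] ^ l) \<in> \<real>\<^sub>\<ge>\<^sub>0"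
  shows "\<exists>\<mu>. finite_measure \<mu> \<and> sets \<mu> = sets borel \<and> (AE x in \<mu>. x \<in> {0..1})
    \<and> (\<forall>p. M p = (\<integral>x. poly p (complex_of_real x) \<partial>\<mu>))"
proof -
  let ?X = "[:0, 1:] :: complex poly" and ?Y = "[:1, -1:] :: complex poly"
  define T where "T = Re (M 1)"
  define w where "w n k = real (n choose k) * Re (M (?X ^ k * ?Y ^ (n - k)))" for n k
  have T0: "T \<ge> 0" using pos[of 0 0] by (simp add: T_def complex_nonneg_Reals_iff)
  have w0: "w n k \<ge> 0" for n k
    using pos[of k "n - k"] by (simp add: w_def complex_nonneg_Reals_iff)
  have M0: "M 0 = 0" using smult[of 0 0] by simp
  have Msum: "M (sum f A) = (\<Sum>i\<in>A. M (f i))" for f and A :: "nat set"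
    by (induction A rule: infinite_finite_induct) (simp_all add: add M0)
  have Mw: "of_nat (n choose k) * M (?X ^ k * ?Y ^ (n - k)) = of_real (w n k)" for n k
    using pos[of k "n - k"] by (simp add: w_def complex_nonneg_Reals_iff complex_eq_iff)
  have mom: "(\<Sum>k\<le>n. real (k choose m) * w n k) = real (n choose m) * Re (M (?X ^ m))"
    and Xreal: "M (?X ^ m) \<in> \<real>" if "m \<le> n" for n m
  proof -
    have "smult (of_nat (n choose m)) (?X ^ m)
        = (\<Sum>k\<le>n. smult (of_nat (k choose m) * of_nat (n choose k)) (?X ^ k * ?Y ^ (n - k)))"
      using binomial_moment[of ?X ?Y m n] that
      by (simp add: one_pCons of_nat_poly mult.commute flip: of_nat_mult)
    then have "M (smult (of_nat (n choose m)) (?X ^ m))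
        = M (\<Sum>k\<le>n. smult (of_nat (k choose m) * of_nat (n choose k)) (?X ^ k * ?Y ^ (n - k)))" by simp
    then have eq: "of_nat (n choose m) * M (?X ^ m) = of_real (\<Sum>k\<le>n. real (k choose m) * w n k)"
      by (simp add: Msum smult mult.assoc Mw)
    from arg_cong[OF eq, of Re] show "(\<Sum>k\<le>n. real (k choose m) * w n k) = real (n choose m) * Re (M (?X ^ m))"
      by simp
    show "M (?X ^ m) \<in> \<real>" using pos[of m 0] by (simp add: complex_nonneg_Reals_iff complex_is_Real_iff)
  qed
  have wT: "(\<Sum>k\<le>n. w n k) = T" for n using mom[of 0 n] by (simp add: T_def)
  have "\<exists>P. real_distribution P \<and> (AE x in P. x \<in> {0..1}) \<and> (\<forall>m. T * (\<integral>x. x ^ m \<partial>P) = Re (M (?X ^ m)))"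
  proof (cases "T = 0")
    case True
    \<comment> \<open>Normalising by T is impossible here, but nonnegative weights with sum 0
      vanish, so all moments are 0 and any P, such as a point mass, will do.\<close>
    have "w n k = 0" if "k \<le> n" for n k
      using wT[of n] True sum_nonneg_eq_0_iff[of "{..n}" "w n"] w0 that by auto
    then have "Re (M (?X ^ m)) = 0" for m using mom[of m m] by simp
    moreover have "real_distribution (return borel 0)"
      by (simp add: real_distribution_def real_distribution_axioms_def prob_space_return)
    moreover have "AE x in return borel 0. x \<in> {0..1::real}" by (subst AE_return) auto
    ultimately show ?thesis using True by auto
  next
    case False
    have "\<exists>P. real_distribution P \<and> (AE x in P. x \<in> {0..1}) \<and> (\<forall>m. (\<integral>x. x ^ m \<partial>P) = Re (M (?X ^ m)) / T)"
    proof (rule hausdorff_weights[where w = "\<lambda>n k. w n k / T"])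
      show "(\<Sum>k\<le>n. real (k choose m) / real (n choose m) * (w n k / T)) = Re (M (?X ^ m)) / T" if "m \<le> n" for n m
      proof -
        have "(\<Sum>k\<le>n. real (k choose m) / real (n choose m) * (w n k / T))
            = (\<Sum>k\<le>n. real (k choose m) * w n k) / (real (n choose m) * T)"
          by (simp add: sum_divide_distrib)
        then show ?thesis using mom[OF that] that by simp
      qed
    qed (use w0 T0 wT False in \<open>auto simp flip: sum_divide_distrib\<close>)
    then show ?thesis using False by auto
  qed
  then obtain P where P: "real_distribution P" "AE x in P. x \<in> {0..1}"
    "\<And>m. T * (\<integral>x. x ^ m \<partial>P) = Re (M (?X ^ m))" by blast
  interpret P: real_distribution P by (rule P)
  define \<mu> where "\<mu> = density P (\<lambda>_. ennreal T)"
  have fin: "finite_measure \<mu>"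
    by (rule finite_measureI) (simp add: \<mu>_def emeasure_density ennreal_mult_eq_top_iff)
  have sets: "sets \<mu> = sets borel" by (simp add: \<mu>_def)
  have AE: "AE x in \<mu>. x \<in> {0..1}"
    unfolding \<mu>_def using P(2) by (subst AE_density) auto
  note int = integrable_poly_interval[OF fin sets AE]
  have "M p = (\<integral>x. poly p (complex_of_real x) \<partial>\<mu>)" for p
  proof (rule poly_functional_eqI[of M])
    fix m
    have "(\<integral>x. poly (?X ^ m) (complex_of_real x) \<partial>\<mu>) = of_real (T * (\<integral>x. x ^ m \<partial>P))"
      unfolding \<mu>_def by (subst integral_density) (auto simp: T0 scaleR_conv_of_real simp flip: of_real_power)
    also have "\<dots> = M (?X ^ m)" using P(3) Xreal[of m m] by simp
    finally show "M (?X ^ m) = (\<integral>x. poly (?X ^ m) (complex_of_real x) \<partial>\<mu>)" by simp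
  qed (simp_all add: add smult int)
  with fin sets AE show ?thesis by blast
qed

lemma pcompose_power: "pcompose (p ^ n) q = pcompose p q ^ n"
  by (induction n) (simp_all add: pcompose_mult pcompose_1)

text \<open>Affine transport: compose with \<open>?A\<close>, which maps [a, b] onto [0, 1], and
  push the resulting measure forward along the inverse \<open>?B\<close>.\<close>

lemma hausdorff_moment_interval:
  fixes M :: "complex poly \<Rightarrow> complex"
  assumes add: "\<And>p q. M (p + q) = M p + M q" and smult: "\<And>c p. M (smult c p) = c * M p"
    and "a < b"
    and pos: "\<And>k l. M ([:- of_real a, 1:] ^ k * [:of_real b, -1:] ^ l) \<in> \<real>\<^sub>\<ge>\<^sub>0"
  shows "\<exists>\<mu>. finite_measure \<mu> \<and> sets \<mu> = sets borel \<and> (AE x in \<mu>. x \<in> {a..b})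
    \<and> (\<forall>p. M p = (\<integral>x. poly p (complex_of_real x) \<partial>\<mu>))"
proof -
  let ?d = "complex_of_real (1 / (b - a))"
  let ?A = "smult ?d [:- of_real a, 1:]" and ?B = "[:of_real a, of_real (b - a):] :: complex poly"
  have "\<exists>\<mu>. finite_measure \<mu> \<and> sets \<mu> = sets borel \<and> (AE x in \<mu>. x \<in> {0..1})
    \<and> (\<forall>p. M (pcompose p ?A) = (\<integral>x. poly p (complex_of_real x) \<partial>\<mu>))"
  proof (rule hausdorff_moment_unit_interval)
    fix k l
    have "pcompose [:0, 1:] ?A = smult ?d [:- of_real a, 1:]"
      by (simp add: pcompose_pCons)
    moreover have "pcompose [:1, -1:] ?A = smult ?d [:of_real b, -1:]"
      using \<open>a < b\<close> by (simp add: pcompose_pCons field_simps)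
    ultimately have eq: "pcompose ([:0, 1:] ^ k * [:1, -1:] ^ l) ?A
        = smult (of_real ((1 / (b - a)) ^ (k + l))) ([:- of_real a, 1:] ^ k * [:of_real b, -1:] ^ l)"
      by (simp only: pcompose_mult pcompose_power smult_power mult_smult_left mult_smult_right
          smult_smult of_real_power power_add) (simp only: of_real_mult of_real_power mult.commute)
    have "complex_of_real ((1 / (b - a)) ^ (k + l)) \<in> \<real>\<^sub>\<ge>\<^sub>0"
      using \<open>a < b\<close> by (simp only: nonneg_Reals_of_real_iff) simp
    then show "M (pcompose ([:0, 1:] ^ k * [:1, -1:] ^ l) ?A) \<in> \<real>\<^sub>\<ge>\<^sub>0"
      unfolding eq smult by (intro nonneg_Reals_mult_I pos)
  qed (simp_all only: pcompose_add pcompose_smult add smult)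
  then obtain \<mu> where \<mu>: "finite_measure \<mu>" "sets \<mu> = sets borel" "AE x in \<mu>. x \<in> {0..1}"
    "\<And>p. M (pcompose p ?A) = (\<integral>x. poly p (complex_of_real x) \<partial>\<mu>)" by blast
  interpret finite_measure \<mu> by (rule \<mu>)
  let ?f = "\<lambda>t. a + (b - a) * t"
  have f: "?f \<in> measurable \<mu> borel" using \<mu>(2) by (simp cong: measurable_cong_sets)
  have BA: "pcompose ?B ?A = [:0, 1:]" using \<open>a < b\<close> by (simp add: pcompose_pCons field_simps)
  have "M p = (\<integral>x. poly p (complex_of_real x) \<partial>distr \<mu> borel ?f)" for p
  proof -
    have "(\<integral>x. poly p (complex_of_real x) \<partial>distr \<mu> borel ?f) = (\<integral>t. poly (pcompose p ?B) (complex_of_real t) \<partial>\<mu>)"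
      using f by (subst integral_distr) (auto simp: poly_pcompose algebra_simps)
    also have "\<dots> = M (pcompose p (pcompose ?B ?A))"
      by (simp add: pcompose_assoc flip: \<mu>(4))
    also have "\<dots> = M p" unfolding BA by (simp add: pcompose_idR)
    finally show ?thesis by simp
  qed
  moreover have "AE x in distr \<mu> borel ?f. x \<in> {a..b}"
    using f \<mu>(3)
  proof (subst AE_distr_iff)
    show "AE t in \<mu>. ?f t \<in> {a..b}" using \<mu>(3)
    proof eventually_elim
      case (elim t)
      then have "(b - a) * t \<le> (b - a) * 1" "0 \<le> (b - a) * t" using \<open>a < b\<close> by (auto intro!: mult_left_mono)
      then show ?case by simp
    qed
  qed auto
  ultimately show ?thesis using finite_measure_distr[OF f] by (intro exI[of _ "distr \<mu> borel ?f"]) simp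
qed

section \<open>The Levy functional\<close>

text \<open>With the factor c - X in place of X - c, the quotient g at c = N is the integrand of the
  Levy functional, and g(N) = - f'(N).\<close>

lemma poly_quotient:
  fixes f :: "complex poly"
  obtains g where "f - [:poly f c:] = [:c, -1:] * g"
proof -
  have "[:- c, 1:] dvd f - [:poly f c:]" by (simp flip: poly_eq_0_iff_dvd)
  then obtain q where "f - [:poly f c:] = [:- c, 1:] * q" by (elim dvdE)
  then have "f - [:poly f c:] = [:c, -1:] * (- q)" by simp
  then show ?thesis by (rule that)
qed

lemma poly_map_cnj: "poly (map_poly cnj p) z = cnj (poly p (cnj z))"
  by (induction p) (simp_all add: map_poly_pCons)

context
  fixes N b :: real and \<nu> :: "real measure"
  assumes N: "N > 0" and fin: "finite_measure \<nu>"
    and sets: "sets \<nu> = sets (restrict_space borel {- N..N})" and null: "emeasure \<nu> {N} = 0"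
begin

lemma space_levy: "space \<nu> = {- N..N}"
  using sets_eq_imp_space_eq[OF sets] by (simp add: space_restrict_space)

lemma measurable_levy: "f \<in> borel_measurable borel \<Longrightarrow> f \<in> borel_measurable \<nu>"
  using measurable_restrict_space1[of f borel borel "{- N..N}"] measurable_cong_sets[OF sets refl] by blast

lemma integrable_poly_levy: "integrable \<nu> (\<lambda>x. poly g (complex_of_real x))"
proof -
  interpret finite_measure \<nu> by (rule fin)
  obtain B where B: "\<forall>x\<in>{- N..N}. norm (poly g (complex_of_real x)) \<le> B"
    using poly_bounded_on_interval by blast
  show ?thesis
    by (rule integrable_const_bound[of _ B])
      (use B in \<open>auto simp: space_levy intro!: AE_I2 measurable_levy\<close>)
qed

text \<open>In terms of g the functional is integration against \<nu> plus b times the point mass at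
  N. All its later properties are read off from this form.\<close>

lemma levy_functional_quotient:
  assumes g: "f - [:poly f (of_real N):] = [:of_real N, -1:] * g"
  shows "levy_functional N b \<nu> f = of_real b * poly g (of_real N) + (\<integral>x. poly g (complex_of_real x) \<partial>\<nu>)"
proof -
  have f: "f = [:poly f (of_real N):] + [:of_real N, -1:] * g"
    unfolding g[symmetric] by simp
  have "pderiv f = [:of_real N, -1:] * pderiv g + g * pderiv [:of_real N, -1:]"
    by (subst f) (simp only: pderiv_add pderiv_mult pderiv_singleton add_0_left)
  then have "poly (pderiv f) (of_real N) = - poly g (of_real N)"
    by (simp add: pderiv_pCons)
  moreover have "(\<integral>x. (poly f (of_real x) - poly f (of_real N)) / of_real (N - x) \<partial>\<nu>)
      = (\<integral>x. poly g (complex_of_real x) \<partial>\<nu>)"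
  proof (rule integral_cong_AE)
    \<comment> \<open>At x = N the integrand is 0/0 = 0 whereas g(N) may be nonzero; the two
      functions agree only off this point.\<close>
    have "{N} \<in> null_sets \<nu>"
      using N null by (intro null_setsI) (auto simp: sets sets_restrict_space_iff)
    then have "AE x in \<nu>. x \<noteq> N" by (rule AE_I') auto
    then show "AE x in \<nu>. (poly f (of_real x) - poly f (of_real N)) / of_real (N - x) = poly g (complex_of_real x)"
    proof eventually_elim
      case (elim x)
      have "poly f (of_real x) - poly f (of_real N) = poly (f - [:poly f (of_real N):]) (of_real x)"
        by simp
      also have "\<dots> = of_real (N - x) * poly g (of_real x)"
        by (simp add: g algebra_simps)
      finally have "poly f (of_real x) - poly f (of_real N) = of_real (N - x) * poly g (of_real x)" .
      moreover have "complex_of_real (N - x) \<noteq> 0" using elim by simp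
      ultimately show ?case by (metis nonzero_mult_div_cancel_left)
    qed
  qed (auto intro!: measurable_levy)
  ultimately show ?thesis by (simp add: levy_functional_def)
qed

lemma levy_functional_add:
  "levy_functional N b \<nu> (f1 + f2) = levy_functional N b \<nu> f1 + levy_functional N b \<nu> f2"
proof -
  obtain g1 where g1: "f1 - [:poly f1 (of_real N):] = [:of_real N, -1:] * g1" by (rule poly_quotient)
  obtain g2 where g2: "f2 - [:poly f2 (of_real N):] = [:of_real N, -1:] * g2" by (rule poly_quotient)
  have "f1 + f2 - [:poly (f1 + f2) (of_real N):]
      = (f1 - [:poly f1 (of_real N):]) + (f2 - [:poly f2 (of_real N):])" by simp
  also have "\<dots> = [:of_real N, -1:] * (g1 + g2)" by (simp only: g1 g2 distrib_left)
  finally have g: "f1 + f2 - [:poly (f1 + f2) (of_real N):] = [:of_real N, -1:] * (g1 + g2)" .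
  show ?thesis
    unfolding levy_functional_quotient[OF g1] levy_functional_quotient[OF g2] levy_functional_quotient[OF g]
    by (simp add: integrable_poly_levy distrib_left)
qed

lemma levy_functional_smult:
  "levy_functional N b \<nu> (smult c f) = c * levy_functional N b \<nu> f"
proof -
  obtain g where g: "f - [:poly f (of_real N):] = [:of_real N, -1:] * g" by (rule poly_quotient)
  have "smult c f - [:poly (smult c f) (of_real N):] = smult c (f - [:poly f (of_real N):])"
    by (simp add: smult_diff_right)
  also have "\<dots> = [:of_real N, -1:] * smult c g" by (simp only: g mult_smult_right)
  finally have g': "smult c f - [:poly (smult c f) (of_real N):] = [:of_real N, -1:] * smult c g" .
  show ?thesis
    unfolding levy_functional_quotient[OF g] levy_functional_quotient[OF g'] by (simp add: distrib_left)
qed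

lemma levy_functional_cnj:
  "levy_functional N b \<nu> (map_poly cnj f) = cnj (levy_functional N b \<nu> f)"
proof -
  obtain g where g: "f - [:poly f (of_real N):] = [:of_real N, -1:] * g" by (rule poly_quotient)
  have "poly (map_poly cnj f - [:poly (map_poly cnj f) (of_real N):]) z
      = poly ([:of_real N, -1:] * map_poly cnj g) z" for z
  proof -
    have "poly (map_poly cnj f - [:poly (map_poly cnj f) (of_real N):]) z
        = cnj (poly (f - [:poly f (of_real N):]) (cnj z))" by (simp add: poly_map_cnj)
    also have "\<dots> = poly ([:of_real N, -1:] * map_poly cnj g) z"
      unfolding g by (simp add: poly_map_cnj)
    finally show ?thesis .
  qed
  then have "map_poly cnj f - [:poly (map_poly cnj f) (of_real N):] = [:of_real N, -1:] * map_poly cnj g"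
    by (intro poly_eq_poly_eq_iff[THEN iffD1] ext)
  from levy_functional_quotient[OF this] show ?thesis
    unfolding levy_functional_quotient[OF g] by (simp add: poly_map_cnj)
qed

lemma levy_functional_nonneg:
  assumes b: "b \<ge> 0" and f0: "poly f (of_real N) = 0"
    and f: "\<And>x. - N \<le> x \<Longrightarrow> x \<le> N \<Longrightarrow> poly f (of_real x) \<in> \<real>\<^sub>\<ge>\<^sub>0"
  shows "levy_functional N b \<nu> f \<in> \<real>\<^sub>\<ge>\<^sub>0"
proof -
  obtain g where g: "f - [:poly f (of_real N):] = [:of_real N, -1:] * g" by (rule poly_quotient)
  have *: "poly g (of_real x) \<in> \<real>\<^sub>\<ge>\<^sub>0" if "- N \<le> x" "x < N" for x
  proof -
    have "f = [:of_real N, -1:] * g" using g f0 by simp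
    then have "poly f (of_real x) = of_real (N - x) * poly g (of_real x)"
      by (simp add: algebra_simps)
    then have "poly g (of_real x) = of_real (1 / (N - x)) * poly f (of_real x)"
      using that by (simp add: field_simps)
    also have "\<dots> \<in> \<real>\<^sub>\<ge>\<^sub>0"
    proof (rule nonneg_Reals_mult_I)
      show "complex_of_real (1 / (N - x)) \<in> \<real>\<^sub>\<ge>\<^sub>0"
        using that by (simp only: nonneg_Reals_of_real_iff) simp
    qed (use f that in simp)
    finally show ?thesis .
  qed
  \<comment> \<open>Dividing by N - x gives nonnegativity of g only for x < N; continuity extends it
    to N, where the coefficient of b is evaluated.\<close>
  have "closed ((\<lambda>x. poly g (complex_of_real x)) -` \<real>\<^sub>\<ge>\<^sub>0)"
    by (intro closed_vimage continuous_intros) simp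
  moreover have "{- N..<N} \<subseteq> (\<lambda>x. poly g (complex_of_real x)) -` \<real>\<^sub>\<ge>\<^sub>0" using * by auto
  ultimately have "closure {- N..<N} \<subseteq> (\<lambda>x. poly g (complex_of_real x)) -` \<real>\<^sub>\<ge>\<^sub>0"
    by (rule closure_minimal[rotated])
  then have **: "poly g (of_real x) \<in> \<real>\<^sub>\<ge>\<^sub>0" if "x \<in> {- N..N}" for x
    using N that by auto
  have "(\<integral>x. poly g (complex_of_real x) \<partial>\<nu>) = (\<integral>x. complex_of_real (Re (poly g (of_real x))) \<partial>\<nu>)"
    using ** by (intro Bochner_Integration.integral_cong) (auto simp: space_levy complex_nonneg_Reals_iff complex_eq_iff)
  also have "\<dots> = of_real (\<integral>x. Re (poly g (of_real x)) \<partial>\<nu>)" by simp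
  also have "\<dots> \<in> \<real>\<^sub>\<ge>\<^sub>0"
    using ** by (simp only: nonneg_Reals_of_real_iff)
      (intro integral_nonneg_AE AE_I2, auto simp: space_levy complex_nonneg_Reals_iff)
  finally show ?thesis
    unfolding levy_functional_quotient[OF g] using b ** N
    by (intro nonneg_Reals_add_I nonneg_Reals_mult_I) auto
qed

end

section \<open>Functionals factoring through the averaging map\<close>

text \<open>Apply h to the invariance identity and exchange the two slices.\<close>

lemma ad_invariant_eq_ad_h:
  assumes lin: "clinear \<phi>" and inv: "ad_invariant \<phi>" and h: "haar_state h"
  shows "\<phi> a = \<phi> (ad_h h a)"
proof -
  have "\<phi> (ad_h h a) = h (slice_right \<phi> (ad a))"
    unfolding ad_h_def by (rule slice_swap[OF haar_state_clinear[OF h] lin])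
  also have "\<dots> = h (\<phi> a *\<^sub>C 1)" using inv by (simp add: ad_invariant_def)
  also have "\<dots> = \<phi> a * h 1"
    unfolding clinear_scaleC[OF haar_state_clinear[OF h]] by (simp add: scaleC_complex_def)
  also have "\<dots> = \<phi> a" using h by (simp add: haar_state_def)
  finally show ?thesis by simp
qed

text \<open>On an irreducible u the matrix \<phi>(u) is a scalar c, since averaging kills
  off-diagonal entries and identifies the diagonal ones. The slice is then c times the product of u
  with its adjoint, that is, c.\<close>

lemma ad_invariant_ad_h:
  fixes u :: "nat \<Rightarrow> nat \<Rightarrow> nat \<Rightarrow> 'n::finite pol_orth" and h :: "'n pol_orth \<Rightarrow> complex"
  assumes ir: "irreps d u" and h: "haar_state h" and lin: "clinear \<phi>"
    and L: "\<And>a. \<phi> a = L (ad_h h a)"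
  shows "ad_invariant \<phi>"
  unfolding ad_invariant_def
proof
  note slin = clinear_slice_right[OF lin]
  fix a
  show "slice_right \<phi> (ad a) = \<phi> a *\<^sub>C 1"
    using ir
  proof (induction a rule: irreps_induct)
    case (coeff s i j)
    let ?I = "{..<d s}"
    have uu: "unitary_corep ?I (u s)" by (rule irrepsD(3)[OF ir])
    define c where "c = L ((1 / of_nat (d s)) *\<^sub>C character d u s)"
    \<comment> \<open>\<open>L\<close> is an arbitrary function; its value at 0 is forced by
      linearity of \<phi>.\<close>
    have L0: "L 0 = 0"
      using L[of 0] clinear_0[OF lin] clinear_0[OF clinear_ad_h[OF haar_state_clinear[OF h]]] by simp
    have \<phi>: "\<phi> (u s p q) = (if p = q then c else 0)" if "p \<in> ?I" "q \<in> ?I" for p q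
      using that by (simp add: L ad_h_character[OF ir h] c_def L0)
    have "slice_right \<phi> (ad (u s i j)) = (\<Sum>p\<in>?I. \<Sum>q\<in>?I. \<phi> (u s p q) *\<^sub>C (u s i p * star (u s j q)))"
      using coeff by (simp add: ad_corep[OF unitary_corep_corep[OF uu]] clinear_sum[OF slin] slice_right_tens[OF lin]
          antipode_corep[OF uu])
    also have "\<dots> = (\<Sum>p\<in>?I. \<Sum>q\<in>?I. (if p = q then c else 0) *\<^sub>C (u s i p * star (u s j q)))"
      by (intro sum.cong refl) (simp add: \<phi>)
    also have "\<dots> = (\<Sum>p\<in>?I. c *\<^sub>C (u s i p * star (u s j p)))"
      by (intro sum.cong refl) (simp only: sum_delta_scaleC finite_lessThan)
    also have "\<dots> = c *\<^sub>C (if i = j then 1 else 0)"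
      using uu coeff by (simp add: unitary_corep_def flip: complex_vector.scale_sum_right)
    also have "\<dots> = \<phi> (u s i j) *\<^sub>C 1" using coeff by (simp add: \<phi>)
    finally show ?case .
  qed (simp_all add: clinear_add[OF slin] clinear_scaleC[OF slin] clinear_add[OF clinear_ad] clinear_scaleC[OF clinear_ad]
      clinear_add[OF lin] clinear_scaleC[OF lin] scaleC_add_left scaleC_scaleC scaleC_complex_def)
qed

section \<open>Positivity of generating functionals on central elements\<close>

text \<open>In column j the Kronecker deltas contribute 1, the squares of the generators contribute
  1 by orthogonality, and the cross terms leave -2s \<open>vgen j j\<close>.\<close>

lemma sum_sq_one_minus_gen:
  assumes s: "s * s = 1"
  shows "(\<Sum>j\<in>UNIV. \<Sum>k\<in>UNIV. ((if k = j then 1 else 0) - s *\<^sub>C vgen k j) * ((if k = j then 1 else 0) - s *\<^sub>C vgen k j))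
    = 2 *\<^sub>C (of_nat CARD('n) *\<^sub>C 1 - s *\<^sub>C (fund_char :: 'n::finite pol_orth))"
proof -
  have "(\<Sum>k\<in>UNIV. ((if k = j then 1 else 0) - s *\<^sub>C vgen k j) * ((if k = j then 1 else 0) - s *\<^sub>C vgen k j))
      = 2 *\<^sub>C (1 - s *\<^sub>C (vgen j j :: 'n pol_orth))" for j :: 'n
  proof -
    have "(\<Sum>k\<in>UNIV. ((if k = j then 1 else 0) - s *\<^sub>C vgen k j) * ((if k = j then 1 else 0) - s *\<^sub>C vgen k j))
      = (\<Sum>k\<in>UNIV. vgen k j * vgen k j + (if k = j then 1 - 2 *\<^sub>C s *\<^sub>C vgen j j else (0 :: 'n pol_orth)))"
      using s scaleC_add_left[of 1 1 "s *\<^sub>C (vgen j j :: 'n pol_orth)"]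
      by (intro sum.cong refl) (auto simp: algebra_simps mult_scaleC_left mult_scaleC_right scaleC_scaleC)
    also have "\<dots> = 1 + (1 - 2 *\<^sub>C s *\<^sub>C vgen j j)"
      using orth_family_v[where ?'a = 'n] by (simp add: sum.distrib orth_family_def)
    also have "\<dots> = 2 *\<^sub>C (1 - s *\<^sub>C vgen j j)"
      using scaleC_add_left[of 1 1 "1 :: 'n pol_orth"] by (simp add: complex_vector.scale_right_diff_distrib)
    finally show ?thesis .
  qed
  then show ?thesis
    by (simp add: fund_char_def sum_subtractf complex_vector.scale_sum_right complex_vector.scale_right_diff_distrib)
      (simp add: scaleC_scaleC of_nat_mult_scaleC mult.commute flip: complex_vector.scale_sum_right)
qed

context
  fixes \<phi> :: "'n::finite pol_orth \<Rightarrow> complex"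
  assumes gen: "generating_functional \<phi>"
begin

lemma gen_clinear: "clinear \<phi>"
  using gen by (simp add: generating_functional_def)

text \<open>Each summand is the square of an element e y, which must lie in ker \<epsilon>. For s =
  1 the factor e already does, so y is free; for s = -1 it does not, and y has to supply the
  zero.\<close>

lemma gen_sandwich_nonneg:
  assumes s: "s = 1 \<or> s = -1 \<and> counit y = 0"
  shows "\<phi> (star y * (of_nat CARD('n) *\<^sub>C 1 - s *\<^sub>C fund_char) * y) \<in> \<real>\<^sub>\<ge>\<^sub>0"
proof -
  define e where "e k j = (if k = j then 1 else 0) - s *\<^sub>C vgen k j" for k j :: 'n
  have ss: "s * s = 1" "cnj s = s" using s by auto
  have star_e: "star (e k j) = e k j" for k j
    by (simp add: e_def star_diff star_delta star_facts ss)
  have ce: "counit (e k j * y) = 0" for k j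
  proof -
    have "counit (e k j) = (if k = j then 1 - s else 0)"
      by (simp add: e_def clinear_diff[OF clinear_counit] counit_facts clinear_0[OF clinear_counit] scaleC_complex_def)
    then show ?thesis using s by (auto simp: counit_facts)
  qed
  let ?x = "star y * (of_nat CARD('n) *\<^sub>C 1 - s *\<^sub>C fund_char) * y"
  have "2 *\<^sub>C ?x = star y * (2 *\<^sub>C (of_nat CARD('n) *\<^sub>C 1 - s *\<^sub>C fund_char)) * y"
    by (simp only: mult_scaleC_left mult_scaleC_right)
  also have "\<dots> = (\<Sum>j\<in>UNIV. \<Sum>k\<in>UNIV. star (e k j * y) * (e k j * y))"
    unfolding sum_sq_one_minus_gen[OF ss(1), symmetric] e_def[symmetric]
    by (simp add: sum_distrib_left sum_distrib_right star_facts star_e mult.assoc)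
  finally have sq: "2 *\<^sub>C ?x = (\<Sum>j\<in>UNIV. \<Sum>k\<in>UNIV. star (e k j * y) * (e k j * y))" .
  have "2 * \<phi> ?x = \<phi> (2 *\<^sub>C ?x)"
    by (simp only: clinear_scaleC[OF gen_clinear] scaleC_complex_def)
  also have "\<dots> = (\<Sum>j\<in>UNIV. \<Sum>k\<in>UNIV. \<phi> (star (e k j * y) * (e k j * y)))"
    unfolding sq by (simp only: clinear_sum[OF gen_clinear])
  finally have "2 * \<phi> ?x = (\<Sum>j\<in>UNIV. \<Sum>k\<in>UNIV. \<phi> (star (e k j * y) * (e k j * y)))" .
  moreover have "\<phi> (star (e k j * y) * (e k j * y)) \<in> \<real>\<^sub>\<ge>\<^sub>0" for k j
    using gen ce by (simp add: generating_functional_def)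
  then have "(\<Sum>j\<in>UNIV. \<Sum>k\<in>UNIV. \<phi> (star (e k j * y) * (e k j * y))) \<in> \<real>\<^sub>\<ge>\<^sub>0"
    by (simp add: complex_nonneg_Reals_iff sum_nonneg)
  ultimately have "2 * \<phi> ?x \<in> \<real>\<^sub>\<ge>\<^sub>0" by simp
  then show ?thesis by (simp add: complex_nonneg_Reals_iff)
qed

text \<open>When both exponents are odd, \<open>(N - \<chi>)\<^sup>m (N + \<chi>)\<^sup>k\<close> is not visibly a sum of squares of elements of
  \<open>ker \<epsilon>\<close>; multiplying it by \<open>((N - \<chi>) + (N + \<chi>)) / (2N) = 1\<close> reduces to the other parities.\<close>

lemma gen_central_nonneg:
  assumes m: "m \<ge> 1"
  shows "\<phi> (alg_poly fund_char ([:of_nat CARD('n), -1:] ^ m * [:of_nat CARD('n), 1:] ^ k)) \<in> \<real>\<^sub>\<ge>\<^sub>0"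
proof -
  let ?a = "[:of_nat CARD('n), -1:] :: complex poly" and ?b = "[:of_nat CARD('n), 1:] :: complex poly"
  define G where "G p = \<phi> (alg_poly fund_char p)" for p
  have a: "alg_poly fund_char ?a = of_nat CARD('n) *\<^sub>C 1 - 1 *\<^sub>C (fund_char :: 'n pol_orth)"
    by simp
  have b: "alg_poly fund_char ?b = of_nat CARD('n) *\<^sub>C 1 - (-1) *\<^sub>C (fund_char :: 'n pol_orth)"
    by simp
  have real: "map_poly cnj (?a ^ i * ?b ^ j) = ?a ^ i * ?b ^ j" for i j
    by (intro poly_eq_poly_eq_iff[THEN iffD1] ext) (simp add: poly_map_cnj)
  have star: "star (alg_poly fund_char (?a ^ i * ?b ^ j)) = alg_poly (fund_char :: 'n pol_orth) (?a ^ i * ?b ^ j)" for i j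
    by (simp only: star_alg_poly[OF star_fund_char] real)
  have counit: "counit (alg_poly (fund_char :: 'n pol_orth) p) = poly p (of_nat CARD('n))" for p
    using hom_alg_poly[of counit "fund_char :: 'n pol_orth" p] star_character_counit[where ?'a = 'n]
    by (simp add: star_character_def counit_fund_char)
  \<comment> \<open>The three kinds of squares at hand: the one with the middle factor N - \<chi>
    holds for every p, the others only when p vanishes at N.\<close>
  have sq: "G (p * ?a * p) \<in> \<real>\<^sub>\<ge>\<^sub>0"
    "poly p (of_nat CARD('n)) = 0 \<Longrightarrow> G (p * ?b * p) \<in> \<real>\<^sub>\<ge>\<^sub>0"
    "poly p (of_nat CARD('n)) = 0 \<Longrightarrow> G (p * p) \<in> \<real>\<^sub>\<ge>\<^sub>0" if p: "p = ?a ^ i * ?b ^ j" for p i j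
  proof -
    let ?y = "alg_poly (fund_char :: 'n pol_orth) p"
    have y: "star ?y = ?y" unfolding p by (rule star)
    show "G (p * ?a * p) \<in> \<real>\<^sub>\<ge>\<^sub>0"
      using gen_sandwich_nonneg[of 1 ?y] unfolding G_def alg_poly_mult[of _ _ p] alg_poly_mult[of _ p] a y by simp
    assume 0: "poly p (of_nat CARD('n)) = 0"
    show "G (p * ?b * p) \<in> \<real>\<^sub>\<ge>\<^sub>0"
      using gen_sandwich_nonneg[of "-1" ?y] 0 unfolding G_def alg_poly_mult[of _ _ p] alg_poly_mult[of _ p] b y counit by simp
    have "\<phi> (star ?y * ?y) \<in> \<real>\<^sub>\<ge>\<^sub>0" using gen 0 by (simp add: generating_functional_def counit)
    then show "G (p * p) \<in> \<real>\<^sub>\<ge>\<^sub>0" unfolding G_def alg_poly_mult y .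
  qed
  \<comment> \<open>Half of the even power of N - \<chi> goes into p, which therefore vanishes at
    N.\<close>
  have even_m: "G (?a ^ m * ?b ^ k) \<in> \<real>\<^sub>\<ge>\<^sub>0" if "even m" "m \<ge> 1" for m k
  proof -
    obtain i where i: "m = 2 * i" using \<open>even m\<close> by blast
    have z: "poly (?a ^ i * ?b ^ j) (of_nat CARD('n)) = 0" for j using i \<open>m \<ge> 1\<close> by simp
    show ?thesis
    proof (cases "even k")
      case True
      then obtain j where "k = 2 * j" by blast
      then have "?a ^ m * ?b ^ k = (?a ^ i * ?b ^ j) * (?a ^ i * ?b ^ j)"
        unfolding i by (simp only: mult_2 power_add) (simp only: mult_ac)
      then show ?thesis using sq(3)[OF refl z] by metis
    next
      case False
      then obtain j where "k = 2 * j + 1" by (elim oddE)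
      then have "?a ^ m * ?b ^ k = (?a ^ i * ?b ^ j) * ?b * (?a ^ i * ?b ^ j)"
        unfolding i by (simp only: mult_2 power_add power_one_right) (simp only: mult_ac)
      then show ?thesis using sq(2)[OF refl z] by metis
    qed
  qed
  have odd_m: "G (?a ^ m * ?b ^ k) \<in> \<real>\<^sub>\<ge>\<^sub>0" if "odd m" "even k" for m k
  proof -
    obtain i where "m = 2 * i + 1" using \<open>odd m\<close> by (rule oddE)
    moreover obtain j where "k = 2 * j" using \<open>even k\<close> by (rule evenE)
    ultimately have "?a ^ m * ?b ^ k = (?a ^ i * ?b ^ j) * ?a * (?a ^ i * ?b ^ j)"
      by (simp only: mult_2 power_add power_one_right) (simp only: mult_ac)
    then show ?thesis using sq(1)[OF refl] by metis
  qed
  have "G (?a ^ m * ?b ^ k) \<in> \<real>\<^sub>\<ge>\<^sub>0"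
  proof (cases "odd m \<and> odd k")
    case True
    let ?c = "complex_of_real (1 / (2 * real CARD('n)))"
    have "smult ?c (?a + ?b) = 1" by (simp add: one_pCons)
    then have "?a ^ m * ?b ^ k = ?a ^ m * ?b ^ k * smult ?c (?a + ?b)" by simp
    also have "\<dots> = smult ?c (?a ^ Suc m * ?b ^ k + ?a ^ m * ?b ^ Suc k)"
      by (simp only: mult_smult_right distrib_left power_Suc mult_ac)
    finally have "G (?a ^ m * ?b ^ k) = ?c * (G (?a ^ Suc m * ?b ^ k) + G (?a ^ m * ?b ^ Suc k))"
      by (metis G_def alg_poly_add alg_poly_smult clinear_add[OF gen_clinear] clinear_scaleC[OF gen_clinear] scaleC_complex_def)
    moreover have "?c \<in> \<real>\<^sub>\<ge>\<^sub>0" by (simp only: nonneg_Reals_of_real_iff) simp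
    ultimately show ?thesis
      using even_m[of "Suc m" k] odd_m[of m "Suc k"] True by (auto intro!: nonneg_Reals_mult_I nonneg_Reals_add_I)
  qed (use even_m odd_m m in auto)
  then show ?thesis by (simp only: G_def)
qed

end

text \<open>Removing the atom by a density leaves a measure on the whole line; restricting it
  afterwards gives the required sigma-algebra on [-N, N].\<close>

lemma remove_endpoint_atom:
  assumes fin: "finite_measure \<mu>" and sets: "sets \<mu> = sets borel" and AE: "AE x in \<mu>. x \<in> {- N..N}"
  obtains b \<nu> where "b \<ge> 0" "finite_measure \<nu>" "sets \<nu> = sets (restrict_space borel {- N..N})"
    "emeasure \<nu> {N} = 0"
    "\<And>p. (\<integral>x. poly p (complex_of_real x) \<partial>\<mu>) = of_real b * poly p (of_real N) + (\<integral>x. poly p (complex_of_real x) \<partial>\<nu>)"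
proof -
  interpret finite_measure \<mu> by (rule fin)
  define \<nu>' where "\<nu>' = density \<mu> (indicator (- {N}))"
  define \<nu> where "\<nu> = restrict_space \<nu>' {- N..N}"
  have bm: "borel_measurable \<mu> = borel_measurable borel" by (rule measurable_cong_sets[OF sets refl])
  have sets': "sets \<nu>' = sets borel" by (simp add: \<nu>'_def sets)
  have sp: "space \<mu> = UNIV" using sets_eq_imp_space_eq[OF sets] by simp
  have "finite_measure \<nu>'"
  proof (rule finite_measureI)
    have "emeasure \<nu>' (space \<nu>') = emeasure \<mu> (- {N})"
      unfolding \<nu>'_def by (subst emeasure_density) (auto simp: sets bm sp)
    then show "emeasure \<nu>' (space \<nu>') \<noteq> \<infinity>" by simp
  qed
  then have 1: "finite_measure \<nu>" unfolding \<nu>_def by (rule finite_measure_restrict_space) (simp add: sets')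
  have 2: "sets \<nu> = sets (restrict_space borel {- N..N})"
    unfolding \<nu>_def by (rule sets_restrict_space_cong[OF sets'])
  have "emeasure \<nu>' {N} = 0"
    unfolding \<nu>'_def by (subst emeasure_density) (auto simp: sets bm indicator_inter_arith[symmetric])
  moreover have "emeasure \<nu> {N} = emeasure \<nu>' {N}" if "N \<in> {- N..N}"
    unfolding \<nu>_def using that by (subst emeasure_restrict_space) (auto simp: sets')
  \<comment> \<open>For N < 0 the interval is empty and {N} is not measurable, where
    \<open>emeasure\<close> takes its default value 0.\<close>
  moreover have "emeasure \<nu> {N} = 0" if "N \<notin> {- N..N}"
    using that by (intro emeasure_notin_sets) (auto simp: 2 sets_restrict_space_iff)
  ultimately have 3: "emeasure \<nu> {N} = 0" by metis
  have "(\<integral>x. poly p (complex_of_real x) \<partial>\<mu>)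
      = of_real (measure \<mu> {N}) * poly p (of_real N) + (\<integral>x. poly p (complex_of_real x) \<partial>\<nu>)" for p
  proof -
    let ?p = "\<lambda>x. poly p (complex_of_real x)"
    have int: "integrable \<mu> ?p" by (rule integrable_poly_interval[OF fin sets AE])
    have "(\<integral>x. ?p x \<partial>\<nu>) = (\<integral>x. indicator {- N..N} x *\<^sub>R ?p x \<partial>\<nu>')"
      unfolding \<nu>_def by (rule integral_restrict_space) (simp add: sets')
    also have "\<dots> = (\<integral>x. indicator (- {N}) x *\<^sub>R (indicator {- N..N} x *\<^sub>R ?p x) \<partial>\<mu>)"
      unfolding \<nu>'_def ennreal_indicator[symmetric] by (subst integral_density) (auto simp: bm)
    \<comment> \<open>The cutoff to [-N, N] disappears because \<mu> is concentrated there.\<close>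
    also have "\<dots> = (\<integral>x. ?p x - indicator {N} x *\<^sub>R ?p N \<partial>\<mu>)"
      using AE by (intro integral_cong_AE) (auto simp: bm split: split_indicator)
    also have "\<dots> = (\<integral>x. ?p x \<partial>\<mu>) - (\<integral>x. indicator {N} x *\<^sub>R ?p N \<partial>\<mu>)"
      by (intro Bochner_Integration.integral_diff int integrable_scaleR_left integrable_real_indicator)
        (auto simp: sets less_top[symmetric])
    also have "(\<integral>x. indicator {N} x *\<^sub>R ?p N \<partial>\<mu>) = of_real (measure \<mu> {N}) * ?p N"
      by (subst integral_scaleR_left) (auto simp: sets sp scaleR_conv_of_real less_top[symmetric])
    finally show ?thesis by simp
  qed
  with 1 2 3 show ?thesis by (intro that[of "measure \<mu> {N}" \<nu>]) auto
qed

section \<open>The two inclusions\<close>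

context
  fixes d :: "nat \<Rightarrow> nat" and u :: "nat \<Rightarrow> nat \<Rightarrow> nat \<Rightarrow> 'n::finite pol_orth" and h :: "'n pol_orth \<Rightarrow> complex"
  assumes card: "CARD('n) \<ge> 2" and ir: "irreps d u" and h: "haar_state h"
begin

lemma ad_h_eq_alg_poly: "ad_h h a = alg_poly fund_char (central_to_poly d u (ad_h h a))"
  using ad_h_central[OF ir h, of a] central_to_poly_alg_poly[OF card ir] by metis

lemma central_ad_h_eqI: "ad_h h a = alg_poly fund_char f \<Longrightarrow> central_to_poly d u (ad_h h a) = f"
  using central_to_poly_alg_poly[OF card ir] by metis

lemma generating_functional_levy:
  assumes b: "b \<ge> 0" and \<nu>: "finite_measure \<nu>"
    "sets \<nu> = sets (restrict_space borel {- real CARD('n)..real CARD('n)})"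
    "emeasure \<nu> {real CARD('n)} = 0"
  shows "generating_functional (\<lambda>a. levy_functional (real CARD('n)) b \<nu> (central_to_poly d u (ad_h h a)))"
    and "ad_invariant (\<lambda>a. levy_functional (real CARD('n)) b \<nu> (central_to_poly d u (ad_h h a)))"
proof -
  let ?F = "\<lambda>a. central_to_poly d u (ad_h h a)"
  have N: "real CARD('n) > 0" using card by simp
  note levy = levy_functional_add[OF N \<nu>] levy_functional_smult[OF N \<nu>] levy_functional_cnj[OF N \<nu>]
  have hl: "clinear (ad_h h)" by (rule clinear_ad_h[OF haar_state_clinear[OF h]])
  have F: "?F (x + y) = ?F x + ?F y" "?F (c *\<^sub>C x) = smult c (?F x)" "?F (star x) = map_poly cnj (?F x)" "?F 1 = 1" for x y c
    by (intro central_ad_h_eqI; simp add: clinear_add[OF hl] clinear_scaleC[OF hl] alg_poly_add alg_poly_smult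
        ad_h_star[OF ir h] ad_h_1[OF ir h] star_alg_poly[OF star_fund_char, symmetric] flip: ad_h_eq_alg_poly)+
  have lin: "clinear (\<lambda>a. levy_functional (real CARD('n)) b \<nu> (?F a))"
    by (simp add: clinear_iff F levy scaleC_complex_def)
  \<comment> \<open>Turns \<epsilon>(a) = 0 into the vanishing of the polynomial of
    \<open>star a * a\<close> at N, the condition in \<open>levy_functional_nonneg\<close>.\<close>
  have counit: "counit a = poly (?F a) (of_nat CARD('n))" for a
  proof -
    have "counit a = counit (alg_poly (fund_char :: 'n pol_orth) (?F a))"
      by (simp add: counit_ad_h[OF ir h] flip: ad_h_eq_alg_poly)
    also have "\<dots> = poly (?F a) (counit (fund_char :: 'n pol_orth))"
      using star_character_counit[where ?'a = 'n] by (intro hom_alg_poly) (simp_all add: star_character_def)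
    finally show ?thesis by (simp add: counit_fund_char)
  qed
  have "levy_functional (real CARD('n)) b \<nu> (?F (star a * a)) \<in> \<real>\<^sub>\<ge>\<^sub>0" if "counit a = 0" for a
  proof (rule levy_functional_nonneg[OF N \<nu> b])
    show "poly (?F (star a * a)) (complex_of_real (real CARD('n))) = 0"
      using counit[of "star a * a"] that by (simp add: counit_facts)
    fix x assume "- real CARD('n) \<le> x" "x \<le> real CARD('n)"
    then show "poly (?F (star a * a)) (complex_of_real x) \<in> \<real>\<^sub>\<ge>\<^sub>0"
      by (intro ad_h_poly_nonneg[OF ir h card _ _ ad_h_eq_alg_poly])
  qed
  then show "generating_functional (\<lambda>a. levy_functional (real CARD('n)) b \<nu> (?F a))"
    by (simp add: generating_functional_def lin F levy) (simp add: levy_functional_def)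
  show "ad_invariant (\<lambda>a. levy_functional (real CARD('n)) b \<nu> (?F a))"
    by (rule ad_invariant_ad_h[OF ir h lin]) (rule refl)
qed

lemma ad_invariant_generating_levy:
  assumes gen: "generating_functional \<phi>" and inv: "ad_invariant \<phi>"
  obtains b \<nu> where "b \<ge> 0" "finite_measure \<nu>"
    "sets \<nu> = sets (restrict_space borel {- real CARD('n)..real CARD('n)})"
    "emeasure \<nu> {real CARD('n)} = 0"
    "\<phi> = (\<lambda>a. levy_functional (real CARD('n)) b \<nu> (central_to_poly d u (ad_h h a)))"
proof -
  let ?F = "\<lambda>a. central_to_poly d u (ad_h h a)"
  let ?N = "real CARD('n)" and ?a = "[:of_nat CARD('n), -1:] :: complex poly"
  have N: "?N > 0" using card by simp
  have lin: "clinear \<phi>" by (rule gen_clinear[OF gen])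
  define M where "M g = \<phi> (alg_poly fund_char (?a * g))" for g
  have "\<exists>\<mu>. finite_measure \<mu> \<and> sets \<mu> = sets borel \<and> (AE x in \<mu>. x \<in> {- ?N..?N})
    \<and> (\<forall>p. M p = (\<integral>x. poly p (complex_of_real x) \<partial>\<mu>))"
  proof (rule hausdorff_moment_interval)
    show "M (p + q) = M p + M q" for p q
      by (simp only: M_def distrib_left alg_poly_add clinear_add[OF lin])
    show "M (smult c p) = c * M p" for c p
      by (simp only: M_def mult_smult_right alg_poly_smult clinear_scaleC[OF lin] scaleC_complex_def)
    fix k l
    \<comment> \<open>The factor N - x built into \<open>M\<close> raises the exponent to at least
      1, as \<open>gen_central_nonneg\<close> demands.\<close>
    have "?a * ([:- complex_of_real (- ?N), 1:] ^ k * [:complex_of_real ?N, - 1:] ^ l)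
        = ?a ^ Suc l * [:of_nat CARD('n), 1:] ^ k"
      by (simp only: of_real_minus minus_minus of_real_of_nat_eq power_Suc mult_ac)
    then show "M ([:- complex_of_real (- ?N), 1:] ^ k * [:complex_of_real ?N, - 1:] ^ l) \<in> \<real>\<^sub>\<ge>\<^sub>0"
      unfolding M_def using gen_central_nonneg[OF gen, of "Suc l" k] by (simp only:)
  qed (use N in simp)
  then obtain \<mu> where \<mu>: "finite_measure \<mu>" "sets \<mu> = sets borel" "AE x in \<mu>. x \<in> {- ?N..?N}"
    and M: "\<And>p. M p = (\<integral>x. poly p (complex_of_real x) \<partial>\<mu>)" by blast
  obtain b \<nu> where b: "b \<ge> 0" and \<nu>: "finite_measure \<nu>" "sets \<nu> = sets (restrict_space borel {- ?N..?N})"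
    "emeasure \<nu> {?N} = 0"
    and int: "\<And>p. (\<integral>x. poly p (complex_of_real x) \<partial>\<mu>)
      = of_real b * poly p (of_real ?N) + (\<integral>x. poly p (complex_of_real x) \<partial>\<nu>)"
    by (rule remove_endpoint_atom[OF \<mu>]) blast
  have "\<phi> a = levy_functional ?N b \<nu> (?F a)" for a
  proof -
    \<comment> \<open>The constant part of the polynomial is invisible since \<phi> 1 = 0. What
      remains is M g, the integral of g against \<mu>, which is the Levy functional in quotient
      form.\<close>
    obtain g where g: "?F a - [:poly (?F a) (of_real ?N):] = [:of_real ?N, -1:] * g" by (rule poly_quotient)
    then have "?F a = smult (poly (?F a) (of_real ?N)) 1 + ?a * g"
      by (simp add: algebra_simps one_pCons)
    then have "\<phi> (alg_poly fund_char (?F a)) = poly (?F a) (of_real ?N) * \<phi> 1 + M g"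
      by (metis M_def alg_poly_add alg_poly_smult alg_poly_1 clinear_add[OF lin] clinear_scaleC[OF lin] scaleC_complex_def)
    moreover have "\<phi> a = \<phi> (alg_poly fund_char (?F a))"
      using ad_invariant_eq_ad_h[OF lin inv h] ad_h_eq_alg_poly by metis
    moreover have "\<phi> 1 = 0" using gen by (simp add: generating_functional_def)
    ultimately show ?thesis
      using levy_functional_quotient[OF N \<nu> g] by (simp add: M int)
  qed
  then show ?thesis using b \<nu> by (intro that) auto
qed

end

theorem theorem10p2:
  fixes d :: "nat \<Rightarrow> nat"
    and u :: "nat \<Rightarrow> nat \<Rightarrow> nat \<Rightarrow> 'n::finite pol_orth"
    and h :: "'n pol_orth \<Rightarrow> complex"
    and N :: real
  assumes "CARD('n) \<ge> 2"
    and "N = real CARD('n)"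
    and "irreps d u"
    and "haar_state h"
  shows "{\<phi> :: 'n pol_orth \<Rightarrow> complex. generating_functional \<phi> \<and> ad_invariant \<phi>} =
    {(\<lambda>a. levy_functional N b \<nu> (central_to_poly d u (ad_h h a))) | b \<nu>.
       b \<ge> 0 \<and> finite_measure \<nu> \<and> sets \<nu> = sets (restrict_space borel {- N..N})
       \<and> emeasure \<nu> {N} = 0}"
proof (intro Set.equalityI subsetI)
  fix \<phi> :: "'n pol_orth \<Rightarrow> complex"
  assume "\<phi> \<in> {\<phi>. generating_functional \<phi> \<and> ad_invariant \<phi>}"
  then have "generating_functional \<phi>" "ad_invariant \<phi>" by auto
  then show "\<phi> \<in> {(\<lambda>a. levy_functional N b \<nu> (central_to_poly d u (ad_h h a))) | b \<nu>.
       b \<ge> 0 \<and> finite_measure \<nu> \<and> sets \<nu> = sets (restrict_space borel {- N..N})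
       \<and> emeasure \<nu> {N} = 0}"
    unfolding assms(2) by (rule ad_invariant_generating_levy[OF assms(1,3,4)]) blast
next
  fix \<phi> :: "'n pol_orth \<Rightarrow> complex"
  assume "\<phi> \<in> {(\<lambda>a. levy_functional N b \<nu> (central_to_poly d u (ad_h h a))) | b \<nu>.
       b \<ge> 0 \<and> finite_measure \<nu> \<and> sets \<nu> = sets (restrict_space borel {- N..N})
       \<and> emeasure \<nu> {N} = 0}"
  then show "\<phi> \<in> {\<phi>. generating_functional \<phi> \<and> ad_invariant \<phi>}"
    using generating_functional_levy[OF assms(1,3,4)] unfolding assms(2) by auto
qed

end
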